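(* Let $K$ be an algebraically closed field of characteristic $0$, and let $\nu_3(G_{3,7})\subset\mathbb{P}^{34}$ be the Plücker-embedded Grassmannian of $3$-dimensional subspaces of $K^7$. Then its third secant variety (the variety of secant planes) $[\nu_3(G_{3,7})]^3$, which is expected to fill $\mathbb{P}^{34}$, does not: it is defective with defectiveness $1$, i.e. $\dim[\nu_3(G_{3,7})]^3=33$.
   Context: $G_{k,n+1}$ is the Grassmannian of $k$-dimensional linear subspaces of $K^{n+1}$, and $\nu_k:G_{k,n+1}\to \mathbb{P}(\wedge^kK^{n+1})\simeq\mathbb{P}^{\binom{n+1}{k}-1}$ is the Plücker embedding $\langle v_1,\dots,v_k\rangle\mapsto [v_1\wedge\cdots\wedge v_k]$. For a closed irreducible projective variety $X\subseteq\mathbb{P}^N$, the $s$-th (higher) secant variety $X^s$ is the closure of the union of all linear spaces spanned by $s$ points of $X$. Its expected dimension is $\min\{N,\ s\dim X+s-1\}$; $X^s$ is called defective if $\dim X^s$ is strictly smaller than this, and the defectiveness is the difference $\min\{N,\ s\dim X+s-1\}-\dim X^s$. *)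

theory Defs
  imports
    "HOL-Analysis.Analysis"
    "HOL-Library.Poly_Mapping"
    "HOL-Library.Extended_Nat"
    "HOL-Computational_Algebra.Polynomial"
    "Jordan_Normal_Form.Determinant"
begin

no_notation Matrix.vec_index (infixl \<open>$\<close> 100)


subsection \<open>Polynomials in the coordinates of a finite-dimensional coordinate space\<close>

type_synonym ('i, 'a) mvpoly = "('i \<Rightarrow>\<^sub>0 nat) \<Rightarrow>\<^sub>0 'a"

definition monomial_value :: "('i::finite \<Rightarrow>\<^sub>0 nat) \<Rightarrow> 'a::field ^ 'i \<Rightarrow> 'a" where
  "monomial_value m x = (\<Prod>i\<in>UNIV. (x $ i) ^ Poly_Mapping.lookup m i)"

definition poly_value :: "('i::finite, 'a::field) mvpoly \<Rightarrow> 'a ^ 'i \<Rightarrow> 'a" where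
  "poly_value f x = (\<Sum>m\<in>Poly_Mapping.keys f. Poly_Mapping.lookup f m * monomial_value m x)"

definition homogeneous_poly :: "('i::finite, 'a::zero) mvpoly \<Rightarrow> bool" where
  "homogeneous_poly f \<longleftrightarrow> (\<exists>d. \<forall>m\<in>Poly_Mapping.keys f. (\<Sum>i\<in>UNIV. Poly_Mapping.lookup m i) = d)"


subsection \<open>Projective spaces and the Zariski topology\<close>

text \<open>The points of the projective space of a linear subspace \<open>W\<close> are the lines in \<open>W\<close>
  through the origin.\<close>

definition proj :: "('a::field ^ 'i::finite) set \<Rightarrow> ('a ^ 'i) set set" where
  "proj W = {L. vec.subspace L \<and> vec.dim L = 1 \<and> L \<subseteq> W}"

definition proj_dim :: "('a::field ^ 'i::finite) set \<Rightarrow> nat" where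
  "proj_dim W = vec.dim W - 1"

definition zero_locus ::
  "('a::field ^ 'i::finite) set \<Rightarrow> ('i, 'a) mvpoly set \<Rightarrow> ('a ^ 'i) set set" where
  "zero_locus W F = {L \<in> proj W. \<forall>f\<in>F. \<forall>x\<in>L. poly_value f x = 0}"

text \<open>Restricting homogeneous polynomials of the whole coordinate space to \<open>W\<close> gives all
  homogeneous polynomials on \<open>W\<close>.\<close>

definition zariski :: "('a::field ^ 'i::finite) set \<Rightarrow> ('a ^ 'i) set topology" where
  "zariski W =
     topology (\<lambda>U. \<exists>F. (\<forall>f\<in>F. homogeneous_poly f) \<and> U = proj W - zero_locus W F)"

lemma monomial_value_add: "monomial_value (m + n) x = monomial_value m x * monomial_value n x"
  by (simp add: monomial_value_def lookup_add power_add prod.distrib)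

lemma poly_value_superset:
  assumes "finite A" "Poly_Mapping.keys f \<subseteq> A"
  shows "poly_value f x = (\<Sum>m\<in>A. Poly_Mapping.lookup f m * monomial_value m x)"
  unfolding poly_value_def using assms by (intro sum.mono_neutral_left) (auto simp: in_keys_iff)

lemma poly_value_add: "poly_value (f + g) x = poly_value f x + poly_value g x"
proof -
  have "Poly_Mapping.keys (f + g) \<subseteq> Poly_Mapping.keys f \<union> Poly_Mapping.keys g" by (rule Poly_Mapping.keys_add)
  then show ?thesis
    by (subst (1 2 3) poly_value_superset[where A = "Poly_Mapping.keys f \<union> Poly_Mapping.keys g"])
       (auto simp: lookup_add distrib_right sum.distrib)
qed

lemma poly_value_zero: "poly_value 0 x = 0"
  by (simp add: poly_value_def)

lemma poly_value_single: "poly_value (Poly_Mapping.single m c) x = c * monomial_value m x"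
  by (cases "c = 0") (auto simp: poly_value_def)

lemma poly_value_sum: "poly_value (sum f A) x = (\<Sum>a\<in>A. poly_value (f a) x)"
  by (induction A rule: infinite_finite_induct) (auto simp: poly_value_zero poly_value_add)

lemma poly_mapping_expand: "f = (\<Sum>m\<in>Poly_Mapping.keys f. Poly_Mapping.single m (Poly_Mapping.lookup f m))"
  by (rule poly_mapping_eqI)
     (simp add: lookup_sum lookup_single when_def in_keys_iff)

lemma poly_value_mult: "poly_value (f * g) x = poly_value f x * poly_value g x"
proof -
  have "f * g = (\<Sum>m\<in>Poly_Mapping.keys f. \<Sum>n\<in>Poly_Mapping.keys g.
          Poly_Mapping.single m (Poly_Mapping.lookup f m) * Poly_Mapping.single n (Poly_Mapping.lookup g n))"
    by (subst poly_mapping_expand[of f], subst poly_mapping_expand[of g]) (rule sum_product)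
  then show ?thesis
    by (simp add: mult_single poly_value_sum poly_value_single monomial_value_add)
       (simp add: poly_value_def sum_product algebra_simps)
qed

lemma homogeneous_poly_mult:
  fixes f g :: "('i::finite, 'a::field) mvpoly"
  assumes "homogeneous_poly f" "homogeneous_poly g"
  shows "homogeneous_poly (f * g)"
proof -
  obtain d e where d: "\<And>m. m \<in> Poly_Mapping.keys f \<Longrightarrow> (\<Sum>i\<in>UNIV. Poly_Mapping.lookup m i) = d"
    and e: "\<And>m. m \<in> Poly_Mapping.keys g \<Longrightarrow> (\<Sum>i\<in>UNIV. Poly_Mapping.lookup m i) = e"
    using assms unfolding homogeneous_poly_def by blast
  have "(\<Sum>i\<in>UNIV. Poly_Mapping.lookup m i) = d + e" if m: "m \<in> Poly_Mapping.keys (f * g)" for m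
  proof -
    obtain a b where "m = a + b" "a \<in> Poly_Mapping.keys f" "b \<in> Poly_Mapping.keys g"
      using Poly_Mapping.keys_mult[of f g] m by blast
    then show ?thesis by (simp add: lookup_add sum.distrib d e)
  qed
  then show ?thesis unfolding homogeneous_poly_def by blast
qed

text \<open>On a line through the origin a product of homogeneous polynomials vanishes only if one of
  the factors vanishes on the whole line.\<close>

lemma monomial_value_scale:
  "monomial_value m (c *s x) = c ^ (\<Sum>i\<in>UNIV. Poly_Mapping.lookup m i) * monomial_value m x"
  by (simp add: monomial_value_def power_mult_distrib prod.distrib power_sum)

lemma poly_value_scale:
  assumes "\<And>m. m \<in> Poly_Mapping.keys f \<Longrightarrow> (\<Sum>i\<in>UNIV. Poly_Mapping.lookup m i) = d"
  shows "poly_value f (c *s x) = c ^ d * poly_value f x"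
  using assms by (simp add: poly_value_def monomial_value_scale sum_distrib_left algebra_simps)

lemma proj_line:
  fixes L :: "('a::field ^ 'i::finite) set"
  assumes "L \<in> proj W"
  obtains v where "v \<noteq> 0" "L = range (\<lambda>c. c *s v)"
proof -
  obtain B where B: "B \<subseteq> L" "vec.independent B" "L \<subseteq> vec.span B" "card B = vec.dim L"
    using vec.basis_exists by blast
  then obtain v where v: "B = {v}"
    using assms by (auto simp: proj_def card_1_singleton_iff)
  have "L = vec.span {v}"
    using B v assms vec.span_minimal[of B L] by (auto simp: proj_def)
  moreover have "v \<noteq> 0" using B(2) v by auto
  ultimately show ?thesis using that by (simp add: vec.span_singleton)
qed

lemma vanishes_mult_iff:
  assumes "homogeneous_poly f" "homogeneous_poly g" "L \<in> proj W"
  shows "(\<forall>x\<in>L. poly_value (f * g) x = 0) \<longleftrightarrow>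
         (\<forall>x\<in>L. poly_value f x = 0) \<or> (\<forall>x\<in>L. poly_value g x = 0)"
proof
  assume *: "\<forall>x\<in>L. poly_value (f * g) x = 0"
  obtain d e where d: "\<And>m. m \<in> Poly_Mapping.keys f \<Longrightarrow> (\<Sum>i\<in>UNIV. Poly_Mapping.lookup m i) = d"
    and e: "\<And>m. m \<in> Poly_Mapping.keys g \<Longrightarrow> (\<Sum>i\<in>UNIV. Poly_Mapping.lookup m i) = e"
    using assms unfolding homogeneous_poly_def by blast
  obtain v where L: "L = range (\<lambda>c. c *s v)" using proj_line[OF assms(3)] by metis
  have "v \<in> L" unfolding L by (rule range_eqI[of _ _ 1]) simp
  with * have "poly_value f v = 0 \<or> poly_value g v = 0" by (auto simp: poly_value_mult)
  then show "(\<forall>x\<in>L. poly_value f x = 0) \<or> (\<forall>x\<in>L. poly_value g x = 0)"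
    by (auto simp: L poly_value_scale[OF d] poly_value_scale[OF e])
qed (auto simp: poly_value_mult)

lemma zero_locus_Un:
  assumes "\<forall>f\<in>F. homogeneous_poly f" "\<forall>g\<in>G. homogeneous_poly g"
  shows "zero_locus W F \<union> zero_locus W G = zero_locus W {f * g | f g. f \<in> F \<and> g \<in> G}"
proof (intro equalityI subsetI)
  fix L assume L: "L \<in> zero_locus W {f * g | f g. f \<in> F \<and> g \<in> G}"
  show "L \<in> zero_locus W F \<union> zero_locus W G"
  proof (rule ccontr)
    assume "L \<notin> zero_locus W F \<union> zero_locus W G"
    then obtain f g where fg: "f \<in> F" "g \<in> G"
      "\<not> (\<forall>x\<in>L. poly_value f x = 0)" "\<not> (\<forall>x\<in>L. poly_value g x = 0)"
      using L unfolding zero_locus_def by blast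
    have "L \<in> proj W" "\<forall>x\<in>L. poly_value (f * g) x = 0"
      using L fg(1,2) unfolding zero_locus_def by blast+
    then show False using vanishes_mult_iff[of f g L W] fg assms by blast
  qed
qed (auto simp: zero_locus_def poly_value_mult)

lemma zero_locus_UN: "zero_locus W (\<Union>A) = proj W \<inter> (\<Inter>F\<in>A. zero_locus W F)"
  by (auto simp: zero_locus_def)

lemma istopology_zariski:
  fixes W :: "('a::field ^ 'i::finite) set"
  shows "istopology (\<lambda>U. \<exists>F. (\<forall>f\<in>F. homogeneous_poly f) \<and> U = proj W - zero_locus W F)"
  unfolding istopology_def
proof (intro conjI allI impI)
  fix S T :: "('a ^ 'i) set set"
  assume "\<exists>F. (\<forall>f\<in>F. homogeneous_poly f) \<and> S = proj W - zero_locus W F"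
    and "\<exists>F. (\<forall>f\<in>F. homogeneous_poly f) \<and> T = proj W - zero_locus W F"
  then obtain F G where F: "\<forall>f\<in>F. homogeneous_poly f" "S = proj W - zero_locus W F"
    and G: "\<forall>g\<in>G. homogeneous_poly g" "T = proj W - zero_locus W G" by blast
  have "S \<inter> T = proj W - zero_locus W {f * g | f g. f \<in> F \<and> g \<in> G}"
    unfolding zero_locus_Un[OF F(1) G(1), symmetric] F(2) G(2) by blast
  moreover have "\<forall>h\<in>{f * g | f g. f \<in> F \<and> g \<in> G}. homogeneous_poly h"
    using F(1) G(1) homogeneous_poly_mult by blast
  ultimately show "\<exists>F. (\<forall>f\<in>F. homogeneous_poly f) \<and> S \<inter> T = proj W - zero_locus W F" by blast
next
  fix K :: "('a ^ 'i) set set set"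
  assume "\<forall>U\<in>K. \<exists>F. (\<forall>f\<in>F. homogeneous_poly f) \<and> U = proj W - zero_locus W F"
  then obtain F where F: "\<And>U. U \<in> K \<Longrightarrow> (\<forall>f\<in>F U. homogeneous_poly f) \<and> U = proj W - zero_locus W (F U)"
    by metis
  have "\<Union>K = proj W - zero_locus W (\<Union>(F ` K))"
    unfolding zero_locus_UN using F by blast
  moreover have "\<forall>f\<in>\<Union>(F ` K). homogeneous_poly f" using F by blast
  ultimately show "\<exists>F. (\<forall>f\<in>F. homogeneous_poly f) \<and> \<Union>K = proj W - zero_locus W F" by blast
qed

lemma openin_zariski:
  "openin (zariski W) U \<longleftrightarrow> (\<exists>F. (\<forall>f\<in>F. homogeneous_poly f) \<and> U = proj W - zero_locus W F)"
  unfolding zariski_def by (subst topology_inverse'[OF istopology_zariski]) (rule refl)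

lemma topspace_zariski: "topspace (zariski W) = proj W"
proof -
  have "homogeneous_poly (1 :: ('b, 'a) mvpoly)"
    by (auto simp: homogeneous_poly_def)
  moreover have "zero_locus W {1 :: ('b, 'a) mvpoly} = {}"
  proof -
    have "poly_value (1 :: ('b, 'a) mvpoly) x = 1" for x
      using poly_value_single[of 0 1 x] by (simp add: monomial_value_def)
    moreover have "0 \<in> L" if "L \<in> proj W" for L
      using that by (auto simp: proj_def vec.subspace_0)
    ultimately show ?thesis by (auto simp: zero_locus_def)
  qed
  ultimately have "openin (zariski W) (proj W)"
    unfolding openin_zariski by (intro exI[of _ "{1}"]) simp
  then show ?thesis
    using openin_subset[of "zariski W"] openin_topspace[of "zariski W"]
    unfolding openin_zariski[of W "topspace (zariski W)"] by blast
qed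

lemma closedin_zariski:
  "closedin (zariski W) C \<longleftrightarrow> (\<exists>F. (\<forall>f\<in>F. homogeneous_poly f) \<and> C = zero_locus W F)"
proof -
  have "zero_locus W F \<subseteq> proj W" for F by (auto simp: zero_locus_def)
  then show ?thesis
    unfolding closedin_def openin_zariski topspace_zariski by (metis double_diff Diff_subset equalityD1)
qed


subsection \<open>Dimension\<close>

definition irreducible_in :: "'a topology \<Rightarrow> 'a set \<Rightarrow> bool" where
  "irreducible_in T S \<longleftrightarrow> S \<noteq> {} \<and> S \<subseteq> topspace T \<and>
     (\<forall>A B. closedin T A \<and> closedin T B \<and> S \<subseteq> A \<union> B \<longrightarrow> S \<subseteq> A \<or> S \<subseteq> B)"

text \<open>Krull dimension of a topological space; the empty space gets the value \<open>0\<close>.\<close>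

definition krull_dim :: "'a topology \<Rightarrow> enat" where
  "krull_dim T = Sup {enat n | n. \<exists>C.
     (\<forall>i\<le>n. closedin T (C i) \<and> irreducible_in T (C i)) \<and> (\<forall>i<n. C i \<subset> C (Suc i))}"

definition variety_dim ::
  "('a::field ^ 'i::finite) set \<Rightarrow> ('a ^ 'i) set set \<Rightarrow> enat" where
  "variety_dim W X = krull_dim (subtopology (zariski W) X)"


subsection \<open>Secant varieties and defectiveness\<close>

text \<open>In the following, \<open>X\<close> is a subset of the ambient projective space \<open>proj W\<close> and \<open>s\<close> is
  positive. The \<open>s\<close> points may coincide: such a span is contained in the span of \<open>s\<close> distinct
  points as soon as \<open>X\<close> has that many. Subtraction on \<^typ>\<open>enat\<close> truncates, so \<open>defectiveness\<close>
  is meaningful because the expected dimension bounds the actual one.\<close>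

definition secant_variety ::
  "('a::field ^ 'i::finite) set \<Rightarrow> ('a ^ 'i) set set \<Rightarrow> nat \<Rightarrow> ('a ^ 'i) set set" where
  "secant_variety W X s =
     zariski W closure_of (\<Union>p\<in>{..<s} \<rightarrow> X. proj (vec.span (\<Union>i<s. p i)))"

definition expected_dim ::
  "('a::field ^ 'i::finite) set \<Rightarrow> ('a ^ 'i) set set \<Rightarrow> nat \<Rightarrow> enat" where
  "expected_dim W X s = min (enat (proj_dim W)) (enat s * variety_dim W X + enat s - 1)"

definition defective ::
  "('a::field ^ 'i::finite) set \<Rightarrow> ('a ^ 'i) set set \<Rightarrow> nat \<Rightarrow> bool" where
  "defective W X s \<longleftrightarrow> variety_dim W (secant_variety W X s) < expected_dim W X s"

definition defectiveness ::
  "('a::field ^ 'i::finite) set \<Rightarrow> ('a ^ 'i) set set \<Rightarrow> nat \<Rightarrow> enat" where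
  "defectiveness W X s = expected_dim W X s - variety_dim W (secant_variety W X s)"


subsection \<open>Exterior powers and the Pluecker embedding\<close>

text \<open>The exterior algebra of \<open>'a ^ 'n\<close> has a basis indexed by the subsets \<open>S\<close> of \<open>'n\<close>, namely
  the wedge products of the basis vectors \<open>e_i\<close>, \<open>i \<in> S\<close>, taken in increasing order. The
  \<open>k\<close>-th exterior power is the span of those with \<open>card S = k\<close>.\<close>

definition exterior_power :: "nat \<Rightarrow> ('a::field ^ ('n::finite set)) set" where
  "exterior_power k = {w. \<forall>S. card S \<noteq> k \<longrightarrow> w $ S = 0}"

text \<open>The coordinate of a wedge product at \<open>S\<close> is the minor with columns \<open>S\<close> of the matrix whose
  rows are the factors.\<close>

definition wedge :: "('a::field ^ 'n::{finite,linorder}) list \<Rightarrow> 'a ^ ('n set)" where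
  "wedge vs = (\<chi> S. if card S = length vs
     then Determinant.det (Matrix.mat (length vs) (length vs) (\<lambda>(i, j). (vs ! i) $ (sorted_list_of_set S ! j)))
     else 0)"

definition grassmannian :: "nat \<Rightarrow> ('a::field ^ 'n::finite) set set" where
  "grassmannian k = {U. vec.subspace U \<and> vec.dim U = k}"

definition is_basis :: "('a::field ^ 'n::finite) list \<Rightarrow> ('a ^ 'n) set \<Rightarrow> bool" where
  "is_basis vs U \<longleftrightarrow> distinct vs \<and> vec.independent (set vs) \<and> vec.span (set vs) = U"

definition plucker :: "('a::field ^ 'n::{finite,linorder}) set \<Rightarrow> ('a ^ ('n set)) set" where
  "plucker U = (THE L. \<exists>vs. is_basis vs U \<and> L = vec.span {wedge vs})"

lemma wedge_change_basis:
  fixes vs ws :: "('a::field ^ 'n::{finite,linorder}) list"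
  assumes len: "length ws = length vs" and sub: "set ws \<subseteq> vec.span (set vs)"
    and dist: "distinct vs"
  shows "\<exists>c. wedge ws = c *s wedge vs"
proof -
  define k where "k = length vs"
  have "\<exists>u. ws ! i = (\<Sum>v\<in>set vs. u v *s v)" if "i < k" for i
  proof -
    have "ws ! i \<in> vec.span (set vs)" using that sub len k_def by (metis nth_mem subsetD)
    then show ?thesis using vec.span_finite[of "set vs"] by auto
  qed
  then obtain u where u: "\<And>i. i < k \<Longrightarrow> ws ! i = (\<Sum>v\<in>set vs. u i v *s v)" by metis
  have w: "ws ! i = (\<Sum>j<k. u i (vs ! j) *s (vs ! j))" if "i < k" for i
    using u[OF that] dist bij_betw_nth[OF dist, of "{..<k}" "set vs"]
    by (simp add: k_def sum.reindex_bij_betw[of "(!) vs" "{..<length vs}" "set vs" "\<lambda>v. u i v *s v"])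
  define M where "M = Matrix.mat k k (\<lambda>(i, j). u i (vs ! j))"
  have "wedge ws $ S = Determinant.det M * wedge vs $ S" for S
  proof -
    let ?V = "Matrix.mat k k (\<lambda>(i, j). (vs ! i) $ (sorted_list_of_set S ! j))"
    have "Matrix.mat k k (\<lambda>(i, j). (ws ! i) $ (sorted_list_of_set S ! j)) = M * ?V"
      by (rule eq_matI) (auto simp: M_def w scalar_prod_def lessThan_atLeast0)
    moreover have "Determinant.det (M * ?V) = Determinant.det M * Determinant.det ?V"
      by (rule Determinant.det_mult[of _ k]) (auto simp: M_def)
    ultimately show ?thesis by (simp add: wedge_def len flip: k_def)
  qed
  then have "wedge ws = Determinant.det M *s wedge vs" by (simp add: Finite_Cartesian_Product.vec_eq_iff)
  then show ?thesis by blast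
qed

lemma plucker_eq:
  assumes "is_basis vs U"
  shows "plucker U = vec.span {wedge vs}"
proof -
  have sub: "vec.span {wedge ws} \<subseteq> vec.span {wedge vs}" if bases: "is_basis vs U" "is_basis ws U" for vs ws
  proof -
    have "length ws = length vs"
      using that vec.dim_span_eq_card_independent[of "set vs"] vec.dim_span_eq_card_independent[of "set ws"]
      by (simp add: is_basis_def distinct_card)
    moreover have "set ws \<subseteq> vec.span (set vs)"
      using that vec.span_superset[of "set ws"] by (simp add: is_basis_def)
    ultimately obtain c where "wedge ws = c *s wedge vs"
      using wedge_change_basis[of ws vs] bases(1) unfolding is_basis_def by blast
    then have "wedge ws \<in> vec.span {wedge vs}"
      by (simp add: vec.span_scale vec.span_base)
    then show ?thesis by (simp add: vec.span_minimal)
  qed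
  show ?thesis
    unfolding plucker_def proof (rule the_equality)
    show "\<exists>vs'. is_basis vs' U \<and> vec.span {wedge vs} = vec.span {wedge vs'}"
      using assms by blast
  next
    fix L assume "\<exists>ws. is_basis ws U \<and> L = vec.span {wedge ws}"
    then obtain ws where "is_basis ws U" "L = vec.span {wedge ws}" by blast
    then show "L = vec.span {wedge vs}" using sub[OF assms] sub[OF _ assms] by blast
  qed
qed

end

theory Submission
  imports Defs "HOL-Library.Function_Algebras"
begin

text \<open>
  Let \<open>W\<close> be the third exterior power of \<open>K\<^sup>7\<close>, of dimension 35. Two facts determine the dimension of the
  third secant variety.

  It is not all of the projective space of \<open>W\<close>. A trivector \<open>\<omega>\<close> defines the bilinear form
  \<open>(x, y) \<mapsto> \<omega> \<and> x \<and> y\<close> on the bivectors, a space of dimension 21. If \<open>\<omega> = u \<and> v \<and> w\<close> is decomposable,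
  every bivector divisible by \<open>u\<close>, \<open>v\<close> or \<open>w\<close> is in the kernel, so the form comes from the bivectors of a
  space of dimension 4 and has rank at most 6 (\<open>vol_row_rank\<close>). On a sum of three decomposable trivectors
  the rank is at most 18 and the determinant vanishes (\<open>det_flattening_secant\<close>). On the trivector of
  the Fano plane the form is nondegenerate (\<open>det_flattening_fano\<close>). Hence the determinant is an equation
  of the secant variety that is not identically zero, and the dimension is at most 33.

  The dimension is at least 33. Sums of three decomposable trivectors are parametrized by nine vectors
  of \<open>K\<^sup>7\<close>, and the derivative of this parametrization at an explicit point has rank at least 34
  (\<open>secant_point_rank\<close>). In the same way the Grassmannian has dimension at least 11, which makes the
  expected dimension 34.

  Both bounds need some dimension theory for the Krull dimension of the Zariski topology, and both come
  from algebraic independence. In a chain of irreducible sets, functions that vanish on one member but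
  not on the next are algebraically independent on the largest one (\<open>prime_chain_indep\<close>), and more
  functions than there are generators of an algebra are never algebraically independent
  (\<open>alg_dependent\<close>). This bounds the length of chains of irreducible cones and gives
  \<open>variety_dim_proper_le\<close>. Conversely, the images of an increasing sequence of linear spaces of parameters
  have strictly increasing closures as long as the derivative grows in rank: a relation that holds
  because of a lack of parameters is violated as soon as one more independent direction is available
  (\<open>variety_dim_ge\<close>).
\<close>

section \<open>Algebras of functions and chains of irreducible sets\<close>

inductive_set alg :: "('x \<Rightarrow> 'a::field) set \<Rightarrow> ('x \<Rightarrow> 'a) set" for G where
  const: "(\<lambda>_. c) \<in> alg G"
| gen: "g \<in> G \<Longrightarrow> g \<in> alg G"
| add: "f \<in> alg G \<Longrightarrow> g \<in> alg G \<Longrightarrow> (\<lambda>x. f x + g x) \<in> alg G"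
| mult: "f \<in> alg G \<Longrightarrow> g \<in> alg G \<Longrightarrow> (\<lambda>x. f x * g x) \<in> alg G"

lemma alg_sum: "(\<And>i. i \<in> I \<Longrightarrow> f i \<in> alg G) \<Longrightarrow> (\<lambda>x. \<Sum>i\<in>I. f i x) \<in> alg G"
  by (induction I rule: infinite_finite_induct) (auto intro: alg.intros)

lemma alg_prod: "(\<And>i. i \<in> I \<Longrightarrow> f i \<in> alg G) \<Longrightarrow> (\<lambda>x. \<Prod>i\<in>I. f i x) \<in> alg G"
  by (induction I rule: infinite_finite_induct) (auto intro: alg.intros)

lemma alg_power: "f \<in> alg G \<Longrightarrow> (\<lambda>x. f x ^ n) \<in> alg G"
  by (induction n) (auto intro: alg.intros)

lemma alg_comp:
  assumes "f \<in> alg G" and "\<And>g. g \<in> G \<Longrightarrow> (\<lambda>x. g (h x)) \<in> alg H"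
  shows "(\<lambda>x. f (h x)) \<in> alg H"
  using assms(1) by induction (auto intro: alg.intros assms(2))

lemma alg_poly:
  assumes "f \<in> alg {\<lambda>s::'a::field. s}"
  shows "\<exists>q. \<forall>s. f s = poly q s"
  using assms
proof induction
  case (const c) show ?case by (rule exI[of _ "[:c:]"]) simp
next
  case (gen g) then show ?case by (intro exI[of _ "[:0, 1:]"]) simp
next
  case (add f g) then show ?case by (metis poly_add)
next
  case (mult f g) then show ?case by (metis poly_mult)
qed

text \<open>The algebraic form of irreducibility: the functions of \<open>R\<close> vanishing on \<open>A\<close> form a prime
  ideal, or all of \<open>R\<close>.\<close>

definition prime_on :: "('x \<Rightarrow> 'a::field) set \<Rightarrow> 'x set \<Rightarrow> bool" where
  "prime_on R A \<longleftrightarrow> (\<forall>f\<in>R. \<forall>g\<in>R. (\<forall>x\<in>A. f x * g x = 0) \<longrightarrow> (\<forall>x\<in>A. f x = 0) \<or> (\<forall>x\<in>A. g x = 0))"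

lemma prime_onD:
  "prime_on R A \<Longrightarrow> f \<in> R \<Longrightarrow> g \<in> R \<Longrightarrow> \<forall>x\<in>A. f x * g x = 0 \<Longrightarrow>
    (\<forall>x\<in>A. f x = 0) \<or> (\<forall>x\<in>A. g x = 0)"
  unfolding prime_on_def by blast

text \<open>A function that is nonzero at \<open>x\<close> and one that is nonzero at \<open>y\<close> restrict to two nonzero
  polynomials in the parameter of the curve, and over an infinite field their product has a nonroot.\<close>

lemma prime_on_curves:
  assumes inf: "infinite (UNIV :: 'a::field set)"
    and curve: "\<And>x y. x \<in> A \<Longrightarrow> y \<in> A \<Longrightarrow>
      \<exists>\<gamma> s t. \<gamma> s = x \<and> \<gamma> t = y \<and> range \<gamma> \<subseteq> A \<and> (\<forall>f\<in>R. (\<lambda>u. f (\<gamma> u)) \<in> alg {\<lambda>u::'a. u})"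
  shows "prime_on R A"
  unfolding prime_on_def
proof (intro ballI impI)
  fix f g assume fg: "f \<in> R" "g \<in> R" and zero: "\<forall>x\<in>A. f x * g x = 0"
  show "(\<forall>x\<in>A. f x = 0) \<or> (\<forall>x\<in>A. g x = 0)"
  proof (rule ccontr)
    assume "\<not> ((\<forall>x\<in>A. f x = 0) \<or> (\<forall>x\<in>A. g x = 0))"
    then obtain x y where xy: "x \<in> A" "f x \<noteq> 0" "y \<in> A" "g y \<noteq> 0" by blast
    obtain \<gamma> s t where \<gamma>: "\<gamma> s = x" "\<gamma> t = y" "range \<gamma> \<subseteq> A"
      "\<forall>f\<in>R. (\<lambda>u. f (\<gamma> u)) \<in> alg {\<lambda>u::'a. u}" using curve[OF xy(1,3)] by blast
    obtain p where p: "\<And>u. f (\<gamma> u) = poly p u"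
      using alg_poly[of "\<lambda>u. f (\<gamma> u)"] \<gamma>(4) fg(1) by auto
    obtain q where q: "\<And>u. g (\<gamma> u) = poly q u"
      using alg_poly[of "\<lambda>u. g (\<gamma> u)"] \<gamma>(4) fg(2) by auto
    note pq = p q
    have "p \<noteq> 0" "q \<noteq> 0" using xy \<gamma> pq(1)[of s] pq(2)[of t] by auto
    then have "finite {u. poly (p * q) u = 0}" by (intro poly_roots_finite) simp
    moreover have "poly (p * q) u = 0" for u using zero \<gamma>(3) pq by (auto simp flip: pq)
    ultimately have "finite (UNIV :: 'a set)" by (simp only: simp_thms UNIV_def)
    then show False using inf by blast
  qed
qed

text \<open>A monomial in a list of functions is given by a list of exponents of the same length, so that
  splitting off the last variable of a polynomial is pattern matching on the list. Bounding each
  exponent separately, instead of the total degree, makes the count of monomials a power.\<close>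

definition exp_box :: "nat \<Rightarrow> nat \<Rightarrow> nat list set" where
  "exp_box n d = {es. set es \<subseteq> {..d} \<and> length es = n}"

definition fmon :: "('x \<Rightarrow> 'a::field) list \<Rightarrow> nat list \<Rightarrow> 'x \<Rightarrow> 'a" where
  "fmon fs es x = (\<Prod>(f, e)\<leftarrow>zip fs es. f x ^ e)"

lemma fmon_Nil [simp]: "fmon fs [] x = 1" "fmon [] es x = 1"
  and fmon_Cons [simp]: "fmon (f # fs) (e # es) x = f x ^ e * fmon fs es x"
  by (simp_all add: fmon_def)

lemma finite_exp_box [simp]: "finite (exp_box n d)"
  unfolding exp_box_def by (rule finite_lists_length_eq) simp

lemma card_exp_box: "card (exp_box n d) = (d + 1) ^ n"
  unfolding exp_box_def by (subst card_lists_length_eq) simp_all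

lemma exp_box_0: "exp_box 0 d = {[]}" by (auto simp: exp_box_def)

lemma exp_box_Suc: "exp_box (Suc n) d = (\<lambda>(e, es). e # es) ` ({..d} \<times> exp_box n d)"
  by (auto simp: exp_box_def length_Suc_conv image_iff)

lemma sum_exp_box_Suc: "(\<Sum>es\<in>exp_box (Suc n) d. F es) = (\<Sum>e\<le>d. \<Sum>es\<in>exp_box n d. F (e # es))"
proof -
  have "(\<Sum>es\<in>exp_box (Suc n) d. F es) = (\<Sum>(e, es)\<in>{..d} \<times> exp_box n d. F (e # es))"
    unfolding exp_box_Suc by (subst sum.reindex) (auto simp: inj_on_def case_prod_beta)
  then show ?thesis by (simp add: sum.cartesian_product)
qed

lemma fmon_alg:
  assumes "set fs \<subseteq> alg G"
  shows "fmon fs es \<in> alg G"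
  using assms
proof (induction fs arbitrary: es)
  case Nil
  then show ?case by (auto simp: fmon_def[abs_def] intro: alg.const)
next
  case (Cons f fs)
  show ?case
  proof (cases es)
    case Nil then show ?thesis by (auto simp: fmon_def[abs_def] intro: alg.const)
  next
    case (Cons e es')
    have "(\<lambda>x. f x ^ e * fmon fs es' x) \<in> alg G"
      using Cons.prems Cons.IH by (intro alg.mult alg_power) auto
    moreover have "fmon (f # fs) es = (\<lambda>x. f x ^ e * fmon fs es' x)"
      by (simp add: fun_eq_iff \<open>es = e # es'\<close>)
    ultimately show ?thesis by simp
  qed
qed

text \<open>Algebraic independence of the restrictions to \<open>A\<close>.\<close>

definition indep_on :: "('x \<Rightarrow> 'a::field) list \<Rightarrow> 'x set \<Rightarrow> bool" where
  "indep_on fs A \<longleftrightarrow> (\<forall>d c. (\<forall>x\<in>A. (\<Sum>es\<in>exp_box (length fs) d. c es * fmon fs es x) = 0) \<longrightarrow>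
     (\<forall>es\<in>exp_box (length fs) d. c es = 0))"

text \<open>A chain of irreducible sets, largest first, together with functions that witness its strictness:
  each vanishes on the next smaller set but not on its own. The smallest set is only required to be
  nonempty because no independence is claimed of the constants on it.\<close>

inductive prime_chain :: "('x \<Rightarrow> 'a::field) set \<Rightarrow> 'x set \<Rightarrow> ('x \<Rightarrow> 'a) list \<Rightarrow> bool" for R where
  base: "A \<noteq> {} \<Longrightarrow> prime_chain R A []"
| step: "prime_chain R B fs \<Longrightarrow> B \<subseteq> A \<Longrightarrow> prime_on R A \<Longrightarrow> f \<in> R \<Longrightarrow> \<forall>x\<in>B. f x = 0 \<Longrightarrow>
    \<exists>x\<in>A. f x \<noteq> 0 \<Longrightarrow> prime_chain R A (f # fs)"

lemma prime_chain_subset: "prime_chain R A fs \<Longrightarrow> set fs \<subseteq> R"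
  by (induction rule: prime_chain.induct) auto

text \<open>A relation on \<open>A\<close> is a polynomial in the topmost function \<open>f\<close> with coefficients in the others.
  Restricted to \<open>B\<close>, where \<open>f\<close> vanishes, it says that the constant coefficient is a relation
  among the remaining functions, hence trivial by induction. Then \<open>f\<close> divides the relation and can
  be cancelled because the vanishing ideal of \<open>A\<close> is prime, and the next coefficient is treated in
  the same way.\<close>

lemma prime_chain_indep:
  assumes "prime_chain (alg G) A fs"
  shows "indep_on fs A"
  using assms
proof induction
  case (base A)
  then show ?case by (auto simp: indep_on_def exp_box_0)
next
  case (step B fs A f)
  let ?P = "\<lambda>d c x. \<Sum>es\<in>exp_box (length fs) d. c es * fmon fs es x"
  have IH: "\<forall>es\<in>exp_box (length fs) d. c es = 0" if "\<forall>x\<in>B. ?P d c x = 0" for d c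
    using step.IH that unfolding indep_on_def by blast
  have Palg: "?P d c \<in> alg G" for d c
    using prime_chain_subset[OF step.hyps(1)]
    by (intro alg_sum alg.mult alg.const fmon_alg)
  have *: "\<forall>k\<le>n. \<forall>es\<in>exp_box (length fs) d. c k es = 0"
    if "\<forall>x\<in>A. (\<Sum>k\<le>n. ?P d (c k) x * f x ^ k) = 0" for n d and c :: "nat \<Rightarrow> nat list \<Rightarrow> 'b"
    using that
  proof (induction n arbitrary: c)
    case 0
    then show ?case using IH[where c = "c 0" and d = d] step.hyps(2) by auto
  next
    case (Suc n)
    let ?Q = "\<lambda>x. \<Sum>k\<le>n. ?P d (c (Suc k)) x * f x ^ k"
    have split: "(\<Sum>k\<le>Suc n. ?P d (c k) x * f x ^ k) = ?P d (c 0) x + f x * ?Q x" for x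
      by (simp only: sum.atMost_Suc_shift) (simp add: sum_distrib_left algebra_simps)
    have "\<forall>x\<in>B. ?P d (c 0) x = 0"
    proof
      fix x assume x: "x \<in> B"
      then have "?P d (c 0) x + f x * ?Q x = 0"
        using Suc.prems step.hyps(2) unfolding split by blast
      moreover have "f x = 0" using step.hyps(5) x by blast
      ultimately show "?P d (c 0) x = 0" by simp
    qed
    then have c0: "\<forall>es\<in>exp_box (length fs) d. c 0 es = 0" by (rule IH)
    then have "\<forall>x\<in>A. f x * ?Q x = 0" using Suc.prems unfolding split by simp
    moreover have "?Q \<in> alg G" by (intro alg_sum alg.mult alg_power Palg step.hyps)
    ultimately have "(\<forall>x\<in>A. f x = 0) \<or> (\<forall>x\<in>A. ?Q x = 0)"
      by (intro prime_onD[OF step.hyps(3,4)])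
    then have "\<forall>x\<in>A. ?Q x = 0" using step.hyps(6) by blast
    then have "\<forall>k\<le>n. \<forall>es\<in>exp_box (length fs) d. c (Suc k) es = 0" by (rule Suc.IH)
    then show ?case using c0 by (metis Suc_le_mono not0_implies_Suc)
  qed
  show ?case unfolding indep_on_def
  proof (intro allI impI)
    fix d c assume "\<forall>x\<in>A. (\<Sum>es\<in>exp_box (length (f # fs)) d. c es * fmon (f # fs) es x) = 0"
    then have "\<forall>x\<in>A. (\<Sum>k\<le>d. ?P d (\<lambda>es. c (k # es)) x * f x ^ k) = 0"
      by (simp add: sum_exp_box_Suc sum_distrib_left sum_distrib_right mult_ac)
    then have "\<forall>k\<le>d. \<forall>es\<in>exp_box (length fs) d. c (k # es) = 0" by (rule *)
    then show "\<forall>es\<in>exp_box (length (f # fs)) d. c es = 0" by (auto simp: exp_box_Suc)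
  qed
qed

lemma indep_on_mono: "indep_on fs A \<Longrightarrow> A \<subseteq> B \<Longrightarrow> indep_on fs B"
  unfolding indep_on_def by blast

section \<open>Algebraic dependence\<close>

text \<open>Functions form a vector space, so that the dimension count below can use the linear algebra of
  an arbitrary \<^locale>\<open>vector_space\<close>.\<close>

interpretation fun_vs: vector_space "\<lambda>c (f :: 'x \<Rightarrow> 'a::field) x. c * f x"
  by standard (auto simp: fun_eq_iff algebra_simps)

lemma sum_fun_apply: "(\<Sum>i\<in>I. f i) x = (\<Sum>i\<in>I. f i x :: 'a::comm_monoid_add)"
  by (induction I rule: infinite_finite_induct) auto

lemma (in vector_space) family_dependent:
  assumes "finite I" "finite T" "u ` I \<subseteq> span T" "card T < card I"
  shows "\<exists>c. (\<exists>i\<in>I. c i \<noteq> 0) \<and> (\<Sum>i\<in>I. scale (c i) (u i)) = 0"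
proof (cases "inj_on u I")
  case True
  then have "card (u ` I) > card T" using assms by (simp add: card_image)
  then have "dependent (u ` I)" using independent_span_bound[of T "u ` I"] assms by fastforce
  then obtain c where "\<exists>v\<in>u ` I. c v \<noteq> 0" "(\<Sum>v\<in>u ` I. scale (c v) v) = 0"
    using dependent_finite[of "u ` I"] assms(1) by auto
  then show ?thesis using True by (intro exI[of _ "c \<circ> u"]) (auto simp: sum.reindex)
next
  case False
  then obtain i j where ij: "i \<in> I" "j \<in> I" "i \<noteq> j" "u i = u j" by (auto simp: inj_on_def)
  define c where "c = (\<lambda>k. if k = i then 1 else if k = j then - 1 else (0::'a))"
  have "(\<Sum>k\<in>I. scale (c k) (u k)) = (\<Sum>k\<in>{i, j}. scale (c k) (u k))"
    using ij assms(1) by (intro sum.mono_neutral_right) (auto simp: c_def)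
  also have "\<dots> = 0" using ij by (simp add: c_def)
  finally show ?thesis using ij by (intro exI[of _ c]) (auto simp: c_def)
qed

lemma fmon_zero: "fmon fs (replicate n 0) x = 1"
proof (induction fs arbitrary: n)
  case (Cons f fs) then show ?case by (cases n) auto
qed auto

lemma fmon_mult:
  "length es = length fs \<Longrightarrow> length es' = length fs \<Longrightarrow>
   fmon fs es x * fmon fs es' x = fmon fs (map2 (+) es es') x"
proof (induction fs arbitrary: es es')
  case (Cons f fs)
  then show ?case by (auto simp: length_Suc_conv power_add algebra_simps)
qed auto

definition mspan :: "('x \<Rightarrow> 'a::field) list \<Rightarrow> nat \<Rightarrow> ('x \<Rightarrow> 'a) set" where
  "mspan gs d = fun_vs.span (fmon gs ` exp_box (length gs) d)"

lemma mspan_mono: "d \<le> e \<Longrightarrow> mspan gs d \<subseteq> mspan gs e"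
  unfolding mspan_def by (intro fun_vs.span_mono image_mono) (auto simp: exp_box_def)

lemma mspan_const: "(\<lambda>x. c) \<in> mspan gs d"
proof -
  have "fmon gs (replicate (length gs) 0) \<in> mspan gs d"
    unfolding mspan_def by (intro fun_vs.span_base imageI) (auto simp: exp_box_def)
  then have "(\<lambda>x. c * fmon gs (replicate (length gs) 0) x) \<in> mspan gs d"
    unfolding mspan_def by (rule fun_vs.span_scale)
  then show ?thesis by (simp add: fmon_zero)
qed

lemma mspan_add: "f \<in> mspan gs d \<Longrightarrow> g \<in> mspan gs d \<Longrightarrow> (\<lambda>x. f x + g x) \<in> mspan gs d"
  unfolding mspan_def using fun_vs.span_add[of f _ g] by (simp add: plus_fun_def)

lemma mspan_mult:
  assumes "f \<in> mspan gs d" "g \<in> mspan gs e"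
  shows "(\<lambda>x. f x * g x) \<in> mspan gs (d + e)"
proof -
  have mm: "(\<lambda>x. fmon gs es x * fmon gs es' x) \<in> mspan gs (d + e)"
    if "es \<in> exp_box (length gs) d" "es' \<in> exp_box (length gs) e" for es es'
  proof -
    have "map2 (+) es es' \<in> exp_box (length gs) (d + e)"
      using that by (auto simp: exp_box_def in_set_zip subset_eq Ball_def intro!: add_mono)
    then show ?thesis using that unfolding mspan_def
      by (subst fmon_mult) (auto simp: exp_box_def intro!: fun_vs.span_base)
  qed
  have step: "(\<lambda>x. fmon gs es x * g x) \<in> mspan gs (d + e)" if "es \<in> exp_box (length gs) d" for es
    using assms(2) unfolding mspan_def
  proof (induction rule: fun_vs.span_induct_alt)
    case base
    then show ?case using fun_vs.span_zero by (simp add: zero_fun_def)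
  next
    case (step c h k)
    then obtain es' where es': "h = fmon gs es'" "es' \<in> exp_box (length gs) e" by blast
    have "(\<lambda>x. c * (fmon gs es x * h x) + fmon gs es x * k x) \<in> mspan gs (d + e)"
      using mm[OF that es'(2)] step(2) unfolding es'(1)
      by (intro mspan_add) (auto simp: mspan_def intro: fun_vs.span_scale)
    then show ?case by (simp add: mspan_def algebra_simps)
  qed
  show ?thesis using assms(1) unfolding mspan_def
  proof (induction rule: fun_vs.span_induct_alt)
    case base
    then show ?case using fun_vs.span_zero by (simp add: zero_fun_def)
  next
    case (step c h k)
    then obtain es where es: "h = fmon gs es" "es \<in> exp_box (length gs) d" by blast
    have "(\<lambda>x. c * (h x * g x) + k x * g x) \<in> mspan gs (d + e)"
      using \<open>es \<in> _ \<Longrightarrow> _\<close>[OF es(2)] step(2) unfolding es(1)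
      by (intro mspan_add) (auto simp: mspan_def intro: fun_vs.span_scale)
    then show ?case by (simp add: mspan_def algebra_simps)
  qed
qed

lemma mspan_gen:
  assumes "g \<in> set gs"
  shows "g \<in> mspan gs 1"
proof -
  have "\<exists>es\<in>exp_box (length gs) 1. \<forall>x. fmon gs es x = g x" using assms
  proof (induction gs)
    case (Cons h gs)
    show ?case
    proof (cases "g = h")
      case True
      then show ?thesis
        by (intro bexI[of _ "1 # replicate (length gs) 0"]) (auto simp: exp_box_def fmon_zero)
    next
      case False
      then obtain es where "es \<in> exp_box (length gs) 1" "\<forall>x. fmon gs es x = g x" using Cons by auto
      then show ?thesis by (intro bexI[of _ "0 # es"]) (auto simp: exp_box_def)
    qed
  qed simp
  then obtain es where "es \<in> exp_box (length gs) 1" "fmon gs es = g" by (auto simp: fun_eq_iff)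
  then show ?thesis unfolding mspan_def by (auto intro: fun_vs.span_base)
qed

lemma alg_mspan:
  assumes "f \<in> alg (set gs)"
  shows "\<exists>d. f \<in> mspan gs d"
  using assms
proof induction
  case (const c) then show ?case using mspan_const by blast
next
  case (gen g) then show ?case using mspan_gen by blast
next
  case (add f g)
  then obtain d e where "f \<in> mspan gs d" "g \<in> mspan gs e" by blast
  then have "f \<in> mspan gs (max d e)" "g \<in> mspan gs (max d e)"
    using mspan_mono[of d "max d e" gs] mspan_mono[of e "max d e" gs] by auto
  then show ?case using mspan_add by blast
next
  case (mult f g) then show ?case using mspan_mult by blast
qed

lemma mspan_power: "f \<in> mspan gs d \<Longrightarrow> (\<lambda>x. f x ^ k) \<in> mspan gs (k * d)"
proof (induction k)
  case 0 then show ?case by (simp add: mspan_const)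
next
  case (Suc k) then show ?case using mspan_mult[of f gs d "\<lambda>x. f x ^ k" "k * d"] by simp
qed

lemma fmon_mspan:
  assumes "set fs \<subseteq> mspan gs D" "es \<in> exp_box (length fs) d"
  shows "fmon fs es \<in> mspan gs (length fs * (d * D))"
  using assms
proof (induction fs arbitrary: es)
  case Nil
  then show ?case using mspan_const[of 1] by (simp add: fmon_def[abs_def])
next
  case (Cons f fs)
  then obtain e es' where es: "es = e # es'" "e \<le> d" "es' \<in> exp_box (length fs) d"
    by (auto simp: exp_box_Suc)
  have "(\<lambda>x. f x ^ e) \<in> mspan gs (d * D)"
    using mspan_power[of f gs D e] mspan_mono[of "e * D" "d * D" gs] es(2) Cons.prems by auto
  from mspan_mult[OF this Cons.IH[OF _ es(3)]] Cons.prems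
  have "(\<lambda>x. f x ^ e * fmon fs es' x) \<in> mspan gs (length (f # fs) * (d * D))" by simp
  moreover have "fmon (f # fs) es = (\<lambda>x. f x ^ e * fmon fs es' x)"
    by (simp add: fun_eq_iff es(1))
  ultimately show ?case by simp
qed

text \<open>With \<open>N\<close> generators, the monomials with exponents at most \<open>d\<close> in \<open>m\<close> functions of degree at most
  \<open>D\<close> lie in a space of dimension at most \<open>(m D d + 1) ^ N\<close>. There are \<open>(d + 1) ^ m\<close> of them, which
  is more when \<open>m > N\<close> and \<open>d\<close> is large.\<close>

lemma alg_dependent:
  assumes fs: "set fs \<subseteq> alg (set gs)" and len: "length gs < length fs"
  shows "\<not> indep_on fs UNIV"
proof -
  define m N where "m = length fs" and "N = length gs"
  have "\<exists>D. set fs \<subseteq> mspan gs D" using fs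
  proof (induction fs)
    case (Cons f fs)
    then obtain D where D: "set fs \<subseteq> mspan gs D" by auto
    obtain E where E: "f \<in> mspan gs E" using alg_mspan Cons by force
    have "set (f # fs) \<subseteq> mspan gs (max D E)"
      using D E mspan_mono[of D "max D E" gs] mspan_mono[of E "max D E" gs] by auto
    then show ?case by blast
  qed auto
  then obtain D where D: "set fs \<subseteq> mspan gs D" by blast
  \<comment> \<open>this \<open>d\<close> makes \<open>(m D d + 1) ^ N < (d + 1) ^ (N + 1)\<close>\<close>
  define b where "b = m * D + 1"
  define d where "d = b ^ N"
  have "m * (d * D) + 1 \<le> b * (d + 1)" by (simp add: b_def algebra_simps)
  then have "(m * (d * D) + 1) ^ N \<le> b ^ N * (d + 1) ^ N"
    by (metis power_mono power_mult_distrib zero_le)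
  also have "\<dots> < (d + 1) * (d + 1) ^ N" by (simp add: d_def)
  also have "\<dots> \<le> (d + 1) ^ m" using len unfolding m_def N_def power_Suc[symmetric]
    by (intro power_increasing) auto
  finally have lt: "(m * (d * D) + 1) ^ N < (d + 1) ^ m" .
  have "\<exists>c. (\<exists>es\<in>exp_box m d. c es \<noteq> 0) \<and> (\<Sum>es\<in>exp_box m d. (\<lambda>x. c es * fmon fs es x)) = 0"
  proof (rule fun_vs.family_dependent)
    show "fmon fs ` exp_box m d \<subseteq> fun_vs.span (fmon gs ` exp_box N (m * (d * D)))"
      using fmon_mspan[OF D] unfolding mspan_def m_def N_def by blast
    have "card (fmon gs ` exp_box N (m * (d * D))) \<le> (m * (d * D) + 1) ^ N"
      using card_image_le[of "exp_box N (m * (d * D))" "fmon gs"] by (simp add: card_exp_box)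
    then show "card (fmon gs ` exp_box N (m * (d * D))) < card (exp_box m d)"
      using lt by (simp add: card_exp_box)
  qed auto
  then obtain c where c: "\<exists>es\<in>exp_box m d. c es \<noteq> 0"
    "(\<Sum>es\<in>exp_box m d. (\<lambda>x. c es * fmon fs es x)) = 0" by blast
  from c(2) have "(\<Sum>es\<in>exp_box m d. c es * fmon fs es x) = 0" for x
    by (simp add: fun_eq_iff sum_fun_apply)
  then show ?thesis using c(1) unfolding indep_on_def m_def by blast
qed

section \<open>Dimension of proper closed subsets\<close>

definition coords :: "('a::field ^ 'i::finite \<Rightarrow> 'a) set" where
  "coords = range (\<lambda>i x. x $ i)"

lemma coord_alg: "(\<lambda>x. x $ i) \<in> alg coords"
  by (intro alg.gen) (auto simp: coords_def)

lemma poly_value_alg: "poly_value q \<in> alg coords"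
proof -
  have "(\<lambda>x. \<Sum>m\<in>Poly_Mapping.keys q. Poly_Mapping.lookup q m *
          (\<Prod>i\<in>UNIV. (x $ i) ^ Poly_Mapping.lookup m i)) \<in> alg coords"
    by (intro alg_sum alg.mult alg.const alg_prod alg_power coord_alg)
  then show ?thesis by (simp add: poly_value_def[abs_def] monomial_value_def)
qed

lemma monomial_value_var: "monomial_value (Poly_Mapping.single i 1) x = x $ i"
proof -
  have "monomial_value (Poly_Mapping.single i 1) x = (\<Prod>j\<in>{i}. (x $ j) ^ Poly_Mapping.lookup (Poly_Mapping.single i 1) j)"
    unfolding monomial_value_def
    by (intro prod.mono_neutral_right) (auto simp: lookup_single when_def)
  then show ?thesis by (simp add: lookup_single)
qed

lemma alg_coords_poly_value:
  assumes "f \<in> alg coords"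
  shows "\<exists>q. \<forall>x. f x = poly_value q x"
  using assms
proof induction
  case (const c)
  show ?case
    by (rule exI[of _ "Poly_Mapping.single 0 c"]) (simp add: poly_value_single monomial_value_def)
next
  case (gen g)
  then obtain i where "g = (\<lambda>x. x $ i)" by (auto simp: coords_def)
  then show ?case
    by (intro exI[of _ "Poly_Mapping.single (Poly_Mapping.single i 1) 1"])
      (simp only: poly_value_single monomial_value_var mult_1_left simp_thms)
next
  case (add f g) then show ?case by (metis poly_value_add)
next
  case (mult f g) then show ?case by (metis poly_value_mult)
qed

text \<open>The closed sets are defined by homogeneous polynomials, but on a line through the origin a
  polynomial vanishes if and only if all its homogeneous components do: restricted to the multiples
  of a vector, they are the coefficients of a polynomial in the scalar. So arbitrary polynomials may
  be used to cut out closed sets.\<close>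

lemma closedin_vanishing:
  fixes f :: "'a::field_char_0 ^ 'i::finite \<Rightarrow> 'a"
  assumes "f \<in> alg coords"
  shows "closedin (zariski W) {L \<in> proj W. \<forall>x\<in>L. f x = 0}"
proof -
  obtain q where q: "\<And>x. f x = poly_value q x" using alg_coords_poly_value[OF assms] by blast
  define deg where "deg m = (\<Sum>i\<in>UNIV. Poly_Mapping.lookup m i)" for m :: "'i \<Rightarrow>\<^sub>0 nat"
  define M where "M k = {m \<in> Poly_Mapping.keys q. deg m = k}" for k
  define comp where "comp k = (\<Sum>m\<in>M k. Poly_Mapping.single m (Poly_Mapping.lookup q m))" for k
  have keys: "Poly_Mapping.keys (comp k) \<subseteq> M k" for k
  proof -
    have fin: "finite (M k)" by (simp add: M_def)
    show ?thesis
      unfolding comp_def by (auto simp: in_keys_iff lookup_sum lookup_single when_def fin split: if_splits)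
  qed
  have hom: "homogeneous_poly (comp k)" for k
    using keys[of k] unfolding homogeneous_poly_def M_def deg_def by blast
  define T where "T = deg ` Poly_Mapping.keys q"
  have val: "poly_value (comp k) x = (\<Sum>m\<in>M k. Poly_Mapping.lookup q m * monomial_value m x)" for k x
    by (simp add: comp_def poly_value_sum poly_value_single)
  have split: "f x = (\<Sum>k\<in>T. poly_value (comp k) x)" for x
  proof -
    have "f x = (\<Sum>m\<in>Poly_Mapping.keys q. Poly_Mapping.lookup q m * monomial_value m x)"
      by (simp add: q poly_value_def)
    also have "\<dots> = (\<Sum>k\<in>T. \<Sum>m\<in>M k. Poly_Mapping.lookup q m * monomial_value m x)"
      unfolding M_def T_def by (rule sum.group[symmetric]) auto
    finally show ?thesis by (simp add: val)
  qed
  have outside: "poly_value (comp k) x = 0" if "k \<notin> T" for k x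
  proof -
    have "M k = {}" using that by (auto simp: M_def T_def)
    then show ?thesis by (simp add: val)
  qed
  have "(\<forall>x\<in>L. f x = 0) \<longleftrightarrow> (\<forall>g\<in>range comp. \<forall>x\<in>L. poly_value g x = 0)" if L: "L \<in> proj W" for L
  proof
    assume *: "\<forall>x\<in>L. f x = 0"
    have "poly_value (comp k) x = 0" if x: "x \<in> L" and k: "k \<in> T" for k x
    proof -
      have "(\<Sum>j\<in>T. c ^ j * poly_value (comp j) x) = 0" for c
      proof -
        have "c *s x \<in> L" using L x by (simp add: proj_def vec.subspace_scale)
        then have "f (c *s x) = 0" using * by blast
        moreover have "poly_value (comp j) (c *s x) = c ^ j * poly_value (comp j) x" for j
          using keys[of j] by (intro poly_value_scale) (auto simp: M_def deg_def)
        ultimately show ?thesis by (simp add: split)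
      qed
      then have "\<forall>c. poly (\<Sum>j\<in>T. monom (poly_value (comp j) x) j) c = 0"
        by (simp add: poly_sum poly_monom mult.commute)
      then have "(\<Sum>j\<in>T. monom (poly_value (comp j) x) j) = 0"
        by (simp only: poly_all_0_iff_0)
      then have "coeff (\<Sum>j\<in>T. monom (poly_value (comp j) x) j) k = 0" by simp
      then show ?thesis using k by (simp add: coeff_sum coeff_monom T_def)
    qed
    then show "\<forall>g\<in>range comp. \<forall>x\<in>L. poly_value g x = 0" using outside by blast
  qed (simp add: split)
  then have "{L \<in> proj W. \<forall>x\<in>L. f x = 0} = zero_locus W (range comp)"
    by (auto simp: zero_locus_def)
  then show ?thesis
    unfolding closedin_zariski by (intro exI[of _ "range comp"]) (auto simp: hom)
qed

lemma prime_on_subspace: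
  fixes V :: "('a::field_char_0 ^ 'i::finite) set"
  assumes "vec.subspace V"
  shows "prime_on (alg coords) V"
proof (rule prime_on_curves)
  show "infinite (UNIV :: 'a set)" by (rule infinite_UNIV_char_0)
  fix x y assume xy: "x \<in> V" "y \<in> V"
  define \<gamma> where "\<gamma> u = x + u *s (y - x)" for u
  have "(\<lambda>u. f (\<gamma> u)) \<in> alg {\<lambda>u. u}" if "f \<in> alg coords" for f
    using that
  proof (rule alg_comp)
    fix g :: "'a ^ 'i \<Rightarrow> 'a" assume "g \<in> coords"
    then obtain i where "g = (\<lambda>x. x $ i)" by (auto simp: coords_def)
    moreover have "(\<lambda>u. x $ i + u * (y - x) $ i) \<in> alg {\<lambda>u. u}"
      by (intro alg.add alg.mult alg.const alg.gen) simp
    ultimately show "(\<lambda>u. g (\<gamma> u)) \<in> alg {\<lambda>u. u}"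
      by (simp add: \<gamma>_def right_diff_distrib)
  qed
  moreover have "range \<gamma> \<subseteq> V"
    using xy assms by (auto simp: \<gamma>_def intro!: vec.subspace_add vec.subspace_scale vec.subspace_diff)
  moreover have "\<gamma> 0 = x" "\<gamma> 1 = y" by (simp_all add: \<gamma>_def)
  ultimately show "\<exists>\<gamma> s t. \<gamma> s = x \<and> \<gamma> t = y \<and> range \<gamma> \<subseteq> V \<and> (\<forall>f\<in>alg coords. (\<lambda>u. f (\<gamma> u)) \<in> alg {\<lambda>u. u})"
    by blast
qed

lemma irreducible_inD:
  "irreducible_in T S \<Longrightarrow> closedin T A \<Longrightarrow> closedin T B \<Longrightarrow> S \<subseteq> A \<union> B \<Longrightarrow> S \<subseteq> A \<or> S \<subseteq> B"
  unfolding irreducible_in_def by blast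

text \<open>If \<open>f g\<close> vanishes on the cone then on each single line one of \<open>f\<close> and \<open>g\<close> vanishes, a line being
  irreducible itself. This covers \<open>C\<close> by two closed sets.\<close>

lemma prime_on_cone:
  fixes C :: "('a::field_char_0 ^ 'i::finite) set set"
  assumes C: "irreducible_in (subtopology (zariski W) Y) C"
  shows "prime_on (alg coords) (\<Union>C)"
  unfolding prime_on_def
proof (intro ballI impI)
  fix f g :: "'a ^ 'i \<Rightarrow> 'a"
  assume fg: "f \<in> alg coords" "g \<in> alg coords" and zero: "\<forall>x\<in>\<Union>C. f x * g x = 0"
  let ?V = "\<lambda>f. {L \<in> proj W. \<forall>x\<in>L. f x = 0}"
  have CY: "C \<subseteq> proj W" "C \<subseteq> Y"
    using C by (auto simp: irreducible_in_def topspace_zariski)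
  have "C \<subseteq> (Y \<inter> ?V f) \<union> (Y \<inter> ?V g)"
  proof
    fix L assume L: "L \<in> C"
    then have "vec.subspace L" using CY by (auto simp: proj_def)
    then have "(\<forall>x\<in>L. f x = 0) \<or> (\<forall>x\<in>L. g x = 0)"
      using zero L by (intro prime_onD[OF prime_on_subspace fg]) auto
    then show "L \<in> (Y \<inter> ?V f) \<union> (Y \<inter> ?V g)" using CY L by blast
  qed
  moreover have "closedin (subtopology (zariski W) Y) (Y \<inter> ?V f)" if "f \<in> alg coords" for f
    using closedin_vanishing[OF that] unfolding closedin_subtopology by blast
  ultimately have "C \<subseteq> Y \<inter> ?V f \<or> C \<subseteq> Y \<inter> ?V g"
    by (intro irreducible_inD[OF C]) (use fg in auto)
  then show "(\<forall>x\<in>\<Union>C. f x = 0) \<or> (\<forall>x\<in>\<Union>C. g x = 0)" by blast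
qed

lemma closed_separation:
  assumes C: "closedin (subtopology (zariski W) Y) C" and D: "D \<subseteq> proj W" "D \<subseteq> Y" "\<not> D \<subseteq> C"
  shows "\<exists>f\<in>alg coords. (\<forall>x\<in>\<Union>C. f x = 0) \<and> (\<exists>x\<in>\<Union>D. f x \<noteq> 0)"
proof -
  obtain F where F: "C = zero_locus W F \<inter> Y"
    using C unfolding closedin_subtopology closedin_zariski by blast
  obtain L where L: "L \<in> D" "L \<notin> C" using D by blast
  then obtain q x where "q \<in> F" "x \<in> L" "poly_value q x \<noteq> 0"
    using F D by (auto simp: zero_locus_def)
  then show ?thesis using L F by (intro bexI[of _ "poly_value q"] poly_value_alg) (auto simp: zero_locus_def)
qed

lemma fmon_comp: "fmon (map (\<lambda>f x. f (h x)) fs) es x = fmon fs es (h x)"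
proof (induction fs arbitrary: es)
  case (Cons f fs) then show ?case by (cases es) auto
qed auto

text \<open>Only the coordinates in \<open>J\<close> matter on \<open>W\<close>. Composing with the projection to \<open>W\<close> turns the chain's
  functions into elements of an algebra with \<open>card J\<close> generators.\<close>

lemma prime_chain_length:
  fixes J :: "'i::finite set" and W :: "('a::field_char_0 ^ 'i) set"
  assumes W: "W = {x. \<forall>i. i \<notin> J \<longrightarrow> x $ i = 0}" and chain: "prime_chain (alg coords) W fs"
  shows "length fs \<le> card J"
proof (rule ccontr)
  assume "\<not> length fs \<le> card J"
  obtain js where js: "set js = J" "distinct js" using finite_distinct_list[of J] by auto
  define gs :: "('a ^ 'i \<Rightarrow> 'a) list" where "gs = map (\<lambda>j x. x $ j) js"
  define \<pi> where "\<pi> x = (\<chi> i. if i \<in> J then x $ i else 0)" for x :: "'a ^ 'i"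
  have \<pi>W: "\<pi> x = x" if "x \<in> W" for x
    using that by (simp add: W \<pi>_def Finite_Cartesian_Product.vec_eq_iff)
  have "(\<lambda>x. f (\<pi> x)) \<in> alg (set gs)" if "f \<in> alg coords" for f
    using that
  proof (rule alg_comp)
    fix g :: "'a ^ 'i \<Rightarrow> 'a" assume "g \<in> coords"
    then obtain i where g: "g = (\<lambda>x. x $ i)" by (auto simp: coords_def)
    show "(\<lambda>x. g (\<pi> x)) \<in> alg (set gs)"
    proof (cases "i \<in> J")
      case True
      then have "(\<lambda>x. x $ i) \<in> set gs" by (auto simp: gs_def js)
      then show ?thesis using True by (simp add: g \<pi>_def alg.gen)
    next
      case False
      then show ?thesis by (simp add: g \<pi>_def alg.const)
    qed
  qed
  then have "set (map (\<lambda>f x. f (\<pi> x)) fs) \<subseteq> alg (set gs)"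
    using prime_chain_subset[OF chain] by auto
  moreover have "length gs < length (map (\<lambda>f x. f (\<pi> x)) fs)"
    using \<open>\<not> length fs \<le> card J\<close> js distinct_card[of js] by (simp add: gs_def)
  ultimately have "\<not> indep_on (map (\<lambda>f x. f (\<pi> x)) fs) UNIV" by (rule alg_dependent)
  moreover have "indep_on (map (\<lambda>f x. f (\<pi> x)) fs) W"
    using prime_chain_indep[OF chain] \<pi>W by (simp add: indep_on_def fmon_comp)
  ultimately show False using indep_on_mono by blast
qed

lemma proj_nonzero: "L \<in> proj W \<Longrightarrow> \<exists>x\<in>L. x \<noteq> 0"
  by (elim proj_line) (metis rangeI vec.scale_one)

text \<open>A chain of \<open>n + 1\<close> irreducible closed sets in \<open>Y\<close> becomes a chain of \<open>n + 1\<close> irreducible cones,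
  which is prolonged by the origin at the bottom and by \<open>W\<close> at the top. The \<open>n + 2\<close> witnesses of
  strictness are algebraically independent on \<open>W\<close>, so \<open>n + 2 \<le> card J\<close>.\<close>

lemma variety_dim_proper_le:
  fixes J :: "'i::finite set" and W :: "('a::field_char_0 ^ 'i) set"
  assumes W: "W = {x. \<forall>i. i \<notin> J \<longrightarrow> x $ i = 0}"
    and Y: "closedin (zariski W) Y" "Y \<noteq> proj W" and card: "card J = N + 2"
  shows "variety_dim W Y \<le> enat N"
  unfolding variety_dim_def krull_dim_def
proof (rule Sup_least)
  fix d assume "d \<in> {enat n |n. \<exists>C. (\<forall>i\<le>n. closedin (subtopology (zariski W) Y) (C i) \<and>
        irreducible_in (subtopology (zariski W) Y) (C i)) \<and> (\<forall>i<n. C i \<subset> C (Suc i))}"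
  then obtain n C where d: "d = enat n"
    and C: "\<And>i. i \<le> n \<Longrightarrow> closedin (subtopology (zariski W) Y) (C i)"
      "\<And>i. i \<le> n \<Longrightarrow> irreducible_in (subtopology (zariski W) Y) (C i)"
      "\<And>i. i < n \<Longrightarrow> C i \<subset> C (Suc i)" by blast
  have sub: "C i \<subseteq> proj W \<and> C i \<subseteq> Y \<and> C i \<noteq> {}" if "i \<le> n" for i
    using C(2)[OF that] by (auto simp: irreducible_in_def topspace_zariski)
  have subspace: "vec.subspace W"
    unfolding W vec.subspace_def by auto
  have "\<exists>fs. length fs = k + 1 \<and> prime_chain (alg coords) (\<Union>(C k)) fs" if "k \<le> n" for k
    using that
  proof (induction k)
    case 0
    then obtain L where L: "L \<in> C 0" "L \<in> proj W" using sub[of 0] by blast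
    obtain x where x: "x \<in> L" "x \<noteq> 0" using proj_nonzero[OF L(2)] by blast
    obtain i where i: "x $ i \<noteq> 0" using x(2) by (auto simp: Finite_Cartesian_Product.vec_eq_iff)
    have "0 \<in> L" using L(2) by (auto simp: proj_def vec.subspace_0)
    have "prime_chain (alg coords) (\<Union>(C 0)) [\<lambda>x. x $ i]"
    proof (rule prime_chain.step)
      show "prime_chain (alg coords) {0} []" by (rule prime_chain.base) simp
    qed (use L x i \<open>0 \<in> L\<close> prime_on_cone[OF C(2)[of 0]] in \<open>auto intro: coord_alg\<close>)
    then show ?case by (intro exI[of _ "[\<lambda>x. x $ i]"]) simp
  next
    case (Suc k)
    then obtain fs where fs: "length fs = k + 1" "prime_chain (alg coords) (\<Union>(C k)) fs" by auto
    have "C k \<subset> C (Suc k)" using C(3) Suc.prems by simp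
    then obtain f where f: "f \<in> alg coords" "\<forall>x\<in>\<Union>(C k). f x = 0" "\<exists>x\<in>\<Union>(C (Suc k)). f x \<noteq> 0"
      using closed_separation[OF C(1)[of k], of "C (Suc k)"] sub[of "Suc k"] Suc.prems by auto
    have "prime_chain (alg coords) (\<Union>(C (Suc k))) (f # fs)"
      using \<open>C k \<subset> C (Suc k)\<close>
      by (intro prime_chain.step[OF fs(2) _ prime_on_cone[OF C(2)] f]) (use Suc.prems in auto)
    then show ?case using fs(1) by (intro exI[of _ "f # fs"]) simp
  qed
  from this[OF order_refl] obtain fs where fs: "length fs = n + 1"
    "prime_chain (alg coords) (\<Union>(C n)) fs" by blast
  have "Y \<subseteq> proj W" using closedin_subset[OF Y(1)] by (simp add: topspace_zariski)
  then obtain f where f: "f \<in> alg coords" "\<forall>x\<in>\<Union>Y. f x = 0" "\<exists>x\<in>\<Union>(proj W). f x \<noteq> 0"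
    using closed_separation[of W "proj W" Y "proj W"] Y
    by (auto simp: subtopology_topspace simp flip: topspace_zariski)
  have "prime_chain (alg coords) W (f # fs)"
  proof (rule prime_chain.step[OF fs(2)])
    show "\<Union>(C n) \<subseteq> W" using sub[of n] by (auto simp: proj_def)
    show "prime_on (alg coords) W" by (rule prime_on_subspace[OF subspace])
    show "f \<in> alg coords" by (rule f)
    show "\<forall>x\<in>\<Union>(C n). f x = 0" using f(2) sub[of n] by blast
    show "\<exists>x\<in>W. f x \<noteq> 0" using f(3) by (auto simp: proj_def)
  qed
  then have "length (f # fs) \<le> card J" by (rule prime_chain_length[OF W])
  then show "d \<le> enat N" using fs(1) card d by simp
qed

section \<open>Dimension of images of polynomial maps\<close>

text \<open>Extend the family to a basis. The coefficient of a vector at \<open>w k\<close> is then a linear form.\<close>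

lemma dual_coefficients:
  fixes w :: "nat \<Rightarrow> 'a::field ^ 'i::finite"
  assumes inj: "inj_on w {..n}" and ind: "vec.independent (w ` {..n})"
  shows "\<exists>a. \<forall>k\<le>n. \<forall>j\<le>n. (\<Sum>i\<in>UNIV. a k i * w j $ i) = (if k = j then 1 else 0)"
proof -
  define E where "E = vec.extend_basis (w ` {..n})"
  have E: "vec.independent E" "vec.span E = UNIV" "w ` {..n} \<subseteq> E"
    unfolding E_def using vec.independent_extend_basis[OF ind] vec.span_extend_basis[OF ind]
      vec.extend_basis_superset[OF ind] by auto
  have "(\<Sum>i\<in>UNIV. vec.representation E (axis i 1) (w k) * w j $ i) = (if k = j then 1 else 0)"
    if "k \<le> n" "j \<le> n" for k j
  proof -
    have "(if k = j then 1 else 0) = vec.representation E (w j) (w k)"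
    proof -
      have "w j \<in> E" using E(3) that by auto
      moreover have "w k = w j \<longleftrightarrow> k = j" using inj that by (auto simp: inj_on_def)
      ultimately show ?thesis using vec.representation_basis[OF E(1), of "w j"] by simp
    qed
    also have "\<dots> = vec.representation E (\<Sum>i\<in>UNIV. w j $ i *s axis i 1) (w k)"
      by (simp add: basis_expansion)
    also have "\<dots> = (\<Sum>i\<in>UNIV. w j $ i * vec.representation E (axis i 1) (w k))"
      using E by (simp add: vec.representation_sum vec.representation_scale)
    finally show ?thesis by (simp add: mult.commute)
  qed
  then show ?thesis by (intro exI[of _ "\<lambda>k i. vec.representation E (axis i 1) (w k)"]) blast
qed

lemma indep_on_coordinates:
  "indep_on (map (\<lambda>k (t :: nat \<Rightarrow> 'a::field_char_0). t k) [0..<m]) UNIV"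
proof -
  define R where "R = alg (range (\<lambda>k (t :: nat \<Rightarrow> 'a). t k))"
  have prime: "prime_on R {t. \<forall>k<i. t k = 0}" for i :: nat
  proof (rule prime_on_curves)
    fix x y :: "nat \<Rightarrow> 'a"
    assume xy: "x \<in> {t. \<forall>k<i. t k = 0}" "y \<in> {t. \<forall>k<i. t k = 0}"
    define \<gamma> where "\<gamma> u k = x k + u * (y k - x k)" for u k
    have "(\<lambda>u. f (\<gamma> u)) \<in> alg {\<lambda>u. u}" if "f \<in> R" for f
      using that unfolding R_def
    proof (rule alg_comp)
      fix g :: "(nat \<Rightarrow> 'a) \<Rightarrow> 'a" assume "g \<in> range (\<lambda>k t. t k)"
      then obtain k where "g = (\<lambda>t. t k)" by blast
      then show "(\<lambda>u. g (\<gamma> u)) \<in> alg {\<lambda>u. u}"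
        by (auto simp: \<gamma>_def intro!: alg.add alg.mult intro: alg.const alg.gen)
    qed
    moreover have "range \<gamma> \<subseteq> {t. \<forall>k<i. t k = 0}" "\<gamma> 0 = x" "\<gamma> 1 = y"
      using xy by (auto simp: \<gamma>_def)
    ultimately show "\<exists>\<gamma> s t. \<gamma> s = x \<and> \<gamma> t = y \<and> range \<gamma> \<subseteq> {t. \<forall>k<i. t k = 0} \<and>
        (\<forall>f\<in>R. (\<lambda>u. f (\<gamma> u)) \<in> alg {\<lambda>u. u})" by blast
  qed (rule infinite_UNIV_char_0)
  have "prime_chain R {t. \<forall>k<i. t k = 0} (map (\<lambda>k t. t k) [i..<m])" if "i \<le> m" for i
    using that
  proof (induction rule: inc_induct)
    case base
    have "(\<lambda>_. 0) \<in> {t :: nat \<Rightarrow> 'a. \<forall>k<m. t k = 0}" by simp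
    then show ?case by (auto intro: prime_chain.base)
  next
    case (step i)
    have "prime_chain R {t. \<forall>k<i. t k = 0} ((\<lambda>t. t i) # map (\<lambda>k t. t k) [Suc i..<m])"
    proof (rule prime_chain.step[OF step.IH _ prime])
      have "(\<lambda>k. if k = i then 1 else 0) \<in> {t :: nat \<Rightarrow> 'a. \<forall>k<i. t k = 0}" by simp
      then show "\<exists>t\<in>{t :: nat \<Rightarrow> 'a. \<forall>k<i. t k = 0}. t i \<noteq> 0"
        by (rule bexI[rotated]) simp
      show "(\<lambda>t. t i) \<in> R" unfolding R_def by (rule alg.gen) (rule rangeI)
    qed auto
    then show ?case using step.hyps by (simp add: upt_conv_Cons)
  qed
  from prime_chain_indep[OF this[of 0, unfolded R_def]] show ?thesis by simp
qed

lemma poly_in_alg: "poly q \<in> alg {\<lambda>s::'a::field. s}"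
proof (induction q)
  case 0 then show ?case using alg.const[of 0] by (simp add: poly_0[abs_def])
next
  case (pCons a q)
  have "(\<lambda>s. a + s * poly q s) \<in> alg {\<lambda>s. s}"
    by (intro alg.add alg.mult alg.const alg.gen pCons.IH) simp
  then show ?case by simp
qed

lemma fmon_scale:
  "length es = length fs \<Longrightarrow>
   fmon (map (\<lambda>f s. s * f s) fs) es s = s ^ sum_list es * fmon fs es s"
proof (induction fs arbitrary: es)
  case (Cons f fs)
  then show ?case by (auto simp: length_Suc_conv power_add power_mult_distrib)
qed simp

text \<open>The \<open>g a k\<close> are polynomials in a parameter \<open>s\<close> with zero constant term and linear coefficient \<open>a k\<close>. Substituted
  into a nonzero polynomial with coefficients \<open>c\<close>, the lowest-degree part of the polynomial, evaluated
  at \<open>a\<close>, is the coefficient of the lowest power of \<open>s\<close> in the result. It is nonzero for a suitable \<open>a\<close>.\<close>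

lemma formal_curve_independent:
  fixes c :: "nat list \<Rightarrow> 'a::field_char_0" and g :: "(nat \<Rightarrow> 'a) \<Rightarrow> nat \<Rightarrow> 'a poly"
  assumes c: "es0 \<in> exp_box m d" "c es0 \<noteq> 0"
    and g: "\<And>a k. k < m \<Longrightarrow> coeff (g a k) 0 = 0 \<and> coeff (g a k) 1 = a k"
  shows "\<exists>a s. (\<Sum>es\<in>exp_box m d. c es * fmon (map (\<lambda>k. poly (g a k)) [0..<m]) es s) \<noteq> 0"
proof -
  define N where "N = {es \<in> exp_box m d. c es \<noteq> 0}"
  have N: "finite N" "N \<noteq> {}" using c by (auto simp: N_def)
  define K where "K = Min (sum_list ` N)"
  have K: "K \<le> sum_list es" if "es \<in> exp_box m d" "c es \<noteq> 0" for es
    unfolding K_def by (rule Min_le) (use N that in \<open>auto simp: N_def\<close>)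
  have "K \<in> sum_list ` N" unfolding K_def using N by (intro Min_in) auto
  then obtain es1 where es1: "es1 \<in> exp_box m d" "c es1 \<noteq> 0" "sum_list es1 = K"
    by (auto simp: N_def)
  define c' where "c' es = (if sum_list es = K then c es else 0)" for es
  let ?X = "map (\<lambda>k (t :: nat \<Rightarrow> 'a). t k) [0..<m]"
  have "\<not> (\<forall>a. (\<Sum>es\<in>exp_box m d. c' es * fmon ?X es a) = 0)"
  proof
    assume "\<forall>a. (\<Sum>es\<in>exp_box m d. c' es * fmon ?X es a) = 0"
    then have "\<forall>es\<in>exp_box m d. c' es = 0"
      using indep_on_coordinates[of m, where 'a = 'a] unfolding indep_on_def by simp
    then show False using es1 by (auto simp: c'_def)
  qed
  then obtain a where a: "(\<Sum>es\<in>exp_box m d. c' es * fmon ?X es a) \<noteq> 0" by blast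
  define u where "u k = poly_shift 1 (g a k)" for k
  define U where "U = map (\<lambda>k. poly (u k)) [0..<m]"
  have gu: "g a k = pCons 0 (u k)" if "k < m" for k
    using g[OF that] by (intro poly_eqI) (auto simp: u_def coeff_poly_shift coeff_pCons split: nat.splits)
  have u0: "poly (u k) 0 = a k" if "k < m" for k
    using g[OF that] by (simp add: u_def poly_0_coeff_0 coeff_poly_shift)
  define h where "h s = (\<Sum>es\<in>exp_box m d. c es * (s ^ (sum_list es - K) * fmon U es s))" for s
  have split: "(\<Sum>es\<in>exp_box m d. c es * fmon (map (\<lambda>k. poly (g a k)) [0..<m]) es s) = s ^ K * h s" for s
  proof -
    have eq: "map (\<lambda>k. poly (g a k)) [0..<m] = map (\<lambda>f s. s * f s) U"
      by (auto simp: U_def gu fun_eq_iff)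
    have "c es * fmon (map (\<lambda>f s. s * f s) U) es s
        = s ^ K * (c es * (s ^ (sum_list es - K) * fmon U es s))" if "es \<in> exp_box m d" for es
    proof (cases "c es = 0")
      case False
      then have "s ^ sum_list es = s ^ K * s ^ (sum_list es - K)"
        using K[OF that] by (simp flip: power_add)
      moreover have "length es = length U" using that by (simp add: exp_box_def U_def)
      ultimately show ?thesis by (simp add: fmon_scale)
    qed simp
    then show ?thesis unfolding eq h_def sum_distrib_left by (rule sum.cong[OF refl])
  qed
  have "h 0 = (\<Sum>es\<in>exp_box m d. c' es * fmon ?X es a)"
    unfolding h_def
  proof (rule sum.cong[OF refl])
    fix es assume es: "es \<in> exp_box m d"
    have "fmon U es 0 = fmon ?X es a"
      unfolding fmon_def U_def by (intro arg_cong[of _ _ prod_list] map_cong)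
        (auto simp: zip_map1 u0 dest: set_zip_leftD)
    then show "c es * (0 ^ (sum_list es - K) * fmon U es 0) = c' es * fmon ?X es a"
      using K[OF es] by (auto simp: c'_def power_0_left)
  qed
  then have h0: "h 0 \<noteq> 0" using a by simp
  have "set U \<subseteq> alg {\<lambda>s. s}" by (auto simp: U_def poly_in_alg)
  then have "(\<lambda>s. \<Sum>es\<in>exp_box m d. c es * (s ^ (sum_list es - K) * fmon U es s)) \<in> alg {\<lambda>s. s}"
    by (intro alg_sum alg.mult alg.const alg_power fmon_alg alg.gen) auto
  then obtain q where q: "\<And>s. h s = poly q s"
    using alg_poly unfolding h_def by blast
  have "q \<noteq> 0" using h0 q by auto
  then have "[:0, 1:] * q \<noteq> 0" by simp
  then obtain s where "poly ([:0, 1:] * q) s \<noteq> 0" using poly_all_0_iff_0 by blast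
  then have "s ^ K * h s \<noteq> 0" by (simp add: q)
  then show ?thesis using split by metis
qed

text \<open>Lower bound for the dimension by the rank of a derivative. Choose vectors \<open>b 0, ..., b n\<close>, the first
  one being \<open>p\<close>, whose images under the derivative \<open>T\<close> at \<open>p\<close> are independent, and let \<open>L j\<close> be the
  span of the first \<open>j + 1\<close> of them. The closures of the images of \<open>L 0, ..., L n\<close> are irreducible
  because linear spaces are. They are distinct: the first \<open>j + 2\<close> of the functions \<open>y k\<close> below satisfy
  a polynomial relation on \<open>\<psi> ` L j\<close>, which depends on \<open>j + 1\<close> parameters only, whereas near \<open>\<psi> p\<close> on
  \<open>\<psi> ` L (j + 1)\<close> they behave like independent parameters. Homogeneity of \<open>\<psi>\<close> and the roots in an
  algebraically closed field make \<open>\<psi> ` L j\<close> a cone, so that polynomial relations on it define closed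
  sets of lines. As \<open>b 0 = p\<close> is the direction of scaling, the projective dimension is \<open>n\<close>, not \<open>n + 1\<close>.\<close>

lemma variety_dim_ge:
  fixes \<psi> :: "'a::{alg_closed_field, field_char_0} ^ 'm::finite \<Rightarrow> 'a ^ 'i::finite"
  assumes Y: "Y \<subseteq> proj W" "\<And>x. \<psi> x \<noteq> 0 \<Longrightarrow> vec.span {\<psi> x} \<in> Y"
    and pol: "\<And>i. (\<lambda>x. \<psi> x $ i) \<in> alg coords"
    and hom: "\<And>c x. \<psi> (c *s x) = c ^ e *s \<psi> x" "e > 0"
    and T: "\<And>x y. T (x + y) = T x + T y" "\<And>c x. T (c *s x) = c *s T x"
    and deriv: "\<And>b i. \<exists>q. (\<forall>s. \<psi> (p + s *s b) $ i = poly q s) \<and> coeff q 1 = T b $ i"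
    and Tp: "T p \<noteq> 0" and rank: "n < vec.dim (range T)"
  shows "enat n \<le> variety_dim W Y"
proof -
  interpret T: Vector_Spaces.linear "(*s)" "(*s)" T
    by standard (use T in auto)
  have T_sum: "T (sum f I) = (\<Sum>i\<in>I. T (f i))" for f :: "nat \<Rightarrow> 'a ^ 'm" and I
    by (rule T.sum)
  have "vec.independent {T p}" using Tp by simp
  then obtain B where B: "{T p} \<subseteq> B" "B \<subseteq> range T" "vec.independent B" "range T \<subseteq> vec.span B"
    using vec.maximal_independent_subset_extend[of "{T p}" "range T"] by blast
  have cardB: "card B = vec.dim (range T)"
    by (rule vec.basis_card_eq_dim) (use B in auto)
  have finB: "finite B" using B(3) vec.finiteI_independent by blast
  obtain us where us: "set us = B - {T p}" "distinct us"
    using finite_distinct_list[of "B - {T p}"] finB by blast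
  define ws where "ws = T p # us"
  have ws: "set ws = B" "distinct ws" using us B by (auto simp: ws_def)
  have len: "n < length ws" using ws distinct_card[of ws] cardB rank by simp
  define w where "w k = ws ! k" for k
  have wB: "w k \<in> B" if "k \<le> n" for k using that len ws by (auto simp: w_def)
  have inj: "inj_on w {..n}"
    using ws(2) len by (auto simp: inj_on_def w_def nth_eq_iff_index_eq)
  have ind: "vec.independent (w ` {..n})"
    by (rule vec.independent_mono[OF B(3)]) (use wB in blast)
  have "\<exists>b. b 0 = p \<and> (\<forall>k\<le>n. T (b k) = w k)"
  proof (rule exI[of _ "\<lambda>k. if k = 0 then p else SOME x. T x = w k"], intro conjI allI impI)
    show "(if 0 = (0::nat) then p else SOME x. T x = w 0) = p" by simp
    fix k assume "k \<le> n"
    then have "\<exists>x. T x = w k" using wB B(2) by (metis imageE subsetD)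
    then have "T (SOME x. T x = w k) = w k" by (rule someI_ex)
    then show "T (if k = 0 then p else SOME x. T x = w k) = w k"
      by (cases "k = 0") (simp add: w_def ws_def, simp)
  qed
  then obtain b where b: "b 0 = p" "\<And>k. k \<le> n \<Longrightarrow> T (b k) = w k" by blast
  obtain \<mu> where \<mu>: "\<And>k j. k \<le> n \<Longrightarrow> j \<le> n \<Longrightarrow> (\<Sum>i\<in>UNIV. \<mu> k i * w j $ i) = (if k = j then 1 else 0)"
    using dual_coefficients[OF inj ind] by blast
  \<comment> \<open>affine functions vanishing at \<open>\<psi> p\<close> that take the value \<open>s * a k\<close>, up to terms in \<open>s\<^sup>2\<close>, at the
    image of \<open>p\<close> moved by \<open>s\<close> times \<open>\<Sum>k. a k *s b k\<close>\<close>
  define y where "y k x = (\<Sum>i\<in>UNIV. \<mu> k i * (x $ i - \<psi> p $ i))" for k x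
  have "(\<lambda>x. \<Sum>i\<in>UNIV. \<mu> k i * (x $ i + (- (\<psi> p $ i)))) \<in> alg coords" for k
    by (intro alg_sum alg.mult alg.const alg.add coord_alg)
  then have y_alg: "y k \<in> alg coords" for k by (simp add: y_def[abs_def])
  have comp: "(\<lambda>x. f (\<psi> x)) \<in> alg coords" if f: "f \<in> alg coords" for f
    using f
  proof (rule alg_comp)
    fix g :: "'a ^ 'i \<Rightarrow> 'a" assume "g \<in> coords"
    then obtain i where "g = (\<lambda>x. x $ i)" by (auto simp: coords_def)
    then show "(\<lambda>x. g (\<psi> x)) \<in> alg coords" using pol[of i] by simp
  qed
  define \<Phi> where "\<Phi> j t = (\<Sum>k\<le>j. t k *s b k)" for j :: nat and t
  define L where "L j = range (\<Phi> j)" for j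
  have L_sub: "vec.subspace (L j)" for j
    unfolding vec.subspace_def
  proof (intro conjI ballI allI)
    have "0 = \<Phi> j (\<lambda>_. 0)" by (simp add: \<Phi>_def)
    then show "0 \<in> L j" unfolding L_def by blast
  next
    fix x y assume "x \<in> L j" "y \<in> L j"
    then obtain t u where "x = \<Phi> j t" "y = \<Phi> j u" unfolding L_def by blast
    then have "x + y = \<Phi> j (\<lambda>k. t k + u k)"
      by (simp add: \<Phi>_def sum.distrib vec.scale_left_distrib)
    then show "x + y \<in> L j" unfolding L_def by blast
  next
    fix c x assume "x \<in> L j"
    then obtain t where "x = \<Phi> j t" unfolding L_def by blast
    then have "c *s x = \<Phi> j (\<lambda>k. c * t k)"
      by (simp add: \<Phi>_def vec.scale_sum_right)
    then show "c *s x \<in> L j" unfolding L_def by blast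
  qed
  have b_in: "b k \<in> L j" if "k \<le> j" for k j
  proof -
    have "\<Phi> j (\<lambda>i. if i = k then 1 else 0) = (\<Sum>i\<in>{k}. b i)"
      unfolding \<Phi>_def using that by (intro sum.mono_neutral_cong_right) auto
    then show ?thesis unfolding L_def by (metis rangeI sum.insert sum.empty finite.emptyI empty_iff add.right_neutral)
  qed
  have p_in: "p \<in> L j" for j using b_in[of 0 j] b(1) by simp
  have L_mono: "L j \<subseteq> L (Suc j)" for j
  proof
    fix x assume "x \<in> L j"
    then obtain t where x: "x = \<Phi> j t" unfolding L_def by blast
    show "x \<in> L (Suc j)" unfolding x \<Phi>_def
    proof (rule vec.subspace_sum[OF L_sub])
      fix k assume "k \<in> {..j}"
      then show "t k *s b k \<in> L (Suc j)"
        using b_in[of k "Suc j"] by (intro vec.subspace_scale[OF L_sub]) simp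
    qed
  qed
  have separate: "\<exists>f\<in>alg coords. (\<forall>x\<in>L j. f (\<psi> x) = 0) \<and> (\<exists>x\<in>L (Suc j). f (\<psi> x) \<noteq> 0)"
    if j: "j < n" for j
  proof -
    define fs where "fs = map y [0..<j + 2]"
    have len_fs: "length fs = j + 2" by (simp add: fs_def)
    have "(\<lambda>t. f (\<psi> (\<Phi> j t))) \<in> alg (set (map (\<lambda>k t. t k) [0..<j + 1]))" if "f \<in> alg coords" for f
    proof -
      show ?thesis
        using comp[OF that]
      proof (rule alg_comp)
        fix g :: "'a ^ 'm \<Rightarrow> 'a" assume "g \<in> coords"
        then obtain i where g: "g = (\<lambda>x. x $ i)" by (auto simp: coords_def)
        have "(\<lambda>t :: nat \<Rightarrow> 'a. t k) \<in> alg (set (map (\<lambda>k t. t k) [0..<j + 1]))" if "k \<le> j" for k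
          unfolding set_map set_upt by (rule alg.gen, rule imageI) (use that in simp)
        then have "(\<lambda>t. \<Sum>k\<le>j. t k * b k $ i) \<in> alg (set (map (\<lambda>k t. t k) [0..<j + 1]))"
          by (intro alg_sum alg.mult alg.const) auto
        then show "(\<lambda>t. g (\<Phi> j t)) \<in> alg (set (map (\<lambda>k t. t k) [0..<j + 1]))"
          by (simp add: g \<Phi>_def)
      qed
    qed
    then have "set (map (\<lambda>f t. f (\<psi> (\<Phi> j t))) fs) \<subseteq> alg (set (map (\<lambda>k t. t k) [0..<j + 1]))"
      using y_alg by (auto simp: fs_def)
    then have "\<not> indep_on (map (\<lambda>f t. f (\<psi> (\<Phi> j t))) fs) UNIV"
      by (rule alg_dependent) (simp add: fs_def)
    then obtain d c es0 where c: "\<And>t. (\<Sum>es\<in>exp_box (j + 2) d. c es * fmon fs es (\<psi> (\<Phi> j t))) = 0"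
      "es0 \<in> exp_box (j + 2) d" "c es0 \<noteq> 0"
      unfolding indep_on_def fmon_comp length_map len_fs by blast
    define f where "f x = (\<Sum>es\<in>exp_box (j + 2) d. c es * fmon fs es x)" for x
    have "(\<lambda>x. \<Sum>es\<in>exp_box (j + 2) d. c es * fmon fs es x) \<in> alg coords"
      by (intro alg_sum alg.mult alg.const fmon_alg) (auto simp: fs_def y_alg)
    then have f_alg: "f \<in> alg coords" by (simp add: f_def[abs_def])
    define P where "P a k q \<longleftrightarrow> (\<forall>s. y k (\<psi> (p + s *s \<Phi> (Suc j) a)) = poly q s)
      \<and> coeff q 0 = 0 \<and> coeff q 1 = a k" for a k q
    have "\<exists>q. P a k q" if k: "k < j + 2" for a k
    proof -
      have "\<forall>i. \<exists>q. (\<forall>s. \<psi> (p + s *s \<Phi> (Suc j) a) $ i = poly q s) \<and> coeff q 1 = T (\<Phi> (Suc j) a) $ i"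
        using deriv by blast
      then obtain q where q: "\<And>i s. \<psi> (p + s *s \<Phi> (Suc j) a) $ i = poly (q i) s"
        "\<And>i. coeff (q i) 1 = T (\<Phi> (Suc j) a) $ i" by metis
      define r where "r = (\<Sum>i\<in>UNIV. Polynomial.smult (\<mu> k i) (q i - [:\<psi> p $ i:]))"
      have "poly (q i) 0 = \<psi> p $ i" for i using q(1)[of 0 i] by simp
      then have "coeff r 0 = 0" by (simp add: r_def coeff_sum poly_0_coeff_0)
      moreover have "coeff r 1 = a k"
      proof -
        have "coeff r 1 = (\<Sum>i\<in>UNIV. \<mu> k i * T (\<Phi> (Suc j) a) $ i)"
          using q(2) by (simp add: r_def coeff_sum)
        also have "\<dots> = (\<Sum>i\<in>UNIV. \<Sum>l\<le>Suc j. a l * (\<mu> k i * w l $ i))"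
          using j b(2) unfolding \<Phi>_def T_sum T(2)
          by (simp add: sum_distrib_left algebra_simps del: sum.atMost_Suc)
        also have "\<dots> = (\<Sum>l\<le>Suc j. a l * (\<Sum>i\<in>UNIV. \<mu> k i * w l $ i))"
          by (subst sum.swap) (simp only: sum_distrib_left)
        also have "\<dots> = (\<Sum>l\<le>Suc j. if k = l then a l else 0)"
          using k j \<mu> by (intro sum.cong) auto
        also have "\<dots> = a k" using k by (subst sum.delta') auto
        finally show ?thesis .
      qed
      moreover have "y k (\<psi> (p + s *s \<Phi> (Suc j) a)) = poly r s" for s
        by (simp add: y_def r_def poly_sum q(1))
      ultimately show ?thesis unfolding P_def by blast
    qed
    then have "\<forall>a k. \<exists>q. k < j + 2 \<longrightarrow> P a k q" by blast
    then obtain g where "\<forall>a k. k < j + 2 \<longrightarrow> P a k (g a k)" by metis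
    then have g: "\<And>a k s. k < j + 2 \<Longrightarrow> y k (\<psi> (p + s *s \<Phi> (Suc j) a)) = poly (g a k) s"
      "\<And>a k. k < j + 2 \<Longrightarrow> coeff (g a k) 0 = 0 \<and> coeff (g a k) 1 = a k"
      unfolding P_def by blast+
    obtain a s where as: "(\<Sum>es\<in>exp_box (j + 2) d. c es * fmon (map (\<lambda>k. poly (g a k)) [0..<j + 2]) es s) \<noteq> 0"
      using formal_curve_independent[of es0 "j + 2" d c g] c g(2) by blast
    have "map (\<lambda>k. poly (g a k)) [0..<j + 2] = map (\<lambda>f s. f (\<psi> (p + s *s \<Phi> (Suc j) a))) fs"
      using g(1) by (auto simp: fs_def fun_eq_iff simp del: upt_Suc)
    then have "f (\<psi> (p + s *s \<Phi> (Suc j) a)) \<noteq> 0"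
      using as by (simp only: f_def fmon_comp) simp
    moreover have "p + s *s \<Phi> (Suc j) a \<in> L (Suc j)"
      using p_in L_sub by (intro vec.subspace_add vec.subspace_scale) (auto simp: L_def)
    moreover have "\<forall>x\<in>L j. f (\<psi> x) = 0" using c(1) by (auto simp: f_def L_def)
    ultimately show ?thesis using f_alg by blast
  qed
  define S where "S j = {vec.span {\<psi> x} | x. x \<in> L j \<and> \<psi> x \<noteq> 0}" for j
  define C where "C j = zariski W closure_of S j \<inter> Y" for j
  have SY: "S j \<subseteq> Y" for j using Y(2) by (auto simp: S_def)
  have SC: "S j \<subseteq> C j" for j
    using closure_of_subset[of "S j" "zariski W"] SY Y(1) by (auto simp: C_def topspace_zariski)
  have S_lines: "\<exists>x'\<in>L j. z = \<psi> x'" if x: "x \<in> L j" and z: "z \<in> vec.span {\<psi> x}" for x z j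
  proof -
    obtain c where "z = c *s \<psi> x" using z by (auto simp: vec.span_singleton)
    moreover obtain r where "r ^ e = c" using nth_root_exists[of e c] hom(2) by blast
    ultimately show ?thesis
      using x L_sub hom(1) by (intro bexI[of _ "r *s x"]) (auto intro: vec.subspace_scale)
  qed
  have \<psi>p: "\<psi> p \<noteq> 0"
  proof
    assume 0: "\<psi> p = 0"
    have "T p $ i = 0" for i
    proof -
      obtain q where q: "\<And>s. \<psi> (p + s *s p) $ i = poly q s" "coeff q 1 = T p $ i"
        using deriv by blast
      have "\<psi> (p + s *s p) = 0" for s
        using hom(1)[of "1 + s" p] 0 by (simp add: vec.scale_left_distrib)
      then have "q = 0" using q(1) by (simp flip: poly_all_0_iff_0)
      then show ?thesis using q(2) by simp
    qed
    then show False using Tp by (simp add: Finite_Cartesian_Product.vec_eq_iff)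
  qed
  have \<psi>0: "\<psi> 0 = 0" using hom(1)[of 0 0] hom(2) by (simp add: zero_power)
  have closed: "closedin (subtopology (zariski W) Y) (C j)" for j
    unfolding C_def closedin_subtopology
    by (rule exI[of _ "zariski W closure_of S j"]) simp
  have S_prime: "S j \<subseteq> zero_locus W F \<or> S j \<subseteq> zero_locus W G"
    if sub: "S j \<subseteq> zero_locus W F \<union> zero_locus W G" for j F G
  proof (rule ccontr)
    assume neg: "\<not> ?thesis"
    have *: "\<exists>f\<in>alg coords. \<exists>x\<in>L j. f (\<psi> x) \<noteq> 0 \<and> (\<forall>M\<in>zero_locus W F. \<forall>z\<in>M. f z = 0)"
      if not: "\<not> S j \<subseteq> zero_locus W F" for F
    proof -
      obtain M where M: "M \<in> S j" "M \<notin> zero_locus W F" using not by blast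
      then have "M \<in> proj W" using SY Y(1) by blast
      then obtain q z where qz: "q \<in> F" "z \<in> M" "poly_value q z \<noteq> 0"
        using M(2) by (auto simp: zero_locus_def)
      obtain x where x: "M = vec.span {\<psi> x}" "x \<in> L j" using M(1) by (auto simp: S_def)
      obtain x' where "x' \<in> L j" "z = \<psi> x'" using S_lines[OF x(2)] qz(2) x(1) by blast
      then show ?thesis using qz
        by (intro bexI[of _ "poly_value q"] bexI[of _ x'] poly_value_alg) (auto simp: zero_locus_def)
    qed
    obtain f x1 where f: "f \<in> alg coords" "x1 \<in> L j" "f (\<psi> x1) \<noteq> 0" "\<forall>M\<in>zero_locus W F. \<forall>z\<in>M. f z = 0"
      using * neg by blast
    obtain g x2 where g: "g \<in> alg coords" "x2 \<in> L j" "g (\<psi> x2) \<noteq> 0" "\<forall>M\<in>zero_locus W G. \<forall>z\<in>M. g z = 0"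
      using * neg by blast
    obtain i where i: "\<psi> p $ i \<noteq> 0" using \<psi>p by (auto simp: Finite_Cartesian_Product.vec_eq_iff)
    \<comment> \<open>the factor \<open>\<psi> x $ i\<close> ensures that the common nonroot has a nonzero image\<close>
    have fg: "\<not> (\<forall>x\<in>L j. f (\<psi> x) * g (\<psi> x) = 0)"
      using prime_onD[OF prime_on_subspace[OF L_sub[of j]] comp[OF f(1)] comp[OF g(1)]] f g by blast
    have "\<not> (\<forall>x\<in>L j. (f (\<psi> x) * g (\<psi> x)) * \<psi> x $ i = 0)"
      using prime_onD[OF prime_on_subspace[OF L_sub[of j]] alg.mult[OF comp[OF f(1)] comp[OF g(1)]] pol[of i]]
        fg p_in i by blast
    then obtain x where x: "x \<in> L j" "f (\<psi> x) \<noteq> 0" "g (\<psi> x) \<noteq> 0" "\<psi> x $ i \<noteq> 0" by auto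
    then have "\<psi> x \<noteq> 0" by auto
    then have "vec.span {\<psi> x} \<in> S j" using x(1) by (auto simp: S_def)
    moreover have "\<psi> x \<in> vec.span {\<psi> x}" by (simp add: vec.span_base)
    ultimately show False using sub f(4) g(4) x by blast
  qed
  have irred: "irreducible_in (subtopology (zariski W) Y) (C j)" for j
    unfolding irreducible_in_def
  proof (intro conjI allI impI)
    have "vec.span {\<psi> p} \<in> S j" using p_in \<psi>p by (auto simp: S_def)
    then show "C j \<noteq> {}" using SC by blast
    show "C j \<subseteq> topspace (subtopology (zariski W) Y)"
      using closedin_subset[OF closed] .
    fix A B
    assume AB: "closedin (subtopology (zariski W) Y) A \<and> closedin (subtopology (zariski W) Y) B \<and> C j \<subseteq> A \<union> B"
    obtain A' where A': "closedin (zariski W) A'" "A = A' \<inter> Y"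
      using AB unfolding closedin_subtopology by auto
    obtain F where F: "A' = zero_locus W F" using A'(1) unfolding closedin_zariski by auto
    obtain B' where B': "closedin (zariski W) B'" "B = B' \<inter> Y"
      using AB unfolding closedin_subtopology by auto
    obtain G where G: "B' = zero_locus W G" using B'(1) unfolding closedin_zariski by auto
    have "S j \<subseteq> A' \<union> B'" using AB SC[of j] A'(2) B'(2) by blast
    then have "S j \<subseteq> A' \<or> S j \<subseteq> B'" unfolding F G by (rule S_prime)
    then show "C j \<subseteq> A \<or> C j \<subseteq> B"
    proof
      assume "S j \<subseteq> A'"
      from closure_of_minimal[OF this A'(1)] show ?thesis unfolding C_def A'(2) by blast
    next
      assume "S j \<subseteq> B'"
      from closure_of_minimal[OF this B'(1)] show ?thesis unfolding C_def B'(2) by blast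
    qed
  qed
  have strict: "C j \<subset> C (Suc j)" if j: "j < n" for j
  proof
    have "S j \<subseteq> S (Suc j)" using L_mono by (auto simp: S_def)
    then show "C j \<subseteq> C (Suc j)" unfolding C_def using closure_of_mono by blast
    obtain f x where f: "f \<in> alg coords" "\<forall>x\<in>L j. f (\<psi> x) = 0" and x: "x \<in> L (Suc j)" "f (\<psi> x) \<noteq> 0"
      using separate[OF j] by blast
    let ?V = "{M \<in> proj W. \<forall>z\<in>M. f z = 0}"
    have "M \<in> ?V" if M: "M \<in> S j" for M
    proof -
      have "M \<in> proj W" using M SY Y(1) by blast
      moreover obtain u where "u \<in> L j" "M = vec.span {\<psi> u}" using M by (auto simp: S_def)
      ultimately show ?thesis using S_lines f(2) by blast
    qed
    then have sub: "zariski W closure_of S j \<subseteq> ?V"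
      by (intro closure_of_minimal closedin_vanishing f(1)) blast
    have "\<psi> x \<noteq> 0" using x(2) f(2) \<psi>0 vec.subspace_0[OF L_sub[of j]] by metis
    then have "vec.span {\<psi> x} \<in> C (Suc j)" using x(1) SC[of "Suc j"] by (auto simp: S_def)
    moreover have "vec.span {\<psi> x} \<notin> ?V" using x(2) vec.span_base[of "\<psi> x" "{\<psi> x}"] by blast
    ultimately show "C j \<noteq> C (Suc j)" using sub unfolding C_def by blast
  qed
  show ?thesis
    unfolding variety_dim_def krull_dim_def
    by (rule Sup_upper) (use closed irred strict in blast)
qed

section \<open>Wedge products of three vectors\<close>

definition minor3 :: "'a::field ^ 'n::finite \<Rightarrow> 'a ^ 'n \<Rightarrow> 'a ^ 'n \<Rightarrow> 'n \<Rightarrow> 'n \<Rightarrow> 'n \<Rightarrow> 'a" where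
  "minor3 u v w i j k =
     u $ i * (v $ j * w $ k - v $ k * w $ j) - u $ j * (v $ i * w $ k - v $ k * w $ i)
     + u $ k * (v $ i * w $ j - v $ j * w $ i)"

lemma det_mat_2:
  "Determinant.det (Matrix.mat 2 2 f) = f (0, 0) * f (1, 1) - f (0, 1) * (f (1, 0) :: 'a::comm_ring_1)"
  by (subst laplace_expansion_row[of _ 2 0])
    (auto simp: numeral_2_eq_2 cofactor_def mat_delete_def det_single)

lemma det_mat_3:
  fixes f :: "nat \<times> nat \<Rightarrow> 'a::comm_ring_1"
  shows "Determinant.det (Matrix.mat 3 3 f) =
    f (0, 0) * (f (1, 1) * f (2, 2) - f (1, 2) * f (2, 1))
    - f (0, 1) * (f (1, 0) * f (2, 2) - f (1, 2) * f (2, 0))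
    + f (0, 2) * (f (1, 0) * f (2, 1) - f (1, 1) * f (2, 0))"
proof -
  have "Determinant.det (Matrix.mat 3 3 f) =
      (\<Sum>j<3. f (0, j) * cofactor (Matrix.mat 3 3 f) 0 j)"
    by (subst laplace_expansion_row[of _ 3 0]) auto
  moreover have "mat_delete (Matrix.mat 3 3 f) 0 j =
      Matrix.mat 2 2 (\<lambda>(i', j'). f (Suc i', if j' < j then j' else Suc j'))" if "j < 3" for j
    using that by (intro eq_matI) (auto simp: mat_delete_def)
  ultimately show ?thesis
    by (simp add: numeral_3_eq_3 cofactor_def det_mat_2[unfolded numeral_2_eq_2] numeral_2_eq_2)
qed

lemma wedge3_nth:
  fixes u v w :: "'a::field ^ 'n::{finite, linorder}"
  shows "wedge [u, v, w] $ S = (if card S = 3 then minor3 u v w (sorted_list_of_set S ! 0)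
    (sorted_list_of_set S ! 1) (sorted_list_of_set S ! 2) else 0)"
  by (simp add: wedge_def det_mat_3[unfolded numeral_3_eq_3] numeral_3_eq_3 minor3_def numeral_2_eq_2)

lemma card_3_less:
  fixes i j k :: "'n::linorder"
  assumes "i < j" "j < k"
  shows "card {i, j, k} = 3"
proof -
  have "i \<noteq> j" "i \<noteq> k" "j \<noteq> k" using assms by auto
  then show ?thesis by simp
qed

lemma sorted_list_of_set_3:
  fixes i j k :: "'n::linorder"
  assumes "i < j" "j < k"
  shows "sorted_list_of_set {i, j, k} = [i, j, k]"
  using assms card_3_less[OF assms] by (intro sorted_list_of_set_unique[THEN iffD1]) auto

lemma card_3_sorted:
  fixes S :: "'n::linorder set"
  assumes "card S = 3"
  obtains i j k where "i < j" "j < k" "S = {i, j, k}" "sorted_list_of_set S = [i, j, k]"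
proof -
  have fin: "finite S" using assms by (metis card.infinite zero_neq_numeral)
  have *: "\<exists>i j k. l = [i, j, k]" if "length l = 3" for l :: "'n list"
    using that by (auto simp: numeral_3_eq_3 length_Suc_conv)
  have "length (sorted_list_of_set S) = 3" using assms by simp
  then obtain i j k where s: "sorted_list_of_set S = [i, j, k]" using * by blast
  moreover have "sorted [i, j, k]" "distinct [i, j, k]"
    using sorted_sorted_list_of_set[of S] distinct_sorted_list_of_set[of S] unfolding s by auto
  moreover have "S = {i, j, k}" using set_sorted_list_of_set[OF fin] unfolding s by auto
  ultimately show ?thesis by (intro that[of i j k]) auto
qed

locale alternating3 =
  fixes F :: "'a::field ^ 'n::{finite, linorder} \<Rightarrow> 'a ^ 'n::{finite, linorder} \<Rightarrow> 'a ^ 'n::{finite, linorder} \<Rightarrow> 'a ^ 'm"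
  assumes add1: "F (u + u') v w = F u v w + F u' v w"
    and add2: "F u (v + v') w = F u v w + F u v' w"
    and add3: "F u v (w + w') = F u v w + F u v w'"
    and scale1: "F (c *s u) v w = c *s F u v w"
    and scale2: "F u (c *s v) w = c *s F u v w"
    and scale3: "F u v (c *s w) = c *s F u v w"
    and eq12: "F u u w = 0"
    and eq23: "F u v v = 0"
    and eq13: "F u v u = 0"
begin

lemma swap12: "F v u w = - F u v w"
proof -
  have "F (u + v) (u + v) w = 0" by (rule eq12)
  then have "F u v w + F v u w = 0" unfolding add1 add2 by (simp add: eq12 add.commute)
  then show ?thesis by (metis add_eq_0_iff)
qed

lemma swap23: "F u w v = - F u v w"
proof -
  have "F u (v + w) (v + w) = 0" by (rule eq23)
  then have "F u v w + F u w v = 0" unfolding add2 add3 by (simp add: eq23 add.commute)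
  then show ?thesis by (metis add_eq_0_iff)
qed

lemma sum1: "F (\<Sum>i\<in>I. c i *s f i) v w = (\<Sum>i\<in>I. c i *s F (f i) v w)"
  using scale1[of 0 0 v w]
  by (induction I rule: infinite_finite_induct) (simp_all add: add1 scale1)

lemma sum2: "F u (\<Sum>i\<in>I. c i *s f i) w = (\<Sum>i\<in>I. c i *s F u (f i) w)"
  using scale2[of u 0 0 w]
  by (induction I rule: infinite_finite_induct) (simp_all add: add2 scale2)

lemma sum3: "F u v (\<Sum>i\<in>I. c i *s f i) = (\<Sum>i\<in>I. c i *s F u v (f i))"
  using scale3[of u v 0 0]
  by (induction I rule: infinite_finite_induct) (simp_all add: add3 scale3)

lemma zero_on_basis:
  assumes basis: "\<And>i j k. i < j \<Longrightarrow> j < k \<Longrightarrow> F (axis i 1) (axis j 1) (axis k 1) = 0"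
  shows "F u v w = 0"
proof -
  have "F (axis i 1) (axis j 1) (axis k 1) = 0" if "i \<le> j" for i j k
  proof -
    consider "i = j" | "j = k" | "i = k" | "i < j" "j < k" | "i < k" "k < j" | "k < i" "i < j"
      using \<open>i \<le> j\<close> by (metis linorder_less_linear order_le_less)
    then show ?thesis
    proof cases
      case 5 then show ?thesis using basis[of i k j] by (subst swap23) simp
    next
      case 6 then show ?thesis using basis[of k i j] by (subst swap23, subst swap12) simp
    qed (auto simp: eq12 eq23 eq13 basis)
  qed note le = this
  have "F (axis i 1) (axis j 1) (axis k 1) = 0" for i j k
    using le[of i j k] le[of j i k] swap12[of "axis i 1" "axis j 1" "axis k 1"]
    by (cases "i \<le> j") auto
  then have "F (\<Sum>i\<in>UNIV. u $ i *s axis i 1) (\<Sum>i\<in>UNIV. v $ i *s axis i 1) (\<Sum>i\<in>UNIV. w $ i *s axis i 1) = 0"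
    by (simp only: sum1 sum2 sum3) simp
  then show ?thesis by (simp only: basis_expansion)
qed

lemma dependent_zero:
  assumes "a *s u + b *s v + c *s w = 0" "a \<noteq> 0 \<or> b \<noteq> 0 \<or> c \<noteq> 0"
  shows "F u v w = 0"
proof -
  have zero: "F 0 v w = 0" "F u 0 w = 0" "F u v 0 = 0" for u v w
    using scale1[of 0 0] scale2[of _ 0 0] scale3[of _ _ 0 0] by simp_all
  have "a *s F u v w = F (a *s u + b *s v + c *s w) v w"
    by (simp add: add1 scale1 eq12 eq13)
  moreover have "b *s F u v w = F u (a *s u + b *s v + c *s w) w"
    by (simp add: add2 scale2 eq12 eq23)
  moreover have "c *s F u v w = F u v (a *s u + b *s v + c *s w)"
    by (simp add: add3 scale3 eq13 eq23)
  ultimately show ?thesis using assms by (auto simp: zero)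
qed

end

interpretation wedge3: alternating3 "\<lambda>u v w. wedge [u, v, w]"
  by standard
    (simp_all add: Finite_Cartesian_Product.vec_eq_iff wedge3_nth minor3_def algebra_simps)

lemma wedge3_axis:
  fixes i j k :: "'n::{finite, linorder}"
  assumes "i < j" "j < k"
  shows "wedge [axis i 1, axis j 1, axis k 1] = axis {i, j, k} (1 :: 'a::field)"
proof -
  have "wedge [axis i 1, axis j 1, axis k 1] $ S = axis {i, j, k} (1 :: 'a) $ S" for S
  proof (cases "card S = 3")
    case True
    then obtain i' j' k' where S: "i' < j'" "j' < k'" "S = {i', j', k'}"
      "sorted_list_of_set S = [i', j', k']" by (rule card_3_sorted)
    have "S = {i, j, k} \<longleftrightarrow> i = i' \<and> j = j' \<and> k = k'"
      using S assms sorted_list_of_set_3[OF assms] by (metis list.inject)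
    moreover have "wedge [axis i 1, axis j 1, axis k 1] $ S = (minor3 (axis i 1) (axis j 1) (axis k 1) i' j' k' :: 'a)"
      using True by (simp add: wedge3_nth S(4))
    moreover have "minor3 (axis i 1) (axis j 1) (axis k 1) i' j' k' = (if i = i' \<and> j = j' \<and> k = k' then 1 else 0 :: 'a)"
      using S assms by (auto simp: minor3_def axis_def)
    ultimately show ?thesis by (simp add: axis_def)
  next
    case False
    moreover have "card {i, j, k} = 3" using assms by (rule card_3_less)
    ultimately show ?thesis by (auto simp: wedge3_nth axis_def)
  qed
  then show ?thesis by (simp add: Finite_Cartesian_Product.vec_eq_iff)
qed

lemma wedge3_nonzero_basis:
  assumes "wedge [u, v, w] \<noteq> (0 :: 'a::field ^ ('n::{finite, linorder} set))"
  shows "is_basis [u, v, w] (vec.span {u, v, w})"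
proof -
  have dep: "a = 0 \<and> b = 0 \<and> c = 0" if "a *s u + b *s v + c *s w = 0" for a b c
    using wedge3.dependent_zero[OF that] assms by blast
  have "u \<noteq> v" "u \<noteq> w" "v \<noteq> w" 
    using assms by (auto simp: wedge3.eq12 wedge3.eq13 wedge3.eq23)
  moreover have "vec.independent {u, v, w}"
  proof
    assume "vec.dependent {u, v, w}"
    then obtain f where f: "\<exists>x\<in>{u, v, w}. f x \<noteq> 0" "(\<Sum>x\<in>{u, v, w}. f x *s x) = 0"
      using vec.dependent_finite[of "{u, v, w}"] by auto
    then have "f u *s u + f v *s v + f w *s w = 0"
      using \<open>u \<noteq> v\<close> \<open>u \<noteq> w\<close> \<open>v \<noteq> w\<close> by (simp add: add.assoc)
    then show False using dep f(1) by blast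
  qed
  ultimately show ?thesis by (simp add: is_basis_def)
qed

text \<open>The universal property of the third exterior power. Both sides are alternating trilinear, so it
  is enough to compare them on increasing triples of basis vectors.\<close>

lemma alternating3_wedge:
  fixes F :: "'a::field ^ 'n::{finite, linorder} \<Rightarrow> 'a ^ 'n::{finite, linorder} \<Rightarrow> 'a ^ 'n::{finite, linorder} \<Rightarrow> 'a ^ 'm::finite"
  assumes "alternating3 F"
  shows "F u v w = (\<Sum>S\<in>{S. card S = 3}. wedge [u, v, w] $ S *s
    F (axis (sorted_list_of_set S ! 0) 1) (axis (sorted_list_of_set S ! 1) 1) (axis (sorted_list_of_set S ! 2) 1))"
proof -
  interpret F: alternating3 F by (rule assms)
  define E where "E S = F (axis (sorted_list_of_set S ! 0) 1) (axis (sorted_list_of_set S ! 1) 1)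
    (axis (sorted_list_of_set S ! 2) 1)" for S
  define H where "H u v w = F u v w - (\<Sum>S\<in>{S. card S = 3}. wedge [u, v, w] $ S *s E S)" for u v w
  have "alternating3 H"
    by standard (simp_all add: H_def F.add1 F.add2 F.add3 F.scale1 F.scale2 F.scale3 F.eq12 F.eq13 F.eq23
        wedge3.add1 wedge3.add2 wedge3.add3 wedge3.scale1 wedge3.scale2 wedge3.scale3
        wedge3.eq12 wedge3.eq13 wedge3.eq23 vec.scale_left_distrib sum.distrib
        vec.scale_right_diff_distrib vec.scale_sum_right)
  then interpret H: alternating3 H .
  have "H u v w = 0"
  proof (rule H.zero_on_basis)
    fix i j k :: 'n assume ijk: "i < j" "j < k"
    have "(\<Sum>S\<in>{S. card S = 3}. axis {i, j, k} 1 $ S *s E S) = (\<Sum>S\<in>{{i, j, k}}. E S)"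
      using card_3_less[OF ijk] by (intro sum.mono_neutral_cong_right) (auto simp: axis_def)
    then show "H (axis i 1) (axis j 1) (axis k 1) = 0"
      by (simp only: H_def wedge3_axis[OF ijk] sum.insert finite.emptyI empty_iff not_False_eq_True
          sum.empty add_0_right) (simp only: E_def sorted_list_of_set_3[OF ijk], simp)
  qed
  then show ?thesis by (simp add: H_def E_def)
qed

section \<open>The flattening of a trivector in dimension seven\<close>

text \<open>The determinant as an alternating form in \<open>n\<close> vectors. On \<open>K\<^sup>7\<close> it replaces the identification of the
  top exterior power with the field.\<close>

definition vol :: "('n::finite \<Rightarrow> 'a::field ^ 'n) \<Rightarrow> 'a" where
  "vol f = Determinants.det (\<chi> i. f i)"

lemma vol_add: "vol (f(k := x + y)) = vol (f(k := x)) + vol (f(k := y))"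
  using Determinants.det_row_add[of k "\<lambda>_. x" "\<lambda>_. y" f] by (simp add: vol_def fun_upd_def)

lemma vol_scale: "vol (f(k := c *s x)) = c * vol (f(k := x))"
  using Determinants.det_row_mul[of k c "\<lambda>_. x" f] by (simp add: vol_def fun_upd_def)

lemma vol_eq: "i \<noteq> j \<Longrightarrow> f i = f j \<Longrightarrow> vol f = 0"
  unfolding vol_def by (rule Determinants.det_identical_rows[of i j]) (simp_all add: Finite_Cartesian_Product.row_def)

lemma vol_permute:
  assumes "p permutes UNIV"
  shows "vol (f \<circ> p) = of_int (sign p) * vol f"
  using Determinants.det_permute_rows[OF assms, of "\<chi> i. f i"] by (simp add: vol_def)

lemma vol_basis:
  fixes p :: "'b::finite \<Rightarrow> 'b"
  assumes "inj p"
  shows "vol (\<lambda>i. axis (p i) 1) \<noteq> (0 :: 'a::field)"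
proof -
  have p: "p permutes UNIV"
    using assms by (simp add: permutes_def) (metis finite_UNIV_inj_surj surj_def injD finite_class.finite_UNIV)
  have "(\<chi> i. axis i 1) = (Finite_Cartesian_Product.mat 1 :: 'a ^ 'b ^ 'b)"
    by (simp add: Finite_Cartesian_Product.vec_eq_iff Finite_Cartesian_Product.mat_def axis_def)
  then have "vol (\<lambda>i :: 'b. axis i (1 :: 'a)) = 1"
    by (simp add: vol_def)
  then show ?thesis
    using vol_permute[OF p, of "\<lambda>i. axis i (1 :: 'a)"] by (simp add: o_def sign_def)
qed

lemma exhaust_7: "x = 0 \<or> x = 1 \<or> x = 2 \<or> x = 3 \<or> x = 4 \<or> x = 5 \<or> x = 6" for x :: 7
proof (induct x)
  case (of_int z)
  then have "0 \<le> z" "z < 7" by simp_all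
  then have "z = 0 \<or> z = 1 \<or> z = 2 \<or> z = 3 \<or> z = 4 \<or> z = 5 \<or> z = 6" by arith
  then show ?case by auto
qed

definition tup7 :: "'b \<Rightarrow> 'b \<Rightarrow> 'b \<Rightarrow> 'b \<Rightarrow> 'b \<Rightarrow> 'b \<Rightarrow> 'b \<Rightarrow> 7 \<Rightarrow> 'b" where
  "tup7 a b c d e f g = (\<lambda>i. if i = 0 then a else if i = 1 then b else if i = 2 then c
     else if i = 3 then d else if i = 4 then e else if i = 5 then f else g)"

lemma tup7_nth [simp]:
  "tup7 a b c d e f g 0 = a" "tup7 a b c d e f g 1 = b" "tup7 a b c d e f g 2 = c"
  "tup7 a b c d e f g 3 = d" "tup7 a b c d e f g 4 = e" "tup7 a b c d e f g 5 = f"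
  "tup7 a b c d e f g 6 = g"
  by (simp_all add: tup7_def)

lemma tup7_upd:
  "(tup7 a b c d e f g)(0 := x) = tup7 x b c d e f g"
  "(tup7 a b c d e f g)(1 := x) = tup7 a x c d e f g"
  "(tup7 a b c d e f g)(2 := x) = tup7 a b x d e f g"
  "(tup7 a b c d e f g)(3 := x) = tup7 a b c x e f g"
  "(tup7 a b c d e f g)(4 := x) = tup7 a b c d x f g"
  by (auto simp: fun_eq_iff tup7_def)

abbreviation vol7 :: "'a::field ^ 7 \<Rightarrow> 'a ^ 7 \<Rightarrow> 'a ^ 7 \<Rightarrow> 'a ^ 7 \<Rightarrow> 'a ^ 7 \<Rightarrow> 'a ^ 7 \<Rightarrow> 'a ^ 7 \<Rightarrow> 'a" where
  "vol7 a b c d e f g \<equiv> vol (tup7 a b c d e f g)"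

lemma vol7_add:
  "vol7 (x + y) b c d e f g = vol7 x b c d e f g + vol7 y b c d e f g"
  "vol7 a (x + y) c d e f g = vol7 a x c d e f g + vol7 a y c d e f g"
  "vol7 a b (x + y) d e f g = vol7 a b x d e f g + vol7 a b y d e f g"
  "vol7 a b c (x + y) e f g = vol7 a b c x e f g + vol7 a b c y e f g"
  "vol7 a b c d (x + y) f g = vol7 a b c d x f g + vol7 a b c d y f g"
  using vol_add[of "tup7 0 b c d e f g" 0] vol_add[of "tup7 a 0 c d e f g" 1]
    vol_add[of "tup7 a b 0 d e f g" 2] vol_add[of "tup7 a b c 0 e f g" 3]
    vol_add[of "tup7 a b c d 0 f g" 4]
  by (simp_all only: tup7_upd)

lemma vol7_scale:
  "vol7 (r *s x) b c d e f g = r * vol7 x b c d e f g"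
  "vol7 a (r *s x) c d e f g = r * vol7 a x c d e f g"
  "vol7 a b (r *s x) d e f g = r * vol7 a b x d e f g"
  "vol7 a b c (r *s x) e f g = r * vol7 a b c x e f g"
  "vol7 a b c d (r *s x) f g = r * vol7 a b c d x f g"
  using vol_scale[of "tup7 0 b c d e f g" 0] vol_scale[of "tup7 a 0 c d e f g" 1]
    vol_scale[of "tup7 a b 0 d e f g" 2] vol_scale[of "tup7 a b c 0 e f g" 3]
    vol_scale[of "tup7 a b c d 0 f g" 4]
  by (simp_all only: tup7_upd)

lemma vol7_eq:
  "vol7 x x c d e f g = 0" "vol7 a x x d e f g = 0" "vol7 x b x d e f g = 0"
  "vol7 x b c x e f g = 0" "vol7 a x c x e f g = 0" "vol7 a b x x e f g = 0"
  "vol7 x b c d x f g = 0" "vol7 a x c d x f g = 0" "vol7 a b x d x f g = 0"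
  "vol7 a b c x x f g = 0"
  by (rule vol_eq[of 0 1], simp, simp) (rule vol_eq[of 1 2], simp, simp, rule vol_eq[of 0 2], simp, simp,
    rule vol_eq[of 0 3], simp, simp, rule vol_eq[of 1 3], simp, simp, rule vol_eq[of 2 3], simp, simp,
    rule vol_eq[of 0 4], simp, simp, rule vol_eq[of 1 4], simp, simp, rule vol_eq[of 2 4], simp, simp,
    rule vol_eq[of 3 4], simp, simp)

text \<open>This is an even permutation of the arguments. It makes the flattening a symmetric matrix.\<close>

lemma vol7_swap_pairs: "vol7 a b c f g d e = vol7 a b c d e f g"
proof -
  define p :: "7 \<Rightarrow> 7" where "p = Transposition.transpose 3 5 \<circ> Transposition.transpose 4 6"
  have "tup7 a b c f g d e = tup7 a b c d e f g \<circ> p"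
  proof
    fix i show "tup7 a b c f g d e i = (tup7 a b c d e f g \<circ> p) i"
      using exhaust_7[of i] by (auto simp: p_def Transposition.transpose_def)
  qed
  moreover have "p permutes UNIV" unfolding p_def
    by (intro permutes_compose permutes_swap_id) auto
  moreover have "sign p = 1" unfolding p_def
    by (subst sign_compose) (auto simp: sign_swap_id permutation_swap_id)
  ultimately show ?thesis by (simp add: vol_permute)
qed

abbreviation basis_at :: "'n::{finite, linorder} set \<Rightarrow> nat \<Rightarrow> 'a::field ^ 'n::{finite, linorder}" where
  "basis_at S k \<equiv> axis (sorted_list_of_set S ! k) 1"

text \<open>The linear form \<open>x \<mapsto> u \<and> v \<and> w \<and> a \<and> b \<and> x\<close> on bivectors, in coordinates.\<close>

definition vol_row :: "'a::field ^ 7 \<Rightarrow> 'a ^ 7 \<Rightarrow> 'a ^ 7 \<Rightarrow> 'a ^ 7 \<Rightarrow> 'a ^ 7 \<Rightarrow> 'a ^ (7 set)" where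
  "vol_row u v w a b = (\<chi> P. if card P = 2 then vol7 u v w a b (basis_at P 0) (basis_at P 1) else 0)"

lemma vol_row_simps:
  "vol_row u v w (x + y) b = vol_row u v w x b + vol_row u v w y b"
  "vol_row u v w a (x + y) = vol_row u v w a x + vol_row u v w a y"
  "vol_row u v w (r *s x) b = r *s vol_row u v w x b"
  "vol_row u v w a (r *s x) = r *s vol_row u v w a x"
  "vol_row u v w u b = 0" "vol_row u v w v b = 0" "vol_row u v w w b = 0"
  "vol_row u v w a u = 0" "vol_row u v w a v = 0" "vol_row u v w a w = 0"
  "vol_row u v w a a = 0"
  by (simp_all add: vol_row_def Finite_Cartesian_Product.vec_eq_iff vol7_add vol7_scale vol7_eq)

lemma vol_row_alternating: "alternating3 (\<lambda>u v w. vol_row u v w a b)"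
  by standard
    (simp_all add: vol_row_def Finite_Cartesian_Product.vec_eq_iff vol7_add vol7_scale vol7_eq)

text \<open>The form depends only on the classes of \<open>a\<close> and \<open>b\<close> modulo the span of \<open>u, v, w\<close>, and is alternating
  in them. If \<open>u, v, w\<close> are independent, the quotient has dimension 4 and its second exterior power
  dimension 6.\<close>

lemma vol_row_rank:
  fixes u v w :: "'a::field ^ 7"
  shows "\<exists>T. finite T \<and> card T \<le> 6 \<and> (\<forall>a b. vol_row u v w a b \<in> vec.span T)"
proof (cases "wedge [u, v, w] = 0")
  case True
  have "vol_row u v w a b = 0" for a b
    by (subst alternating3_wedge[OF vol_row_alternating]) (simp add: True)
  then show ?thesis by (intro exI[of _ "{}"]) simp
next
  case False
  define E where "E = vec.extend_basis {u, v, w}"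
  have uvw: "vec.independent {u, v, w}" "u \<noteq> v" "u \<noteq> w" "v \<noteq> w"
    using wedge3_nonzero_basis[OF False] by (auto simp: is_basis_def)
  have E: "{u, v, w} \<subseteq> E" "vec.independent E" "vec.span E = UNIV"
    unfolding E_def using uvw(1) vec.extend_basis_superset vec.independent_extend_basis
      vec.span_extend_basis by blast+
  have "card E = vec.dim (UNIV :: ('a ^ 7) set)"
    by (rule vec.basis_card_eq_dim) (use E in auto)
  then have "card E = 7" by (simp add: card_cart_basis)
  moreover have "finite E" using E(2) vec.finiteI_independent by blast
  moreover have "card {u, v, w} = 3" using uvw by simp
  ultimately have "card (E - {u, v, w}) = 4" "finite (E - {u, v, w})"
    using E(1) by (simp_all add: card_Diff_subset)
  then obtain rs where rs: "set rs = E - {u, v, w}" "length rs = 4"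
    by (metis distinct_card finite_distinct_list)
  then obtain r0 r1 r2 r3 where "rs = [r0, r1, r2, r3]"
    by (auto simp: length_Suc_conv eval_nat_numeral)
  then have r: "E \<subseteq> {u, v, w} \<union> {r0, r1, r2, r3}" using rs(1) by auto
  define G where "G = vol_row u v w"
  define T where "T = set [G r0 r1, G r0 r2, G r0 r3, G r1 r2, G r1 r3, G r2 r3]"
  have flip: "G x y = - G y x" for x y
  proof -
    have "vol_row u v w (x + y) (x + y) = 0" by (rule vol_row_simps)
    then have "G x y + G y x = 0" unfolding vol_row_simps(1,2) by (simp add: G_def vol_row_simps(11) add.commute)
    then show ?thesis by (simp add: add_eq_0_iff2)
  qed
  have T: "G r0 r1 \<in> vec.span T" "G r0 r2 \<in> vec.span T" "G r0 r3 \<in> vec.span T"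
    "G r1 r2 \<in> vec.span T" "G r1 r3 \<in> vec.span T" "G r2 r3 \<in> vec.span T"
    by (auto simp: T_def intro: vec.span_base)
  then have T': "G r1 r0 \<in> vec.span T" "G r2 r0 \<in> vec.span T" "G r3 r0 \<in> vec.span T"
    "G r2 r1 \<in> vec.span T" "G r3 r1 \<in> vec.span T" "G r3 r2 \<in> vec.span T"
    using flip[of r1 r0] flip[of r2 r0] flip[of r3 r0] flip[of r2 r1] flip[of r3 r1] flip[of r3 r2]
    by (simp_all add: vec.span_neg)
  have EE: "G x y \<in> vec.span T" if xy: "x \<in> E" "y \<in> E" for x y
  proof -
    consider "x \<in> {u, v, w}" | "y \<in> {u, v, w}" | "x \<in> {r0, r1, r2, r3}" "y \<in> {r0, r1, r2, r3}"
      using xy r by blast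
    then show ?thesis
    proof cases
      case 1 then show ?thesis by (auto simp: G_def vol_row_simps vec.span_zero)
    next
      case 2 then show ?thesis by (auto simp: G_def vol_row_simps vec.span_zero)
    next
      case 3
      have "G x x = 0" for x by (simp add: G_def vol_row_simps)
      with 3 show ?thesis using T T' by (auto simp: vec.span_zero)
    qed
  qed
  have zero: "vol_row u v w 0 b = 0" "vol_row u v w a 0 = 0" for a b
    using vol_row_simps(3)[of u v w 0 0 b] vol_row_simps(4)[of u v w a 0 0] by simp_all
  have "vec.subspace {a. \<forall>y\<in>E. G a y \<in> vec.span T}"
    unfolding vec.subspace_def
    by (auto simp: zero vec.span_zero G_def vol_row_simps vec.span_add vec.span_scale)
  then have "vec.span E \<subseteq> {a. \<forall>y\<in>E. G a y \<in> vec.span T}"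
    by (intro vec.span_minimal) (use EE in auto)
  then have UE: "G a y \<in> vec.span T" if "y \<in> E" for a y using E(3) that by blast
  have "G a b \<in> vec.span T" for a b
  proof -
    have "vec.subspace {b. G a b \<in> vec.span T}"
      unfolding vec.subspace_def
      by (auto simp: zero vec.span_zero G_def vol_row_simps vec.span_add vec.span_scale)
    then have "vec.span E \<subseteq> {b. G a b \<in> vec.span T}"
      by (intro vec.span_minimal) (use UE in auto)
    then show ?thesis using E(3) by blast
  qed
  moreover have "card T \<le> 6" unfolding T_def by (rule order_trans[OF card_length]) simp
  ultimately show ?thesis unfolding G_def by (intro exI[of _ T]) (auto simp: T_def)
qed

text \<open>For a trivector \<open>\<omega>\<close>, \<open>flat_row \<omega> a b\<close> is the linear form \<open>x \<mapsto> \<omega> \<and> a \<and> b \<and> x\<close> on bivectors. The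
  flattening is the \<open>21 \<times> 21\<close> matrix of the bilinear form \<open>(y, x) \<mapsto> \<omega> \<and> y \<and> x\<close> on bivectors, extended
  by an identity matrix to the index sets that are not pairs, which makes it square over a type.\<close>

definition flat_row :: "'a::field ^ (7 set) \<Rightarrow> 'a ^ 7 \<Rightarrow> 'a ^ 7 \<Rightarrow> 'a ^ (7 set)" where
  "flat_row \<omega> a b = (\<Sum>S\<in>{S. card S = 3}. \<omega> $ S *s vol_row (basis_at S 0) (basis_at S 1) (basis_at S 2) a b)"

definition flattening :: "'a::field ^ (7 set) \<Rightarrow> 'a ^ (7 set) ^ (7 set)" where
  "flattening \<omega> = (\<chi> Q. if card Q = 2 then flat_row \<omega> (basis_at Q 0) (basis_at Q 1) else axis Q 1)"

lemma flat_row_wedge: "flat_row (wedge [u, v, w]) a b = vol_row u v w a b"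
  unfolding flat_row_def by (rule alternating3_wedge[OF vol_row_alternating, symmetric])

lemma det_flattening_alg: "(\<lambda>\<omega>. Determinants.det (flattening \<omega>)) \<in> alg coords"
proof -
  have "(\<lambda>\<omega>. flattening \<omega> $ Q $ P) \<in> alg coords" for Q P
  proof (cases "card Q = 2")
    case True
    have "(\<lambda>\<omega>. \<Sum>S\<in>{S. card S = 3}. \<omega> $ S * vol_row (basis_at S 0) (basis_at S 1) (basis_at S 2)
        (basis_at Q 0) (basis_at Q 1) $ P) \<in> alg coords"
      by (intro alg_sum alg.mult alg.const coord_alg)
    then show ?thesis using True by (simp add: flattening_def flat_row_def)
  next
    case False
    then show ?thesis by (simp add: flattening_def alg.const)
  qed
  then have "(\<lambda>\<omega>. \<Sum>p\<in>{p. p permutes UNIV}. of_int (sign p) * (\<Prod>i\<in>UNIV. flattening \<omega> $ i $ p i)) \<in> alg coords"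
    by (intro alg_sum alg.mult alg.const alg_prod)
  then show ?thesis by (simp add: Determinants.det_def)
qed

lemma card_pairs_7: "card {Q :: 7 set. card Q = 2} = 21"
proof -
  have "card {Q :: 7 set. Q \<subseteq> UNIV \<and> card Q = 2} = card (UNIV :: 7 set) choose 2"
    by (rule n_subsets) simp
  then show ?thesis by (simp add: choose_two)
qed

text \<open>The 21 rows indexed by pairs lie in the span of 18 vectors.\<close>

lemma det_flattening_zero:
  assumes T: "finite T" "card T \<le> 18" "\<And>a b. flat_row \<omega> a b \<in> vec.span T"
  shows "Determinants.det (flattening \<omega>) = 0"
proof (rule ccontr)
  assume nz: "Determinants.det (flattening \<omega>) \<noteq> 0"
  let ?P = "{Q :: 7 set. card Q = 2}"
  have inj: "inj_on (\<lambda>Q. flattening \<omega> $ Q) ?P"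
  proof (rule inj_onI)
    fix Q Q' assume "flattening \<omega> $ Q = flattening \<omega> $ Q'"
    then show "Q = Q'"
      using nz Determinants.det_identical_rows[of Q Q' "flattening \<omega>"] by (auto simp: Finite_Cartesian_Product.row_def)
  qed
  have "vec.independent (Finite_Cartesian_Product.rows (flattening \<omega>))"
    using nz Determinants.det_dependent_rows by blast
  moreover have "(\<lambda>Q. flattening \<omega> $ Q) ` ?P \<subseteq> Finite_Cartesian_Product.rows (flattening \<omega>)"
    by (auto simp: Finite_Cartesian_Product.rows_def Finite_Cartesian_Product.row_def)
  ultimately have ind: "vec.independent ((\<lambda>Q. flattening \<omega> $ Q) ` ?P)"
    using vec.independent_mono by blast
  have "(\<lambda>Q. flattening \<omega> $ Q) ` ?P \<subseteq> vec.span T"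
    using T(3) by (auto simp: flattening_def)
  then have "card ((\<lambda>Q. flattening \<omega> $ Q) ` ?P) \<le> card T"
    using vec.independent_span_bound[OF T(1) ind] by blast
  then show False using T(2) by (simp add: card_image[OF inj] card_pairs_7)
qed

lemma card_2_sorted:
  fixes S :: "'n::linorder set"
  assumes "card S = 2"
  obtains i j where "S = {i, j}" "sorted_list_of_set S = [i, j]"
proof -
  have fin: "finite S" using assms by (metis card.infinite zero_neq_numeral)
  have *: "\<exists>i j. l = [i, j]" if "length l = 2" for l :: "'n list"
    using that by (auto simp: numeral_2_eq_2 length_Suc_conv)
  have "length (sorted_list_of_set S) = 2" using assms by simp
  then obtain i j where s: "sorted_list_of_set S = [i, j]" using * by blast
  moreover have "S = {i, j}" using set_sorted_list_of_set[OF fin] unfolding s by auto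
  ultimately show ?thesis using that by blast
qed

lemma UNIV_7: "(UNIV :: 7 set) = {0, 1, 2, 3, 4, 5, 6}"
  using exhaust_7 by auto

lemma vol7_partition:
  fixes S Q P :: "7 set"
  assumes "card S = 3" "card Q = 2" "card P = 2"
  shows "vol7 (basis_at S 0) (basis_at S 1) (basis_at S 2) (basis_at Q 0) (basis_at Q 1)
    (basis_at P 0) (basis_at P 1) \<noteq> (0 :: 'a::field) \<longleftrightarrow> S \<union> Q \<union> P = UNIV"
proof -
  obtain s0 s1 s2 where S: "S = {s0, s1, s2}" "sorted_list_of_set S = [s0, s1, s2]"
    using assms(1) by (rule card_3_sorted)
  obtain q0 q1 where Q: "Q = {q0, q1}" "sorted_list_of_set Q = [q0, q1]"
    using assms(2) by (rule card_2_sorted)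
  obtain p0 p1 where P: "P = {p0, p1}" "sorted_list_of_set P = [p0, p1]"
    using assms(3) by (rule card_2_sorted)
  let ?p = "tup7 s0 s1 s2 q0 q1 p0 p1"
  have tup: "tup7 (axis s0 1) (axis s1 1) (axis s2 1) (axis q0 1) (axis q1 1) (axis p0 1) (axis p1 (1 :: 'a))
      = (\<lambda>i. axis (?p i) 1)"
    by (auto simp: fun_eq_iff tup7_def)
  have range: "range ?p = S \<union> Q \<union> P"
    unfolding UNIV_7 S(1) Q(1) P(1) by auto
  have "vol (\<lambda>i. axis (?p i) 1) \<noteq> (0 :: 'a) \<longleftrightarrow> inj ?p"
  proof
    assume nz: "vol (\<lambda>i. axis (?p i) 1) \<noteq> (0 :: 'a)"
    show "inj ?p"
    proof (rule injI, rule ccontr)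
      fix i j assume "?p i = ?p j" "i \<noteq> j"
      then show False using nz vol_eq[of i j "\<lambda>i. axis (?p i) (1 :: 'a)"] by simp
    qed
  qed (rule vol_basis)
  also have "inj ?p \<longleftrightarrow> surj ?p"
    using finite_UNIV_inj_surj[of ?p] finite_UNIV_surj_inj[of ?p] by auto
  finally show ?thesis unfolding S(2) Q(2) P(2) by (simp add: tup range)
qed

section \<open>A nondegenerate flattening from the Fano plane\<close>

text \<open>The sum of the basis trivectors over the lines of the Fano plane \<open>{i, i + 1, i + 3}\<close> modulo 7; with
  suitable signs these are the terms of the invariant trivector of the group \<open>G\<^sub>2\<close>. Signs do not
  affect which entries of the flattening vanish.\<close>

definition fano_form :: "'a::field ^ (7 set)" where
  "fano_form = (\<chi> S. if S \<in> range (\<lambda>m. {m, m + 1, m + 3}) then 1 else 0)"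

definition entry :: "7 set \<Rightarrow> 7 set \<Rightarrow> 'a::field" where
  "entry Q P = flat_row fano_form (basis_at Q 0) (basis_at Q 1) $ P"

lemma entry_sym:
  assumes "card P = 2" "card Q = 2"
  shows "entry Q P = entry P Q"
  using assms by (simp add: entry_def flat_row_def vol_row_def vol7_swap_pairs)

lemma card_line: "card {m, m + 1, m + 3 :: 7} = 3"
  by simp

text \<open>Only the complement of \<open>Q \<union> P\<close> can contribute to the entry, and it does if it is a line.\<close>

lemma entry_nonzero:
  assumes Q: "card Q = 2" and P: "card P = 2"
  shows "entry Q P \<noteq> (0 :: 'a::field) \<longleftrightarrow> (\<exists>m. {m, m + 1, m + 3} \<union> Q \<union> P = UNIV)"
proof -
  let ?R = "- (Q \<union> P)"
  let ?v = "\<lambda>S. vol7 (basis_at S 0) (basis_at S 1) (basis_at S 2) (basis_at Q 0) (basis_at Q 1)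
    (basis_at P 0) (basis_at P 1) :: 'a"
  define R where "R = - (Q \<union> P)"
  have "card (Q \<union> P) \<le> 4" using card_Un_le[of Q P] Q P by simp
  then have "card R \<ge> 3"
    unfolding R_def Compl_eq_Diff_UNIV by (subst card_Diff_subset) auto
  have unique: "S = R" if "card S = 3" "S \<union> Q \<union> P = UNIV" for S
  proof -
    have "R \<subseteq> S" using that(2) unfolding R_def by blast
    then show ?thesis using card_seteq[of S R] \<open>card R \<ge> 3\<close> that(1) by simp
  qed
  have "entry Q P = (\<Sum>S\<in>{S. card S = 3}. fano_form $ S * ?v S)"
    using P by (simp add: entry_def flat_row_def vol_row_def)
  also have "\<dots> = (\<Sum>S\<in>(if card R = 3 then {R} else {}). fano_form $ S * ?v S)"
  proof (intro sum.mono_neutral_right ballI)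
    fix S assume "S \<in> {S. card S = 3} - (if card R = 3 then {R} else {})"
    then have S: "card S = 3" "S \<noteq> R" by (auto split: if_splits)
    then have "?v S = 0" using vol7_partition[OF S(1) Q P, where 'a = 'a] unique[OF S(1)] by blast
    then show "fano_form $ S * ?v S = 0" by simp
  qed simp_all
  finally have e: "entry Q P = (if card R = 3 then fano_form $ R * ?v R else 0)" by simp
  show ?thesis
  proof
    assume "entry Q P \<noteq> (0 :: 'a)"
    then have "fano_form $ R \<noteq> (0 :: 'a)" unfolding e by (auto split: if_splits)
    then obtain m where "R = {m, m + 1, m + 3}" by (auto simp: fano_form_def split: if_splits)
    then show "\<exists>m. {m, m + 1, m + 3} \<union> Q \<union> P = UNIV"
      unfolding R_def by (intro exI[of _ m]) blast
  next
    assume "\<exists>m. {m, m + 1, m + 3} \<union> Q \<union> P = UNIV"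
    then obtain m where m: "{m, m + 1, m + 3} \<union> Q \<union> P = UNIV" by blast
    then have eq: "{m, m + 1, m + 3} = R" by (intro unique card_line)
    have "card R = 3" using card_line[of m] unfolding eq .
    moreover have "fano_form $ R = (1 :: 'a)" unfolding eq[symmetric] by (auto simp: fano_form_def)
    moreover have "?v R \<noteq> 0"
      using vol7_partition[OF \<open>card R = 3\<close> Q P, where 'a = 'a] m unfolding eq by blast
    ultimately show "entry Q P \<noteq> (0 :: 'a)" unfolding e by (simp only: if_True mult_1_left) simp
  qed
qed

lemma all_translates: "(\<forall>x. Pr x) \<longleftrightarrow> Pr m \<and> Pr (m + 1) \<and> Pr (m + 2) \<and> Pr (m + 3) \<and> Pr (m + 4)
    \<and> Pr (m + 5) \<and> Pr (m + 6)" for m :: 7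
proof
  assume *: "Pr m \<and> Pr (m + 1) \<and> Pr (m + 2) \<and> Pr (m + 3) \<and> Pr (m + 4) \<and> Pr (m + 5) \<and> Pr (m + 6)"
  show "\<forall>x. Pr x"
  proof
    fix x
    define d where "d = x - m"
    have x: "x = m + d" by (simp add: d_def)
    show "Pr x" unfolding x using exhaust_7[of d] * by (elim disjE) simp_all
  qed
qed simp

lemma card_2_eq: "card P = 2 \<Longrightarrow> x \<in> P \<Longrightarrow> y \<in> P \<Longrightarrow> x \<noteq> y \<Longrightarrow> P = {x, y}"
  by (auto simp: card_2_iff)

text \<open>The three lines through \<open>m\<close>, with \<open>m\<close> removed.\<close>

definition pencil :: "7 \<Rightarrow> 7 set set" where
  "pencil m = {{m + 1, m + 3}, {m + 2, m + 6}, {m + 4, m + 5}}"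

text \<open>Counting shows that the line \<open>{i, i + 1, i + 3}\<close> must be disjoint from \<open>Q\<close>. It then passes through \<open>m\<close>,
  since it meets the line formed by \<open>m\<close> and \<open>Q\<close>. So \<open>P\<close> is what the third line through \<open>m\<close> leaves.\<close>

lemma pencil_closed:
  assumes "card P = 2" "Q \<in> pencil m" "{i, i + 1, i + 3} \<union> Q \<union> P = UNIV"
  shows "P \<in> pencil m - {Q}"
proof -
  define d where "d = i - m"
  have i: "i = m + d" by (simp add: d_def)
  let ?l = "{m + d, m + d + 1, m + d + 3}"
  have Q: "card Q = 2" using assms(2) by (auto simp: pencil_def)
  have U: "?l \<union> Q \<union> P = UNIV" using assms(3) unfolding i .
  have l: "card ?l = 3" by (rule card_line)
  have "7 \<le> card (?l \<union> Q) + card P"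
    using card_Un_le[of "?l \<union> Q" P] unfolding U by simp
  then have "card (?l \<union> Q) = 5"
    using card_Un_le[of ?l Q] assms(1) Q l by simp
  then have "card (?l \<inter> Q) = 0" using card_Un_Int[of ?l Q] Q l by simp
  then have disj: "?l \<inter> Q = {}" by simp
  have "card (- (?l \<union> Q)) = 2"
    unfolding Compl_eq_Diff_UNIV using \<open>card (?l \<union> Q) = 5\<close> by (subst card_Diff_subset) simp_all
  moreover have "- (?l \<union> Q) \<subseteq> P" using U by blast
  ultimately have P: "P = - (?l \<union> Q)"
    using card_seteq[of P "- (?l \<union> Q)"] assms(1) by simp
  consider (a) "Q = {m + 1, m + 3}" | (b) "Q = {m + 2, m + 6}" | (c) "Q = {m + 4, m + 5}"
    using assms(2) unfolding pencil_def by blast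
  then show ?thesis
  proof cases
    case a
    have "d = 4 \<or> d = 6" using exhaust_7[of d] disj unfolding a
      by (elim disjE) simp_all
    then show ?thesis
    proof
      assume d: "d = 4"
      have "m + 2 \<in> P" "m + 6 \<in> P" unfolding P d a by simp_all
      then have "P = {m + 2, m + 6}" by (intro card_2_eq[OF assms(1)]) simp_all
      then show ?thesis unfolding a by (simp add: pencil_def doubleton_eq_iff)
    next
      assume d: "d = 6"
      have "m + 4 \<in> P" "m + 5 \<in> P" unfolding P d a by simp_all
      then have "P = {m + 4, m + 5}" by (intro card_2_eq[OF assms(1)]) simp_all
      then show ?thesis unfolding a by (simp add: pencil_def doubleton_eq_iff)
    qed
  next
    case b
    have "d = 4 \<or> d = 0" using exhaust_7[of d] disj unfolding b
      by (elim disjE) simp_all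
    then show ?thesis
    proof
      assume d: "d = 4"
      have "m + 1 \<in> P" "m + 3 \<in> P" unfolding P d b by simp_all
      then have "P = {m + 1, m + 3}" by (intro card_2_eq[OF assms(1)]) simp_all
      then show ?thesis unfolding b by (simp add: pencil_def doubleton_eq_iff)
    next
      assume d: "d = 0"
      have "m + 4 \<in> P" "m + 5 \<in> P" unfolding P d b by simp_all
      then have "P = {m + 4, m + 5}" by (intro card_2_eq[OF assms(1)]) simp_all
      then show ?thesis unfolding b by (simp add: pencil_def doubleton_eq_iff)
    qed
  next
    case c
    have "d = 6 \<or> d = 0" using exhaust_7[of d] disj unfolding c
      by (elim disjE) simp_all
    then show ?thesis
    proof
      assume d: "d = 6"
      have "m + 1 \<in> P" "m + 3 \<in> P" unfolding P d c by simp_all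
      then have "P = {m + 1, m + 3}" by (intro card_2_eq[OF assms(1)]) simp_all
      then show ?thesis unfolding c by (simp add: pencil_def doubleton_eq_iff)
    next
      assume d: "d = 0"
      have "m + 2 \<in> P" "m + 6 \<in> P" unfolding P d c by simp_all
      then have "P = {m + 2, m + 6}" by (intro card_2_eq[OF assms(1)]) simp_all
      then show ?thesis unfolding c by (simp add: pencil_def doubleton_eq_iff)
    qed
  qed
qed

lemma pencil_card: "Q \<in> pencil m \<Longrightarrow> card Q = 2"
  by (auto simp: pencil_def)

lemma pencil_complement:
  assumes "Q \<in> pencil m" "P \<in> pencil m" "Q \<noteq> P"
  shows "\<exists>i. {i, i + 1, i + 3} \<union> Q \<union> P = UNIV"
proof -
  have "Q \<union> P = A \<union> B \<or> Q \<union> P = A \<union> C \<or> Q \<union> P = B \<union> C" if "Q \<in> {A, B, C}" "P \<in> {A, B, C}" for A B C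
    using that assms(3) by (elim insertE emptyE) (simp_all add: Un_commute)
  from this[OF assms(1,2)[unfolded pencil_def]]
  consider "Q \<union> P = {m + 1, m + 3} \<union> {m + 2, m + 6}" | "Q \<union> P = {m + 1, m + 3} \<union> {m + 4, m + 5}"
    | "Q \<union> P = {m + 2, m + 6} \<union> {m + 4, m + 5}" by blast
  then have "\<exists>d. {m + d, m + d + 1, m + d + 3} \<union> (Q \<union> P) = UNIV"
  proof cases
    case 1
    then have "\<forall>x. x \<in> {m + 4, m + 4 + 1, m + 4 + 3} \<union> (Q \<union> P)"
      unfolding all_translates[of _ m] by simp
    then show ?thesis by blast
  next
    case 2
    then have "\<forall>x. x \<in> {m + 6, m + 6 + 1, m + 6 + 3} \<union> (Q \<union> P)"
      unfolding all_translates[of _ m] by simp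
    then show ?thesis by blast
  next
    case 3
    then have "\<forall>x. x \<in> {m + 0, m + 0 + 1, m + 0 + 3} \<union> (Q \<union> P)"
      unfolding all_translates[of _ m] by simp
    then show ?thesis by blast
  qed
  then show ?thesis by (metis Un_assoc)
qed

lemma pencil_cover:
  assumes "card Q = 2"
  shows "\<exists>m. Q \<in> pencil m"
proof -
  obtain a b where Q: "Q = {a, b}" "a \<noteq> b" using assms by (auto simp: card_2_iff)
  define d where "d = b - a"
  have b: "b = a + d" by (simp add: d_def)
  have "d \<noteq> 0" using Q b by auto
  then consider "d = 1" | "d = 2" | "d = 3" | "d = 4" | "d = 5" | "d = 6" using exhaust_7[of d] by blast
  then show ?thesis
  proof cases
    case 1 then show ?thesis by (intro exI[of _ "a + 3"]) (simp add: pencil_def Q(1) b doubleton_eq_iff)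
  next
    case 2 then show ?thesis by (intro exI[of _ "a + 6"]) (simp add: pencil_def Q(1) b doubleton_eq_iff)
  next
    case 3 then show ?thesis by (intro exI[of _ "a + 1"]) (simp add: pencil_def Q(1) b doubleton_eq_iff)
  next
    case 4 then show ?thesis by (intro exI[of _ "a + 5"]) (simp add: pencil_def Q(1) b doubleton_eq_iff)
  next
    case 5 then show ?thesis by (intro exI[of _ "a + 4"]) (simp add: pencil_def Q(1) b doubleton_eq_iff)
  next
    case 6 then show ?thesis by (intro exI[of _ "a + 2"]) (simp add: pencil_def Q(1) b doubleton_eq_iff)
  qed
qed

text \<open>By the preceding lemmas the flattening splits into seven symmetric blocks of size 3, one for each
  pencil, with zero diagonal and nonzero entries \<open>a, b, c\<close> off the diagonal. Such a block has
  determinant \<open>2 a b c\<close>, whatever the signs of the entries.\<close>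

lemma det_flattening_fano: "Determinants.det (flattening fano_form) \<noteq> (0 :: 'a::field_char_0)"
proof -
  have "x = 0" if x: "flattening fano_form *v x = (0 :: 'a ^ (7 set))" for x
  proof -
    have row: "(\<Sum>P\<in>UNIV. flattening fano_form $ Q $ P * x $ P) = 0" for Q
      using x by (simp add: Finite_Cartesian_Product.vec_eq_iff matrix_vector_mult_def)
    have eq: "(\<Sum>P\<in>pencil m - {Q}. entry Q P * x $ P) = 0" if Q: "Q \<in> pencil m" for Q m
    proof -
      have "entry Q P = (0 :: 'a)" if "P \<notin> pencil m - {Q}" for P
      proof (cases "card P = 2")
        case True
        then show ?thesis
          using entry_nonzero[OF pencil_card[OF Q] True, where 'a = 'a] pencil_closed[OF True Q] that by blast
      next
        case False
        then show ?thesis by (simp add: entry_def flat_row_def vol_row_def)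
      qed
      then have "(\<Sum>P\<in>pencil m - {Q}. entry Q P * x $ P) = (\<Sum>P\<in>UNIV. entry Q P * x $ P)"
        by (intro sum.mono_neutral_left) auto
      also have "\<dots> = 0" using row[of Q] pencil_card[OF Q] by (simp add: flattening_def entry_def)
      finally show ?thesis .
    qed
    have "x $ Q = 0" for Q
    proof (cases "card Q = 2")
      case False
      have "(\<Sum>P\<in>UNIV. axis Q 1 $ P * x $ P) = 0" using row[of Q] False by (simp add: flattening_def)
      moreover have "(\<Sum>P\<in>UNIV. axis Q 1 $ P * x $ P) = (\<Sum>P\<in>{Q}. axis Q 1 $ P * x $ P)"
        by (intro sum.mono_neutral_right) (auto simp: axis_def)
      ultimately show ?thesis by (simp add: axis_def)
    next
      case True
      then obtain m where m: "Q \<in> pencil m" using pencil_cover by blast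
      define A B C where "A = {m + 1, m + 3}" and "B = {m + 2, m + 6}" and "C = {m + 4, m + 5}"
      have ABC: "pencil m = {A, B, C}" "A \<noteq> B" "A \<noteq> C" "B \<noteq> C"
        by (auto simp: pencil_def A_def B_def C_def doubleton_eq_iff)
      have card: "card A = 2" "card B = 2" "card C = 2" using ABC(1) pencil_card by blast+
      have nz: "entry A B \<noteq> (0 :: 'a)" "entry A C \<noteq> (0 :: 'a)" "entry B C \<noteq> (0 :: 'a)"
        using entry_nonzero[where 'a = 'a] card pencil_complement[of _ m] ABC by simp_all
      have sym: "entry B A = (entry A B :: 'a)" "entry C A = (entry A C :: 'a)" "entry C B = (entry B C :: 'a)"
        using entry_sym card by blast+
      have "{A, B, C} - {A} = {B, C}" "{A, B, C} - {B} = {A, C}" "{A, B, C} - {C} = {A, B}"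
        using ABC by auto
      then have eqs: "entry A B * x $ B + entry A C * x $ C = 0" "entry A B * x $ A + entry B C * x $ C = 0"
        "entry A C * x $ A + entry B C * x $ B = 0"
        using eq[of A m] eq[of B m] eq[of C m] ABC by (simp_all add: sym)
      have "entry B C * (entry A B * x $ B - entry A C * x $ C) =
          entry A B * (entry A C * x $ A + entry B C * x $ B) - entry A C * (entry A B * x $ A + entry B C * x $ C)"
        by (simp add: algebra_simps)
      then have "entry B C * (entry A B * x $ B - entry A C * x $ C) = 0"
        unfolding eqs(2,3) by simp
      then have "entry A B * x $ B = entry A C * x $ C" using nz by simp
      then have "2 * (entry A C * x $ C) = 0" using eqs(1) by (simp only: mult_2)
      then have C: "x $ C = 0" using nz by simp
      then have "x $ A = 0" "x $ B = 0" using eqs(1,2) nz by simp_all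
      then show ?thesis using C m ABC by auto
    qed
    then show ?thesis by (simp add: Finite_Cartesian_Product.vec_eq_iff)
  qed
  then have "invertible (flattening fano_form :: 'a ^ (7 set) ^ (7 set))"
    unfolding invertible_left_inverse matrix_left_invertible_ker by blast
  then show ?thesis by (simp add: invertible_det_nz)
qed

section \<open>Tangent spaces of the parametrization\<close>

lemma alg_diff: "f \<in> alg G \<Longrightarrow> g \<in> alg G \<Longrightarrow> (\<lambda>x. f x - g x) \<in> alg G"
  using alg.add[OF _ alg.mult[OF alg.const[of "-1"]], of f G g] by simp

definition factor :: "'a::field ^ ('s::finite \<times> 3 \<times> 7) \<Rightarrow> 's \<Rightarrow> 3 \<Rightarrow> 'a ^ 7" where
  "factor x s k = (\<chi> j. x $ (s, k, j))"

text \<open>The parametrization of sums of decomposable trivectors, with one summand for each element of \<open>'s\<close>: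
  its image is the cone over the Grassmannian for \<open>'s = 1\<close>, and the cone over the union of the secant
  planes for \<open>'s = 3\<close>.\<close>

definition wedge_sum :: "'a::field ^ ('s::finite \<times> 3 \<times> 7) \<Rightarrow> 'a ^ (7 set)" where
  "wedge_sum x = (\<Sum>s\<in>UNIV. wedge [factor x s 0, factor x s 1, factor x s 2])"

definition wedge_sum_deriv :: "'a::field ^ ('s::finite \<times> 3 \<times> 7) \<Rightarrow> 'a ^ ('s \<times> 3 \<times> 7) \<Rightarrow> 'a ^ (7 set)" where
  "wedge_sum_deriv p b = (\<Sum>s\<in>UNIV. wedge [factor b s 0, factor p s 1, factor p s 2]
     + wedge [factor p s 0, factor b s 1, factor p s 2] + wedge [factor p s 0, factor p s 1, factor b s 2])"

lemma factor_add: "factor (x + y) s k = factor x s k + factor y s k"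
  and factor_scale: "factor (c *s x) s k = c *s factor x s k"
  by (simp_all add: factor_def Finite_Cartesian_Product.vec_eq_iff)

lemma wedge_sum_alg:
  "(\<lambda>x :: 'a::field ^ ('s::finite \<times> 3 \<times> 7). wedge_sum x $ S) \<in> alg coords"
proof -
  have *: "(\<lambda>x :: 'a ^ ('s \<times> 3 \<times> 7). wedge [factor x s 0, factor x s 1, factor x s 2] $ S) \<in> alg coords" for s
  proof (cases "card S = 3")
    case True
    have "(\<lambda>x :: 'a ^ ('s \<times> 3 \<times> 7). factor x s k $ j) \<in> alg coords" for k j
      by (simp add: factor_def coord_alg)
    then have "(\<lambda>x :: 'a ^ ('s \<times> 3 \<times> 7). minor3 (factor x s 0) (factor x s 1) (factor x s 2) i j k) \<in> alg coords" for i j k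
      unfolding minor3_def by (intro alg.add alg_diff alg.mult)
    then show ?thesis using True by (simp add: wedge3_nth)
  next
    case False
    then show ?thesis by (simp add: wedge3_nth alg.const)
  qed
  then show ?thesis unfolding wedge_sum_def by (simp add: alg_sum)
qed

lemma wedge_sum_scale: "wedge_sum (c *s x) = c ^ 3 *s wedge_sum x"
  by (simp add: wedge_sum_def factor_scale wedge3.scale1 wedge3.scale2 wedge3.scale3
      vec.scale_sum_right power3_eq_cube mult.assoc)

lemma wedge_sum_deriv_linear:
  "wedge_sum_deriv p (x + y) = wedge_sum_deriv p x + wedge_sum_deriv p y"
  "wedge_sum_deriv p (c *s x) = c *s wedge_sum_deriv p x"
  by (simp_all add: wedge_sum_deriv_def factor_add factor_scale wedge3.add1 wedge3.add2 wedge3.add3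
      wedge3.scale1 wedge3.scale2 wedge3.scale3 sum.distrib vec.scale_sum_right vec.scale_right_distrib
      algebra_simps)

lemma wedge_sum_deriv_radial: "wedge_sum_deriv p p = 3 *s wedge_sum p"
proof -
  have "v + v + v = 3 *s v" for v :: "'a ^ (7 set)"
    by (simp add: Finite_Cartesian_Product.vec_eq_iff)
  then show ?thesis by (simp add: wedge_sum_deriv_def wedge_sum_def vec.scale_sum_right)
qed

lemma wedge_sum_curve:
  fixes p b :: "'a::field ^ ('s::finite \<times> 3 \<times> 7)"
  shows "\<exists>q. (\<forall>t. wedge_sum (p + t *s b) $ S = poly q t) \<and> coeff q 1 = wedge_sum_deriv p b $ S"
proof -
  let ?w = "\<lambda>x y z s. wedge [factor x s 0, factor y s 1, factor z s 2] $ S"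
  define q where "q = (\<Sum>s\<in>UNIV. [:?w p p p s, ?w b p p s + ?w p b p s + ?w p p b s,
    ?w b b p s + ?w b p b s + ?w p b b s, ?w b b b s:])"
  have "wedge_sum (p + t *s b) $ S = poly q t" for t
    unfolding wedge_sum_def q_def poly_sum sum_component
    by (intro sum.cong refl)
      (simp add: factor_add factor_scale wedge3.add1 wedge3.add2 wedge3.add3
        wedge3.scale1 wedge3.scale2 wedge3.scale3 algebra_simps)
  moreover have "coeff q 1 = wedge_sum_deriv p b $ S"
    by (simp add: q_def wedge_sum_deriv_def coeff_sum)
  ultimately show ?thesis by blast
qed

definition place :: "'s::finite \<Rightarrow> 3 \<Rightarrow> 'a::field ^ 7 \<Rightarrow> 'a ^ ('s \<times> 3 \<times> 7)" where
  "place s k y = (\<chi> i. case i of (s', k', j) \<Rightarrow> if s' = s \<and> k' = k then y $ j else 0)"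

lemma factor_place: "factor (place s k y) s' k' = (if s' = s \<and> k' = k then y else 0)"
  by (auto simp: factor_def place_def Finite_Cartesian_Product.vec_eq_iff)

lemma wedge3_zero: "wedge [0, v, w] = (0 :: 'a::field ^ ('n::{finite, linorder} set))"
  "wedge [u, 0, w] = (0 :: 'a::field ^ ('n::{finite, linorder} set))"
  "wedge [u, v, 0] = (0 :: 'a::field ^ ('n::{finite, linorder} set))"
  by (simp_all add: Finite_Cartesian_Product.vec_eq_iff wedge3_nth minor3_def)

text \<open>Vary one of the factors of one summand and keep the others.\<close>

lemma tangent_vectors:
  "wedge [y, factor p s 1, factor p s 2] \<in> range (wedge_sum_deriv p)"
  "wedge [factor p s 0, y, factor p s 2] \<in> range (wedge_sum_deriv p)"
  "wedge [factor p s 0, factor p s 1, y] \<in> range (wedge_sum_deriv p)"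
proof -
  have *: "wedge_sum_deriv p (place s k y) =
      (if k = 0 then wedge [y, factor p s 1, factor p s 2] else if k = 1 then wedge [factor p s 0, y, factor p s 2]
       else wedge [factor p s 0, factor p s 1, y])" for k
  proof -
    have "k = 0 \<or> k = 1 \<or> k = 2" using exhaust_3[of k] by auto
    moreover have "wedge_sum_deriv p (place s k y) = (\<Sum>s'\<in>{s}. wedge [factor (place s k y) s' 0, factor p s' 1, factor p s' 2]
        + wedge [factor p s' 0, factor (place s k y) s' 1, factor p s' 2]
        + wedge [factor p s' 0, factor p s' 1, factor (place s k y) s' 2])"
      unfolding wedge_sum_deriv_def
      by (rule sum.mono_neutral_right) (auto simp: factor_place wedge3_zero)
    ultimately show ?thesis by (auto simp: factor_place wedge3_zero)
  qed
  show "wedge [y, factor p s 1, factor p s 2] \<in> range (wedge_sum_deriv p)"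
    using *[of 0] by (metis rangeI)
  show "wedge [factor p s 0, y, factor p s 2] \<in> range (wedge_sum_deriv p)"
    using *[of 1] by (metis rangeI zero_neq_one)
  have "(2 :: 3) \<noteq> 0" "(2 :: 3) \<noteq> 1" by simp_all
  then show "wedge [factor p s 0, factor p s 1, y] \<in> range (wedge_sum_deriv p)"
    using *[of 2] by (metis rangeI)
qed

lemma range_deriv_subspace: "vec.subspace (range (wedge_sum_deriv p))"
  unfolding vec.subspace_def
proof (intro conjI ballI allI)
  have "wedge_sum_deriv p 0 = 0" using wedge_sum_deriv_linear(2)[of p 0 0] by simp
  then show "0 \<in> range (wedge_sum_deriv p)" by (metis rangeI)
qed (auto simp flip: wedge_sum_deriv_linear)

lemma wedge3_axis_sign:
  fixes i j k :: "'n::{finite, linorder}"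
  assumes dist: "i \<noteq> j" "i \<noteq> k" "j \<noteq> k"
  shows "wedge [axis i 1, axis j 1, axis k 1] = axis {i, j, k} (1 :: 'a::field) \<or>
    wedge [axis i 1, axis j 1, axis k 1] = - axis {i, j, k} (1 :: 'a)"
proof -
  have *: "wedge [axis i 1, axis j 1, axis k 1] = axis {i, j, k} (1 :: 'a) \<or>
      wedge [axis i 1, axis j 1, axis k 1] = - axis {i, j, k} (1 :: 'a)" if ijk: "i < j" "i \<noteq> k" "j \<noteq> k" for i j k :: 'n
  proof -
    consider "j < k" | "i < k" "k < j" | "k < i" using ijk by (metis linorder_less_linear)
    then show ?thesis
    proof cases
      case 1 then show ?thesis using ijk by (simp add: wedge3_axis)
    next
      case 2
      then have "wedge [axis i 1, axis k 1, axis j 1] = axis {i, k, j} (1 :: 'a)" by (simp add: wedge3_axis)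
      then show ?thesis using wedge3.swap23[of "axis i 1" "axis j 1" "axis k (1 :: 'a)"] by (simp add: insert_commute)
    next
      case 3
      then have "wedge [axis k 1, axis i 1, axis j 1] = axis {k, i, j} (1 :: 'a)" using ijk by (simp add: wedge3_axis)
      then show ?thesis
        using wedge3.swap23[of "axis i 1" "axis j 1" "axis k (1 :: 'a)"] wedge3.swap12[of "axis i 1" "axis k 1" "axis j (1 :: 'a)"]
        by (simp add: insert_commute)
    qed
  qed
  show ?thesis
  proof (cases "i < j")
    case True then show ?thesis using * dist by blast
  next
    case False
    then have "j < i" using dist by simp
    then show ?thesis
      using *[of j i k] dist wedge3.swap12[of "axis i 1" "axis j 1" "axis k (1 :: 'a)"]
      by (auto simp: insert_commute minus_equation_iff)
  qed
qed

lemma wedge3_axis_mem: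
  fixes R :: "('a::field ^ ('n::{finite, linorder} set)) set"
  assumes R: "vec.subspace R" and dist: "i \<noteq> j" "i \<noteq> k" "j \<noteq> k"
  shows "wedge [axis i 1, axis j 1, axis k 1] \<in> R \<longleftrightarrow> axis {i, j, k} 1 \<in> R"
  using wedge3_axis_sign[OF dist, where 'a = 'a] vec.subspace_neg[OF R]
  by (metis minus_minus)

lemma dim_ge_axes:
  assumes "\<And>S. S \<in> I \<Longrightarrow> axis S 1 \<in> R"
  shows "card I \<le> vec.dim (R :: ('a::field ^ 'i::finite) set)"
proof -
  have "vec.independent ((\<lambda>S. axis S 1 :: 'a ^ 'i) ` I)"
    by (rule vec.independent_mono[OF vec.independent_Basis]) (auto simp: cart_basis_def)
  then have "card ((\<lambda>S. axis S 1 :: 'a ^ 'i) ` I) \<le> vec.dim R"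
    by (intro vec.independent_card_le_dim) (use assms in auto)
  moreover have "inj_on (\<lambda>S. axis S 1 :: 'a ^ 'i) I"
    by (auto simp: inj_on_def axis_eq_axis)
  ultimately show ?thesis by (simp add: card_image)
qed

text \<open>Replacing one of three basis vectors by an arbitrary basis vector keeps the other two.\<close>

lemma coordinate_tangent:
  fixes p :: "'a::field ^ ('s::finite \<times> 3 \<times> 7)"
  assumes p: "factor p s 0 = axis a 1" "factor p s 1 = axis b 1" "factor p s 2 = axis c 1"
    and ij: "i \<in> {a, b, c}" "j \<in> {a, b, c}" and dist: "i \<noteq> j" "i \<noteq> k" "j \<noteq> k"
  shows "axis {i, j, k} 1 \<in> range (wedge_sum_deriv p)"
proof -
  note t = tangent_vectors[where y = "axis k 1" and p = p and s = s, unfolded p]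
  note m = wedge3_axis_mem[OF range_deriv_subspace, THEN iffD1]
  have "{i, j} = {b, c} \<or> {i, j} = {a, c} \<or> {i, j} = {a, b}" using ij dist(1) by auto
  then show ?thesis
  proof (elim disjE)
    assume e: "{i, j} = {b, c}"
    then have "axis {k, b, c} 1 \<in> range (wedge_sum_deriv p)" by (intro m t) (use dist in \<open>auto simp: doubleton_eq_iff\<close>)
    moreover have "{i, j, k} = {k, b, c}" using e by auto
    ultimately show ?thesis by simp
  next
    assume e: "{i, j} = {a, c}"
    then have "axis {a, k, c} 1 \<in> range (wedge_sum_deriv p)" by (intro m t) (use dist in \<open>auto simp: doubleton_eq_iff\<close>)
    moreover have "{i, j, k} = {a, k, c}" using e by auto
    ultimately show ?thesis by simp
  next
    assume e: "{i, j} = {a, b}"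
    then have "axis {a, b, k} 1 \<in> range (wedge_sum_deriv p)" by (intro m t) (use dist in \<open>auto simp: doubleton_eq_iff\<close>)
    moreover have "{i, j, k} = {a, b, k}" using e by auto
    ultimately show ?thesis by simp
  qed
qed

definition of_factors :: "('s::finite \<Rightarrow> 3 \<Rightarrow> 'a::field ^ 7) \<Rightarrow> 'a ^ ('s \<times> 3 \<times> 7)" where
  "of_factors f = (\<chi> i. case i of (s, k, j) \<Rightarrow> f s k $ j)"

lemma factor_of_factors: "factor (of_factors f) s k = f s k"
  by (simp add: factor_def of_factors_def)

definition offset :: "7 \<Rightarrow> 3 \<Rightarrow> 7" where
  "offset a k = (if k = 0 then a else if k = 1 then a + 1 else a + 2)"

definition grass_point :: "'a::field ^ (1 \<times> 3 \<times> 7)" where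
  "grass_point = of_factors (\<lambda>s k. axis (offset 0 k) 1)"

lemma grass_point_factors:
  "factor grass_point s 0 = axis 0 1" "factor grass_point s 1 = axis 1 1" "factor grass_point s 2 = axis 2 1"
  by (simp_all add: grass_point_def factor_of_factors offset_def)

lemma grass_point_rank: "12 \<le> vec.dim (range (wedge_sum_deriv (grass_point :: 'a::field ^ (1 \<times> 3 \<times> 7))))"
proof -
  define I where "I = (\<lambda>(i, k). insert k ({0, 1, 2} - {i})) ` ({0, 1, 2} \<times> ({3, 4, 5, 6} :: 7 set))"
  have "inj_on (\<lambda>(i, k). insert k ({0, 1, 2} - {i})) ({0, 1, 2} \<times> ({3, 4, 5, 6} :: 7 set))"
  proof (rule inj_onI, clarify)
    fix i k i' k' :: 7
    assume ik: "i \<in> {0, 1, 2}" "k \<in> {3, 4, 5, 6}" "i' \<in> {0, 1, 2}" "k' \<in> {3, 4, 5, 6}"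
      and eq: "insert k ({0, 1, 2} - {i}) = insert k' ({0, 1, 2} - {i'})"
    have k: "k \<notin> {0, 1, 2}" using ik(2) by auto
    have k': "k' \<notin> {0, 1, 2}" using ik(4) by auto
    have recover: "insert k (U - {i}) - U = {k} \<and> U - insert k (U - {i}) = {i}"
      if "i \<in> U" "k \<notin> U" for i k :: 7 and U
      using that by auto
    show "i = i' \<and> k = k'"
      using recover[OF ik(1) k] recover[OF ik(3) k'] unfolding eq by simp
  qed
  then have "card I = 12" unfolding I_def by (subst card_image) auto
  moreover have "axis S 1 \<in> range (wedge_sum_deriv (grass_point :: 'a ^ (1 \<times> 3 \<times> 7)))" if S: "S \<in> I" for S
  proof -
    note c = coordinate_tangent[of "grass_point :: 'a ^ (1 \<times> 3 \<times> 7)" 1, OF grass_point_factors]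
    obtain z where z: "S = (case z of (i, k) \<Rightarrow> insert k ({0, 1, 2} - {i}))"
      "z \<in> {0, 1, 2} \<times> {3, 4, 5, 6}"
      using S unfolding I_def by (rule imageE)
    obtain i k where ik': "z = (i, k)" by (cases z)
    have ik: "i \<in> {0, 1, 2}" "k \<in> {3, 4, 5, 6}" "S = insert k ({0, 1, 2} - {i})"
      using z unfolding ik' by (simp_all only: mem_Sigma_iff prod.case)
    have "S = {1, 2, k} \<or> S = {0, 2, k} \<or> S = {0, 1, k}"
      using ik(1) unfolding ik(3) by (elim insertE emptyE) (simp_all add: insert_Diff_if insert_commute)
    moreover have "0 \<noteq> k" "1 \<noteq> k" "2 \<noteq> k" using ik(2) by auto
    ultimately show ?thesis using c[of 1 2 k] c[of 0 2 k] c[of 0 1 k] by (elim disjE) simp_all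
  qed
  ultimately show ?thesis using dim_ge_axes[of I] by metis
qed

text \<open>With \<open>e\<^sub>i\<close> the basis vectors, the three summands are \<open>e\<^sub>0 \<and> e\<^sub>1 \<and> e\<^sub>2\<close>, \<open>e\<^sub>3 \<and> e\<^sub>4 \<and> e\<^sub>5\<close> and
  \<open>(e\<^sub>0 + e\<^sub>3) \<and> (e\<^sub>1 + e\<^sub>4) \<and> e\<^sub>6\<close>. Up to a change of basis this is the general sum of three.\<close>

definition secant_point :: "'a::field ^ (3 \<times> 3 \<times> 7)" where
  "secant_point = of_factors (\<lambda>s k. if s = 0 then axis (offset 0 k) 1 else if s = 1 then axis (offset 3 k) 1
     else if k = 2 then axis 6 1 else axis (offset 0 k) 1 + axis (offset 3 k) 1)"

lemma secant_point_factors: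
  "factor secant_point 0 0 = axis 0 1" "factor secant_point 0 1 = axis 1 1" "factor secant_point 0 2 = axis 2 1"
  "factor secant_point 1 0 = axis 3 1" "factor secant_point 1 1 = axis 4 1" "factor secant_point 1 2 = axis 5 1"
  "factor secant_point 2 0 = axis 0 1 + axis 3 1" "factor secant_point 2 1 = axis 1 1 + axis 4 1"
  "factor secant_point 2 2 = axis 6 1"
  by (simp_all add: secant_point_def factor_of_factors offset_def)

lemma secant_point_coordinate: "wedge_sum secant_point $ {0, 1, 2} = (1 :: 'a::field)"
proof -
  have "(0 :: 7) < 1" "(1 :: 7) < 2"
    by (simp_all add: less_bit1_def bit1.Rep_0 bit1.Rep_1 bit1.Rep_numeral)
  then have "sorted_list_of_set {0, 1, 2 :: 7} = [0, 1, 2]" by (rule sorted_list_of_set_3)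
  then have w: "wedge [u, v, w] $ {0, 1, 2} = minor3 u v w 0 1 2" for u v w :: "'a ^ 7"
    by (simp add: wedge3_nth)
  have "x = 0 \<or> x = 1 \<or> x = 2" for x :: 3 using exhaust_3[of x] by auto
  then have U: "(UNIV :: 3 set) = {0, 1, 2}" by blast
  have ax: "axis i 1 $ j = (if i = j then 1 else 0 :: 'a)" for i j :: 7 by (auto simp: axis_def)
  have "minor3 (axis 0 1) (axis 1 1) (axis 2 1) 0 1 (2 :: 7) = (1 :: 'a)"
    "minor3 (axis 3 1) (axis 4 1) (axis 5 1) 0 1 (2 :: 7) = (0 :: 'a)"
    "minor3 (axis 0 1 + axis 3 1) (axis 1 1 + axis 4 1) (axis 6 1) 0 1 (2 :: 7) = (0 :: 'a)"
    by (simp_all add: minor3_def ax)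
  moreover have "wedge_sum secant_point $ {0, 1, 2} = (\<Sum>s\<in>{0, 1, 2 :: 3}. minor3 (factor secant_point s 0)
      (factor secant_point s 1) (factor secant_point s 2) 0 1 2 :: 'a)"
    unfolding wedge_sum_def U sum_component w ..
  ultimately show ?thesis by (simp add: secant_point_factors)
qed

lemma card_triples_7: "card {S :: 7 set. card S = 3} = 35"
proof -
  have "card {S :: 7 set. S \<subseteq> UNIV \<and> card S = 3} = card (UNIV :: 7 set) choose 3"
    by (rule n_subsets) simp
  then show ?thesis by (simp add: eval_nat_numeral)
qed

text \<open>The first two summands contribute all basis trivectors with two factors among \<open>e\<^sub>0, e\<^sub>1, e\<^sub>2\<close> or two
  among \<open>e\<^sub>3, e\<^sub>4, e\<^sub>5\<close>. The others are \<open>e\<^sub>i \<and> e\<^sub>j \<and> e\<^sub>6\<close> with \<open>i\<close> in the first and \<open>j\<close> in the second group.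
  Modulo the former, the third summand contributes those with \<open>i \<in> {0, 1}\<close> or \<open>j \<in> {3, 4}\<close>, so all but
  the one with \<open>i = 2\<close> and \<open>j = 5\<close>.\<close>

lemma secant_point_rank: "34 \<le> vec.dim (range (wedge_sum_deriv (secant_point :: 'a::field ^ (3 \<times> 3 \<times> 7))))"
proof -
  define R where "R = range (wedge_sum_deriv (secant_point :: 'a ^ (3 \<times> 3 \<times> 7)))"
  have R: "vec.subspace R" unfolding R_def by (rule range_deriv_subspace)
  have A: "axis {i, j, k} 1 \<in> R" if "i \<in> {0, 1, 2}" "j \<in> {0, 1, 2}" "i \<noteq> j" "i \<noteq> k" "j \<noteq> k" for i j k
    unfolding R_def by (rule coordinate_tangent[OF secant_point_factors(1-3)]) (use that in auto)
  have B: "axis {i, j, k} 1 \<in> R" if "i \<in> {3, 4, 5}" "j \<in> {3, 4, 5}" "i \<noteq> j" "i \<noteq> k" "j \<noteq> k" for i j k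
    unfolding R_def by (rule coordinate_tangent[OF secant_point_factors(4-6)]) (use that in auto)
  let ?e = "\<lambda>i :: 7. axis i (1 :: 'a)"
  have AA: "wedge [?e i, ?e j, ?e 6] \<in> R" if "i \<in> {0, 1, 2}" "j \<in> {0, 1, 2}" for i j
  proof (cases "i = j")
    case True then show ?thesis using vec.subspace_0[OF R] by (simp add: wedge3.eq12)
  next
    case False
    then show ?thesis using wedge3_axis_mem[OF R, of i j 6] A[OF that False, of 6] that by auto
  qed
  have BB: "wedge [?e i, ?e j, ?e 6] \<in> R" if "i \<in> {3, 4, 5}" "j \<in> {3, 4, 5}" for i j
  proof (cases "i = j")
    case True then show ?thesis using vec.subspace_0[OF R] by (simp add: wedge3.eq12)
  next
    case False
    then show ?thesis using wedge3_axis_mem[OF R, of i j 6] B[OF that False, of 6] that by auto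
  qed
  have t: "wedge [y, ?e 1, ?e 6] + wedge [y, ?e 4, ?e 6] \<in> R" "wedge [?e 0, y, ?e 6] + wedge [?e 3, y, ?e 6] \<in> R" for y
    using tangent_vectors(1,2)[where y = y and p = secant_point and s = 2, unfolded secant_point_factors]
    by (simp_all add: R_def wedge3.add1 wedge3.add2)
  have cancel: "w \<in> R" if "v + w \<in> R" "v \<in> R" for v w :: "'a ^ (7 set)"
    using vec.subspace_diff[OF R that] by simp
  have C: "axis {i, j, 6} 1 \<in> R" if ij: "i \<in> {0, 1, 2}" "j \<in> {3, 4, 5}" "i \<noteq> 2 \<or> j \<noteq> 5" for i j
  proof -
    have i4: "wedge [?e i, ?e 4, ?e 6] \<in> R" using cancel[OF t(1) AA[OF ij(1)]] by simp
    have j1: "wedge [?e j, ?e 1, ?e 6] \<in> R" using cancel[OF _ BB[OF ij(2)], of 4] t(1)[of "?e j"] by (simp add: add.commute)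
    have i3: "wedge [?e 3, ?e i, ?e 6] \<in> R" using cancel[OF t(2) AA[OF _ ij(1)]] by simp
    have j0: "wedge [?e 0, ?e j, ?e 6] \<in> R" using cancel[OF _ BB[OF _ ij(2)], of 3] t(2)[of "?e j"] by (simp add: add.commute)
    note m = wedge3_axis_mem[OF R, THEN iffD1]
    have "axis {i, 4, 6} 1 \<in> R" by (rule m[OF _ _ _ i4]) (use ij in auto)
    moreover have "axis {j, 1, 6} 1 \<in> R" by (rule m[OF _ _ _ j1]) (use ij in auto)
    moreover have "axis {3, i, 6} 1 \<in> R" by (rule m[OF _ _ _ i3]) (use ij in auto)
    moreover have "axis {0, j, 6} 1 \<in> R" by (rule m[OF _ _ _ j0]) (use ij in auto)
    moreover have "j = 4 \<or> i = 1 \<or> j = 3 \<or> i = 0" using ij by auto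
    ultimately show ?thesis by (auto simp: insert_commute)
  qed
  have "axis S 1 \<in> R" if S: "card S = 3" "S \<noteq> {2, 5, 6}" for S
  proof -
    obtain i j k where ijk: "S = {i, j, k}" "i \<noteq> j" "i \<noteq> k" "j \<noteq> k"
      using S(1) by (auto simp: card_3_iff)
    define U V where "U = {0, 1, 2 :: 7}" and "V = {3, 4, 5 :: 7}"
    have cls: "x \<in> U \<or> x \<in> V \<or> x = 6" for x using exhaust_7[of x] by (auto simp: U_def V_def)
    have "axis {i, j, k} 1 \<in> R" if "S = {i, j, k}" "i \<noteq> j" "i \<noteq> k" "j \<noteq> k"
      "i \<in> U \<and> j \<in> U \<or> i \<in> V \<and> j \<in> V \<or> i \<in> U \<and> j \<in> V \<and> k = 6" for i j k
    proof -
      have "i \<noteq> 2 \<or> j \<noteq> 5" if "k = 6" using that \<open>S = {i, j, k}\<close> S(2) by auto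
      then show ?thesis using that A[of i j k] B[of i j k] C[of i j] unfolding U_def V_def by blast
    qed
    note r = this
    have eqs: "S = {i, k, j}" "S = {j, k, i}" "S = {j, i, k}" "S = {k, i, j}" "S = {k, j, i}"
      using ijk(1) by auto
    have "(i \<in> U \<and> j \<in> U \<or> i \<in> V \<and> j \<in> V \<or> i \<in> U \<and> j \<in> V \<and> k = 6)
      \<or> (i \<in> U \<and> k \<in> U \<or> i \<in> V \<and> k \<in> V \<or> i \<in> U \<and> k \<in> V \<and> j = 6)
      \<or> (j \<in> U \<and> k \<in> U \<or> j \<in> V \<and> k \<in> V \<or> j \<in> U \<and> k \<in> V \<and> i = 6)
      \<or> j \<in> U \<and> i \<in> V \<and> k = 6 \<or> k \<in> U \<and> i \<in> V \<and> j = 6 \<or> k \<in> U \<and> j \<in> V \<and> i = 6"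
      using cls[of i] cls[of j] cls[of k] ijk(2-4) by (elim disjE) simp_all
    then consider (1) "i \<in> U \<and> j \<in> U \<or> i \<in> V \<and> j \<in> V \<or> i \<in> U \<and> j \<in> V \<and> k = 6"
      | (2) "i \<in> U \<and> k \<in> U \<or> i \<in> V \<and> k \<in> V \<or> i \<in> U \<and> k \<in> V \<and> j = 6"
      | (3) "j \<in> U \<and> k \<in> U \<or> j \<in> V \<and> k \<in> V \<or> j \<in> U \<and> k \<in> V \<and> i = 6"
      | (4) "j \<in> U \<and> i \<in> V \<and> k = 6" | (5) "k \<in> U \<and> i \<in> V \<and> j = 6" | (6) "k \<in> U \<and> j \<in> V \<and> i = 6"
      by argo
    then show ?thesis
    proof cases
      case 1 then show ?thesis using r[OF ijk] ijk(1) by simp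
    next
      case 2 then show ?thesis using r[OF eqs(1)] ijk(2-4) eqs(1) by auto
    next
      case 3 then show ?thesis using r[OF eqs(2)] ijk(2-4) eqs(2) by auto
    next
      case 4 then show ?thesis using r[OF eqs(3)] ijk(2-4) eqs(3) by auto
    next
      case 5 then show ?thesis using r[OF eqs(4)] ijk(2-4) eqs(4) by auto
    next
      case 6 then show ?thesis using r[OF eqs(5)] ijk(2-4) eqs(5) by auto
    qed
  qed
  then have "card ({S :: 7 set. card S = 3} - {{2, 5, 6}}) \<le> vec.dim R"
    by (intro dim_ge_axes) auto
  moreover have "card ({S :: 7 set. card S = 3} - {{2, 5, 6}}) = 34"
    by (subst card_Diff_singleton) (simp_all add: card_triples_7)
  ultimately show ?thesis by (simp add: R_def)
qed

section \<open>The third secant variety\<close>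

lemma span_singleton_in_proj:
  assumes "v \<noteq> 0" "v \<in> V" "vec.subspace V"
  shows "vec.span {v} \<in> proj V"
proof -
  have "vec.dim (vec.span {v}) = 1"
    using assms(1) vec.dim_span_eq_card_independent[of "{v}"] by simp
  then show ?thesis using assms vec.span_minimal[of "{v}" V] by (auto simp: proj_def)
qed

lemma grassmannian3_basis:
  assumes "U \<in> grassmannian 3"
  obtains u v w where "plucker U = vec.span {wedge [u, v, w]}"
proof -
  obtain B where B: "B \<subseteq> U" "vec.independent B" "U \<subseteq> vec.span B" "card B = vec.dim U"
    using vec.basis_exists by blast
  have U: "vec.subspace U" "vec.dim U = 3" using assms by (auto simp: grassmannian_def)
  have "vec.span B = U" using B U vec.span_minimal[of B U] by blast
  moreover obtain vs where vs: "set vs = B" "distinct vs"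
    using finite_distinct_list vec.finiteI_independent[OF B(2)] by blast
  ultimately have "is_basis vs U" using B(2) by (simp add: is_basis_def)
  moreover have "length vs = 3" using vs B(4) U(2) distinct_card[of vs] by simp
  then obtain u v w where "vs = [u, v, w]" by (auto simp: numeral_3_eq_3 length_Suc_conv)
  ultimately show ?thesis using that plucker_eq by blast
qed

lemma wedge3_in_plucker:
  assumes "wedge [u, v, w] \<noteq> 0"
  shows "vec.span {wedge [u, v, w]} \<in> plucker ` grassmannian 3"
proof -
  have b: "is_basis [u, v, w] (vec.span {u, v, w})" by (rule wedge3_nonzero_basis[OF assms])
  then have "card {u, v, w} = 3" "vec.independent {u, v, w}" by (auto simp: is_basis_def)
  then have "vec.span {u, v, w} \<in> grassmannian 3"
    by (simp add: grassmannian_def vec.dim_eq_card_independent)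
  moreover have "plucker (vec.span {u, v, w}) = vec.span {wedge [u, v, w]}" by (rule plucker_eq[OF b])
  ultimately show ?thesis by (metis imageI)
qed

lemma flat_row_linear:
  "flat_row (x + y) a b = flat_row x a b + flat_row y a b"
  "flat_row (c *s x) a b = c *s flat_row x a b"
  "flat_row 0 a b = 0"
  by (simp_all add: flat_row_def vec.scale_left_distrib sum.distrib vec.scale_sum_right)

lemma det_flattening_secant:
  fixes p :: "nat \<Rightarrow> ('a::field ^ (7 set)) set"
  assumes p: "\<And>i. i < 3 \<Longrightarrow> p i \<in> plucker ` grassmannian 3" and \<omega>: "\<omega> \<in> vec.span (\<Union>i<3. p i)"
  shows "Determinants.det (flattening \<omega>) = 0"
proof -
  have "\<exists>T. finite T \<and> card T \<le> 6 \<and> (\<forall>x\<in>p i. \<forall>a b. flat_row x a b \<in> vec.span T)" if i: "i < 3" for i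
  proof -
    obtain U where "U \<in> grassmannian 3" "p i = plucker U" using p[OF i] by blast
    then obtain u v w where uvw: "p i = vec.span {wedge [u, v, w]}" using grassmannian3_basis by metis
    obtain T where T: "finite T" "card T \<le> 6" "\<And>a b. vol_row u v w a b \<in> vec.span T"
      using vol_row_rank[of u v w] by blast
    have "flat_row x a b \<in> vec.span T" if "x \<in> p i" for x a b
      using that T(3) by (auto simp: uvw vec.span_singleton flat_row_linear flat_row_wedge vec.span_scale)
    then show ?thesis using T(1,2) by blast
  qed
  then obtain T where T: "\<And>i. i < 3 \<Longrightarrow> finite (T i) \<and> card (T i) \<le> 6"
    "\<And>i x a b. i < 3 \<Longrightarrow> x \<in> p i \<Longrightarrow> flat_row x a b \<in> vec.span (T i)" by metis
  define T' where "T' = (\<Union>i<3. T i)"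
  have "card T' \<le> (\<Sum>i<3. card (T i))" unfolding T'_def by (rule card_UN_le) simp
  also have "\<dots> \<le> (\<Sum>i<(3::nat). 6)" by (rule sum_mono) (use T(1) in auto)
  finally have card: "card T' \<le> 18" by simp
  have "vec.subspace {x. \<forall>a b. flat_row x a b \<in> vec.span T'}"
    unfolding vec.subspace_def
    by (auto simp: flat_row_linear vec.span_zero vec.span_add vec.span_scale)
  moreover have "(\<Union>i<3. p i) \<subseteq> {x. \<forall>a b. flat_row x a b \<in> vec.span T'}"
  proof (intro subsetI CollectI allI)
    fix x a b assume "x \<in> (\<Union>i<3. p i)"
    then obtain i where i: "i < 3" "x \<in> p i" by blast
    have "vec.span (T i) \<subseteq> vec.span T'"
      by (rule vec.span_mono) (use i in \<open>auto simp: T'_def\<close>)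
    then show "flat_row x a b \<in> vec.span T'" using T(2)[OF i] by blast
  qed
  ultimately have "flat_row \<omega> a b \<in> vec.span T'" for a b
    using vec.span_minimal \<omega> by blast
  then show ?thesis using card T(1) by (intro det_flattening_zero[of T']) (auto simp: T'_def)
qed

text \<open>A summand that vanishes comes from dependent factors and determines no point of the Grassmannian;
  any point can take its place, since zero lies in every line.\<close>

lemma wedge_sum_in_secant_span:
  fixes x :: "'a::field ^ (3 \<times> 3 \<times> 7)"
  shows "\<exists>p\<in>{..<3::nat} \<rightarrow> plucker ` grassmannian 3. wedge_sum x \<in> vec.span (\<Union>i<3. p i)"
proof -
  define v where "v s = wedge [factor x s 0, factor x s 1, factor x s 2]" for s
  have "wedge [axis 0 1, axis 1 1, axis 2 1] = axis {0, 1, 2 :: 7} (1 :: 'a) \<or>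
      wedge [axis 0 1, axis 1 1, axis 2 1] = - axis {0, 1, 2 :: 7} (1 :: 'a)"
    by (rule wedge3_axis_sign) simp_all
  then have "wedge [axis 0 1, axis 1 1, axis 2 1 :: 'a ^ 7] \<noteq> 0" by auto
  from wedge3_in_plucker[OF this] obtain M :: "('a ^ (7 set)) set" where M: "M \<in> plucker ` grassmannian 3" by blast
  define p where "p i = (if v (of_nat i) = 0 then M else vec.span {v (of_nat i)})" for i :: nat
  have "p \<in> {..<3} \<rightarrow> plucker ` grassmannian 3"
    using M wedge3_in_plucker by (auto simp: p_def v_def)
  moreover have "v s \<in> vec.span (\<Union>i<3. p i)" for s
  proof (cases "v s = 0")
    case True then show ?thesis by (simp add: vec.span_zero)
  next
    case False
    have "s = of_nat 0 \<or> s = of_nat 1 \<or> s = of_nat 2" using exhaust_3[of s] by auto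
    then have "\<exists>i<3. s = of_nat i" 
      by (elim disjE) (rule exI[of _ 0], simp, rule exI[of _ 1], simp, rule exI[of _ 2], simp)
    then obtain i where i: "i < 3" "s = of_nat i" by blast
    have "v s \<in> p i" using False by (simp add: p_def flip: i(2)) (simp add: vec.span_base)
    then show ?thesis using i(1) by (intro vec.span_base) blast
  qed
  then have "wedge_sum x \<in> vec.span (\<Union>i<3. p i)"
    unfolding wedge_sum_def v_def by (intro vec.span_sum)
  ultimately show ?thesis by blast
qed

lemma wedge_sum_nonzero_deriv:
  fixes p :: "'a::field_char_0 ^ ('s::finite \<times> 3 \<times> 7)"
  shows "wedge_sum p \<noteq> 0 \<Longrightarrow> wedge_sum_deriv p p \<noteq> 0"
  by (simp add: wedge_sum_deriv_radial)

theorem mainTheorem4: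
  fixes W :: "('a::{alg_closed_field, field_char_0} ^ (7 set)) set"
    and X :: "('a ^ (7 set)) set set"
  assumes W: "W = exterior_power 3"
    and X: "X = plucker ` (grassmannian 3 :: ('a ^ 7) set set)"
  shows "proj_dim W = 34
    \<and> expected_dim W X 3 = 34
    \<and> secant_variety W X 3 \<noteq> proj W
    \<and> defective W X 3
    \<and> defectiveness W X 3 = 1
    \<and> variety_dim W (secant_variety W X 3) = 33"
proof -
  define J where "J = {S :: 7 set. card S = 3}"
  have WJ: "W = {x. \<forall>S. S \<notin> J \<longrightarrow> x $ S = 0}" by (simp add: W exterior_power_def J_def)
  have cardJ: "card J = 35" by (simp add: J_def card_triples_7)
  have proj: "proj_dim W = 34"
    unfolding proj_dim_def WJ dim_substandard_cart using cardJ by simp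
  have W_sub: "vec.subspace W" unfolding WJ vec.subspace_def by auto
  have wedge_W: "wedge [u, v, w] \<in> W" for u v w :: "'a ^ 7"
    by (simp add: W exterior_power_def wedge3_nth)
  have sum_W: "wedge_sum x \<in> W" for x :: "'a ^ ('s::finite \<times> 3 \<times> 7)"
    unfolding wedge_sum_def by (intro vec.subspace_sum[OF W_sub] wedge_W)
  \<comment> \<open>three times 11, plus 2, exceeds 34, so this bound makes the expected dimension 34\<close>
  have "enat 11 \<le> variety_dim W (X \<inter> proj W)"
  proof (rule variety_dim_ge[where \<psi> = wedge_sum and e = 3 and T = "wedge_sum_deriv grass_point" and p = grass_point])
    fix x :: "'a ^ (1 \<times> 3 \<times> 7)" assume x: "wedge_sum x \<noteq> 0"
    have s: "wedge_sum x = wedge [factor x 1 0, factor x 1 1, factor x 1 2]"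
      by (simp add: wedge_sum_def)
    then show "vec.span {wedge_sum x} \<in> X \<inter> proj W"
      using x wedge3_in_plucker span_singleton_in_proj[OF x sum_W W_sub] by (auto simp: X)
  next
    have "wedge_sum grass_point = wedge [axis 0 1, axis 1 1, axis 2 (1 :: 'a)]"
      by (simp add: wedge_sum_def grass_point_factors)
    then have "wedge_sum grass_point \<noteq> (0 :: 'a ^ (7 set))"
      using wedge3_axis_sign[of "0 :: 7" 1 2, where 'a = 'a] by auto
    then show "wedge_sum_deriv grass_point grass_point \<noteq> (0 :: 'a ^ (7 set))"
      by (rule wedge_sum_nonzero_deriv)
  next
    show "11 < vec.dim (range (wedge_sum_deriv (grass_point :: 'a ^ (1 \<times> 3 \<times> 7))))"
      using grass_point_rank[where 'a = 'a] by simp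
  next
    fix b :: "'a ^ (1 \<times> 3 \<times> 7)" and i
    show "\<exists>q. (\<forall>s. wedge_sum (grass_point + s *s b) $ i = poly q s) \<and> coeff q 1 = wedge_sum_deriv grass_point b $ i"
      by (rule wedge_sum_curve)
  qed (auto simp: wedge_sum_scale wedge_sum_deriv_linear intro: wedge_sum_alg wedge_sum_curve)
  moreover have "variety_dim W (X \<inter> proj W) = variety_dim W X"
    unfolding variety_dim_def
    using subtopology_restrict[of "zariski W" X] by (simp add: topspace_zariski Int_commute)
  ultimately have dimX: "enat 11 \<le> variety_dim W X" by simp
  have expected: "expected_dim W X 3 = 34"
  proof -
    have "enat 34 \<le> enat 3 * variety_dim W X + enat 3 - 1"
      using dimX by (cases "variety_dim W X") (auto simp: one_enat_def)
    then show ?thesis by (simp add: expected_dim_def proj min_def numeral_eq_enat)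
  qed
  define Y where "Y = secant_variety W X 3"
  let ?S = "\<Union>p\<in>{..<3::nat} \<rightarrow> X. proj (vec.span (\<Union>i<3. p i))"
  let ?f = "\<lambda>\<omega> :: 'a ^ (7 set). Determinants.det (flattening \<omega>)"
  have closedY: "closedin (zariski W) Y" unfolding Y_def secant_variety_def by simp
  then have Yproj: "Y \<subseteq> proj W" using closedin_subset topspace_zariski by metis
  have SY: "?S \<inter> proj W \<subseteq> Y"
    using closure_of_subset_Int[of "zariski W" ?S] by (simp add: Y_def secant_variety_def topspace_zariski Int_commute)
  have "?S \<inter> proj W \<subseteq> {L \<in> proj W. \<forall>x\<in>L. ?f x = 0}"
  proof clarify
    fix L p x assume p: "p \<in> {..<3::nat} \<rightarrow> X" and L: "L \<in> proj (vec.span (\<Union>i<3. p i))" and x: "x \<in> L"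
    have "x \<in> vec.span (\<Union>i<3. p i)" using L x by (auto simp: proj_def)
    then show "?f x = 0" using p by (intro det_flattening_secant[of p]) (auto simp: X Pi_iff)
  qed
  then have "zariski W closure_of (?S \<inter> proj W) \<subseteq> {L \<in> proj W. \<forall>x\<in>L. ?f x = 0}"
    by (intro closure_of_minimal closedin_vanishing det_flattening_alg)
  then have Y_zero: "Y \<subseteq> {L \<in> proj W. \<forall>x\<in>L. ?f x = 0}"
    using closure_of_restrict[of "zariski W" ?S] by (simp add: Y_def secant_variety_def topspace_zariski Int_commute)
  have fano_W: "fano_form \<in> W" by (auto simp: W exterior_power_def fano_form_def)
  have "fano_form \<noteq> (0 :: 'a ^ (7 set))"
  proof
    assume "fano_form = (0 :: 'a ^ (7 set))"
    then have "(fano_form :: 'a ^ (7 set)) $ {0, 0 + 1, 0 + 3} = 0" by simp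
    moreover have "(fano_form :: 'a ^ (7 set)) $ {0, 0 + 1, 0 + 3} = 1"
    proof -
      have "{0, 0 + 1, 0 + 3} \<in> range (\<lambda>m :: 7. {m, m + 1, m + 3})" by (rule rangeI)
      then show ?thesis unfolding fano_form_def by (simp only: vec_lambda_beta if_True)
    qed
    ultimately show False by simp
  qed
  then have fano_line: "vec.span {fano_form} \<in> proj W" by (rule span_singleton_in_proj[OF _ fano_W W_sub])
  have proper: "Y \<noteq> proj W"
  proof
    assume "Y = proj W"
    then have "?f fano_form = 0" using fano_line Y_zero vec.span_base[of fano_form "{fano_form}"] by blast
    then show False using det_flattening_fano by blast
  qed
  have "variety_dim W Y \<le> enat 33"
    by (rule variety_dim_proper_le[OF WJ closedY proper]) (simp add: cardJ)
  moreover have "enat 33 \<le> variety_dim W Y"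
  proof (rule variety_dim_ge[where \<psi> = wedge_sum and e = 3 and T = "wedge_sum_deriv secant_point" and p = secant_point])
    fix x :: "'a ^ (3 \<times> 3 \<times> 7)" assume x: "wedge_sum x \<noteq> 0"
    obtain p where p: "p \<in> {..<3::nat} \<rightarrow> X" "wedge_sum x \<in> vec.span (\<Union>i<3. p i)"
      using wedge_sum_in_secant_span[of x] unfolding X by blast
    have "vec.span {wedge_sum x} \<in> proj (vec.span (\<Union>i<3. p i))"
      by (rule span_singleton_in_proj[OF x p(2)]) (rule vec.subspace_span)
    moreover have "vec.span {wedge_sum x} \<in> proj W" by (rule span_singleton_in_proj[OF x sum_W W_sub])
    ultimately show "vec.span {wedge_sum x} \<in> Y" using SY p(1) by blast
  next
    have "wedge_sum (secant_point :: 'a ^ (3 \<times> 3 \<times> 7)) $ {0, 1, 2} \<noteq> 0"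
      by (simp add: secant_point_coordinate)
    then have "wedge_sum secant_point \<noteq> (0 :: 'a ^ (7 set))" by auto
    then show "wedge_sum_deriv secant_point secant_point \<noteq> (0 :: 'a ^ (7 set))"
      by (rule wedge_sum_nonzero_deriv)
  next
    show "33 < vec.dim (range (wedge_sum_deriv (secant_point :: 'a ^ (3 \<times> 3 \<times> 7))))"
      using secant_point_rank[where 'a = 'a] by simp
  next
    fix b :: "'a ^ (3 \<times> 3 \<times> 7)" and i
    show "\<exists>q. (\<forall>s. wedge_sum (secant_point + s *s b) $ i = poly q s) \<and> coeff q 1 = wedge_sum_deriv secant_point b $ i"
      by (rule wedge_sum_curve)
  qed (auto simp: wedge_sum_scale wedge_sum_deriv_linear Yproj[THEN subsetD] intro: wedge_sum_alg wedge_sum_curve)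
  ultimately have dimY: "variety_dim W Y = enat 33" by simp
  show ?thesis
    unfolding defective_def defectiveness_def Y_def[symmetric] dimY expected
    using proj proper by (simp add: numeral_eq_enat one_enat_def)
qed

end
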